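(* Let $2\le n<\infty$, let $\mathcal{A}$ be a unital $C^*$-algebra and let $\phi:\mathcal{S}_n^d\to\mathcal{A}$ be a unital linear map. Then $\phi$ is completely positive if and only if $\phi$ is self-adjoint and \[w(A_1\otimes\phi(\delta_1)+\cdots+A_n\otimes\phi(\delta_n))\le\tfrac12\] for every $p\in\mathbb{N}$ and every row contraction $(A_1,\dots,A_n)$ in $M_p$.
   Context: $w$ denotes the numerical radius of an element of a unital $C^*$-algebra, here of $M_p\otimes\mathcal{A}=M_p(\mathcal{A})$ (supremum of $|f(x)|$ over states $f$). $(A_1,\dots,A_n)$ is a row contraction if $\sum_{i=1}^nA_iA_i^*\le I_p$. $\mathcal{O}_n$ is the Cuntz algebra, generated by isometries $S_1,\dots,S_n$ with $\sum_{i=1}^n S_iS_i^*=I$; $\mathcal{S}_n=\operatorname{span}\{I,S_1,\dots,S_n,S_1^*,\dots,S_n^*\}$, with basis $I,S_i,S_i^*$. $\mathcal{S}_n^d$ is the dual space of $\mathcal{S}_n$ with dual basis $\delta_0,\delta_i,\delta_i^*$ ($1\le i\le n$): $\delta_0(I)=1$, $\delta_0(S_j)=\delta_0(S_j^* )=0$; $\delta_i(I)=0$, $\delta_i(S_j)=\delta_{ij}$, $\delta_i(S_j^* )=0$; $\delta_i^*(I)=0$, $\delta_i^*(S_j^* )=\delta_{ij}$, $\delta_i^*(S_j)=0$, where $\delta_{ij}$ is the Kronecker delta. The involution is $f^*(x)=\overline{f(x^* )}$. The matrix order on $\mathcal{S}_n^d$ is: $(f_{kl})\in M_p(\mathcal{S}_n^d)^+$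 iff the map $\mathcal{S}_n\to M_p$, $x\mapsto(f_{kl}(x))$, is completely positive; with this order and Archimedean order unit $\delta_0$, $\mathcal{S}_n^d$ is an operator system. Unital means $\phi(\delta_0)=1$; self-adjoint means $\phi(f^* )=\phi(f)^*$. *)

theory Defs
  imports Complex_Main "HOL-Library.Extended_Real" "Jordan_Normal_Form.Matrix"
begin

section \<open>Unital C*-algebras\<close>

text \<open>Norm, completeness and \<open>norm 1 = 1\<close> come from \<^class>\<open>real_normed_algebra_1\<close> and \<^class>\<open>banach\<close>; the
  complex scaling extends the real one. In particular \<open>1 \<noteq> 0\<close>.\<close>

class unital_cstar_algebra = real_normed_algebra_1 + banach +
  fixes scaleC :: "complex \<Rightarrow> 'a \<Rightarrow> 'a" (infixr \<open>*\<^sub>C\<close> 75)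
    and star :: "'a \<Rightarrow> 'a"
  assumes scaleC_of_real: "complex_of_real r *\<^sub>C x = scaleR r x"
    and scaleC_add_right: "c *\<^sub>C (x + y) = c *\<^sub>C x + c *\<^sub>C y"
    and scaleC_add_left: "(c + d) *\<^sub>C x = c *\<^sub>C x + d *\<^sub>C x"
    and scaleC_scaleC: "c *\<^sub>C d *\<^sub>C x = (c * d) *\<^sub>C x"
    and norm_scaleC: "norm (c *\<^sub>C x) = cmod c * norm x"
    and mult_scaleC_left: "(c *\<^sub>C x) * y = c *\<^sub>C (x * y)"
    and mult_scaleC_right: "x * (c *\<^sub>C y) = c *\<^sub>C (x * y)"
    and star_star: "star (star x) = x"
    and star_add: "star (x + y) = star x + star y"
    and star_scaleC: "star (c *\<^sub>C x) = cnj c *\<^sub>C star x"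
    and star_mult: "star (x * y) = star y * star x"
    and cstar_identity: "norm (star x * x) = (norm x)\<^sup>2"

instantiation complex :: unital_cstar_algebra
begin

definition "scaleC_complex (c :: complex) (x :: complex) = c * x"
definition "star_complex (x :: complex) = cnj x"

instance
  by standard
    (auto simp: scaleC_complex_def star_complex_def scaleR_conv_of_real algebra_simps
      norm_mult power2_eq_square)

end

lemma vector_space_scaleC:
  "vector_space (scaleC :: complex \<Rightarrow> 'a \<Rightarrow> 'a::unital_cstar_algebra)"
proof (unfold_locales, goal_cases)
  case (4 x)
  show ?case using scaleC_of_real[of 1 x] by simp
qed (auto simp: scaleC_add_right scaleC_add_left scaleC_scaleC)

definition cspan :: "'a::unital_cstar_algebra set \<Rightarrow> 'a set" where
  "cspan = module.span scaleC"

definition cstar_subalgebra :: "'a::unital_cstar_algebra set \<Rightarrow> bool" where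
  "cstar_subalgebra B \<longleftrightarrow> closed B \<and> 1 \<in> B \<and>
     (\<forall>x\<in>B. \<forall>y\<in>B. x + y \<in> B \<and> x * y \<in> B) \<and> (\<forall>c. \<forall>x\<in>B. c *\<^sub>C x \<in> B) \<and> (\<forall>x\<in>B. star x \<in> B)"

definition cstar_generated :: "'a::unital_cstar_algebra set \<Rightarrow> 'a set" where
  "cstar_generated X = \<Inter>{B. cstar_subalgebra B \<and> X \<subseteq> B}"


section \<open>The C*-algebra of matrices over a C*-algebra\<close>

definition mat_star :: "'a::unital_cstar_algebra mat \<Rightarrow> 'a mat" where
  "mat_star X = mat (dim_col X) (dim_row X) (\<lambda>(i, j). star (X $$ (j, i)))"

definition mat_sum :: "nat \<Rightarrow> ('i \<Rightarrow> 'a::comm_monoid_add mat) \<Rightarrow> 'i set \<Rightarrow> 'a mat" where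
  "mat_sum p X I = mat p p (\<lambda>(k, l). \<Sum>i\<in>I. X i $$ (k, l))"

definition mat_positive :: "nat \<Rightarrow> 'a::unital_cstar_algebra mat set" where
  "mat_positive p = {mat_star Y * Y | Y. Y \<in> carrier_mat p p}"

definition mat_state :: "nat \<Rightarrow> ('a::unital_cstar_algebra mat \<Rightarrow> complex) \<Rightarrow> bool" where
  "mat_state p f \<longleftrightarrow>
     (\<forall>X\<in>carrier_mat p p. \<forall>Y\<in>carrier_mat p p. f (X + Y) = f X + f Y) \<and>
     (\<forall>c. \<forall>X\<in>carrier_mat p p. f (map_mat (scaleC c) X) = c * f X) \<and>
     (\<forall>X\<in>mat_positive p. f X \<in> \<real> \<and> 0 \<le> Re (f X)) \<and>
     f (1\<^sub>m p) = 1"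

text \<open>The supremum is taken in the extended reals, where it always exists; since a state satisfies
  \<open>\<bar>f(x)\<bar> \<le> \<parallel>x\<parallel>\<close> and the state space is nonempty for \<open>p \<ge> 1\<close>, it is the usual real supremum.\<close>

definition numerical_radius :: "nat \<Rightarrow> 'a::unital_cstar_algebra mat \<Rightarrow> ereal" where
  "numerical_radius p X = (SUP f\<in>{f. mat_state p f}. ereal (cmod (f X)))"

text \<open>The elementary tensor \<open>A \<otimes> a\<close> in \<open>M\<^sub>p \<otimes> \<A> = M\<^sub>p(\<A>)\<close>.\<close>

definition mat_tensor :: "complex mat \<Rightarrow> 'a::unital_cstar_algebra \<Rightarrow> 'a mat" where
  "mat_tensor A a = map_mat (\<lambda>c. c *\<^sub>C a) A"

definition row_contraction :: "nat \<Rightarrow> nat \<Rightarrow> (nat \<Rightarrow> complex mat) \<Rightarrow> bool" where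
  "row_contraction n p A \<longleftrightarrow>
     (\<forall>i\<in>{1..n}. A i \<in> carrier_mat p p) \<and>
     1\<^sub>m p - mat_sum p (\<lambda>i. A i * mat_star (A i)) {1..n} \<in> mat_positive p"


section \<open>Complete positivity\<close>

text \<open>A matrix order is a family \<open>C\<close> of cones, \<open>C q\<close> consisting of \<open>q \<times> q\<close> matrices.\<close>

definition completely_positive ::
    "(nat \<Rightarrow> 'v mat set) \<Rightarrow> (nat \<Rightarrow> 'w mat set) \<Rightarrow> ('v \<Rightarrow> 'w) \<Rightarrow> bool" where
  "completely_positive C D f \<longleftrightarrow> (\<forall>q\<ge>1. \<forall>X\<in>C q. map_mat f X \<in> D q)"

definition mat_flatten :: "nat \<Rightarrow> nat \<Rightarrow> 'a mat mat \<Rightarrow> 'a mat" where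
  "mat_flatten q p X =
     mat (q * p) (q * p) (\<lambda>(r, c). X $$ (r div p, c div p) $$ (r mod p, c mod p))"

text \<open>The matrix order of \<open>M\<^sub>p\<close>, with \<open>M\<^sub>q(M\<^sub>p)\<close> identified with \<open>M\<^sub>q\<^sub>p\<close> via block matrices.\<close>

definition matalg_positive :: "nat \<Rightarrow> nat \<Rightarrow> complex mat mat set" where
  "matalg_positive p q = {X \<in> carrier_mat q q. elements_mat X \<subseteq> carrier_mat p p \<and>
     mat_flatten q p X \<in> mat_positive (q * p)}"


section \<open>The Cuntz algebra, its generating operator system and the dual\<close>

text \<open>The ambient type is the Cuntz algebra with canonical generators \<open>S 1, \<dots>, S n\<close>.\<close>

definition cuntz_algebra :: "nat \<Rightarrow> (nat \<Rightarrow> 'o::unital_cstar_algebra) \<Rightarrow> bool" where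
  "cuntz_algebra n S \<longleftrightarrow>
     (\<forall>i\<in>{1..n}. star (S i) * S i = 1) \<and>
     (\<Sum>i\<in>{1..n}. S i * star (S i)) = 1 \<and>
     cstar_generated (S ` {1..n}) = UNIV"

definition cuntz_system :: "nat \<Rightarrow> (nat \<Rightarrow> 'o::unital_cstar_algebra) \<Rightarrow> 'o set" where
  "cuntz_system n S = cspan ({1} \<union> S ` {1..n} \<union> (star \<circ> S) ` {1..n})"

definition cuntz_system_positive :: "nat \<Rightarrow> (nat \<Rightarrow> 'o::unital_cstar_algebra) \<Rightarrow> nat \<Rightarrow> 'o mat set" where
  "cuntz_system_positive n S q = {X \<in> mat_positive q. elements_mat X \<subseteq> cuntz_system n S}"

text \<open>A functional on the operator system is represented by its extension by \<open>0\<close> to the whole type,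
  so that distinct elements of the set below are distinct functionals. The pointwise operations and
  the involution preserve this representation.\<close>

definition cuntz_dual :: "nat \<Rightarrow> (nat \<Rightarrow> 'o::unital_cstar_algebra) \<Rightarrow> ('o \<Rightarrow> complex) set" where
  "cuntz_dual n S = {f.
     (\<forall>x\<in>cuntz_system n S. \<forall>y\<in>cuntz_system n S. f (x + y) = f x + f y) \<and>
     (\<forall>c. \<forall>x\<in>cuntz_system n S. f (c *\<^sub>C x) = c * f x) \<and>
     (\<forall>x. x \<notin> cuntz_system n S \<longrightarrow> f x = 0)}"

definition delta_0 :: "nat \<Rightarrow> (nat \<Rightarrow> 'o::unital_cstar_algebra) \<Rightarrow> 'o \<Rightarrow> complex" where
  "delta_0 n S = (THE f. f \<in> cuntz_dual n S \<and> f 1 = 1 \<and>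
     (\<forall>j\<in>{1..n}. f (S j) = 0 \<and> f (star (S j)) = 0))"

definition delta :: "nat \<Rightarrow> (nat \<Rightarrow> 'o::unital_cstar_algebra) \<Rightarrow> nat \<Rightarrow> 'o \<Rightarrow> complex" where
  "delta n S i = (THE f. f \<in> cuntz_dual n S \<and> f 1 = 0 \<and>
     (\<forall>j\<in>{1..n}. f (S j) = (if i = j then 1 else 0) \<and> f (star (S j)) = 0))"

definition dual_star :: "('o::unital_cstar_algebra \<Rightarrow> complex) \<Rightarrow> 'o \<Rightarrow> complex" where
  "dual_star f = (\<lambda>x. cnj (f (star x)))"

definition cuntz_dual_positive ::
    "nat \<Rightarrow> (nat \<Rightarrow> 'o::unital_cstar_algebra) \<Rightarrow> nat \<Rightarrow> ('o \<Rightarrow> complex) mat set" where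
  "cuntz_dual_positive n S p = {F \<in> carrier_mat p p. elements_mat F \<subseteq> cuntz_dual n S \<and>
     completely_positive (cuntz_system_positive n S) (matalg_positive p)
       (\<lambda>x. map_mat (\<lambda>f. f x) F)}"

text \<open>Only the values of a map on \<^const>\<open>cuntz_dual\<close> are meaningful.\<close>

definition dual_linear ::
    "nat \<Rightarrow> (nat \<Rightarrow> 'o::unital_cstar_algebra) \<Rightarrow> (('o \<Rightarrow> complex) \<Rightarrow> 'a::unital_cstar_algebra) \<Rightarrow> bool" where
  "dual_linear n S \<phi> \<longleftrightarrow>
     (\<forall>f\<in>cuntz_dual n S. \<forall>g\<in>cuntz_dual n S. \<phi> (\<lambda>x. f x + g x) = \<phi> f + \<phi> g) \<and>
     (\<forall>c. \<forall>f\<in>cuntz_dual n S. \<phi> (\<lambda>x. c * f x) = c *\<^sub>C \<phi> f)"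

definition dual_self_adjoint ::
    "nat \<Rightarrow> (nat \<Rightarrow> 'o::unital_cstar_algebra) \<Rightarrow> (('o \<Rightarrow> complex) \<Rightarrow> 'a::unital_cstar_algebra) \<Rightarrow> bool" where
  "dual_self_adjoint n S \<phi> \<longleftrightarrow> (\<forall>f\<in>cuntz_dual n S. \<phi> (dual_star f) = star (\<phi> f))"

end

theory Submission
  imports Defs "Jordan_Normal_Form.Determinant"
begin

text \<open>A matrix over a C*-algebra is positive iff all its quadratic forms \<open>v\<^sup>* X v\<close> are positive, and iff all
  states are nonnegative on it; square roots come from the binomial series.

  An element of \<open>M\<^sub>p(\<S>\<^sub>n\<^sup>d)\<close> with coefficient \<open>I\<close> at \<open>\<delta>\<^sub>0\<close> is positive iff its coefficients \<open>A\<^sub>i\<close> at \<open>\<delta>\<^sub>i\<close> form a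
  row contraction and those at \<open>\<delta>\<^sub>i\<^sup>*\<close> are the adjoints. For necessity, evaluate the completely positive map
  at the positive block matrix of the row \<open>(1, S\<^sub>1, \<dots>, S\<^sub>n)\<close>. For sufficiency, a strict row contraction is
  a limit of compressions of the \<open>S\<^sub>i\<close> by the truncated Poisson kernel \<open>\<Sum> S\<^sub>w S\<^sub>1\<^sup>M S\<^sub>2 \<otimes> Y A\<^sub>w\<^sup>*\<close>, summed over the
  words \<open>w\<close> of length at most \<open>m + 1 < M\<close>, where \<open>Y\<^sup>* Y = I - \<Sum> A\<^sub>i A\<^sub>i\<^sup>*\<close>.

  Since rotating \<open>A\<close> by a unimodular scalar preserves row contractions, positivity of
  \<open>1 + T + T\<^sup>*\<close> for all \<open>T = \<Sum> A\<^sub>i \<otimes> \<phi>(\<delta>\<^sub>i)\<close> is the numerical radius condition; a general positive element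
  is reduced to this case by conjugating with a root of its (perturbed) \<open>\<delta>\<^sub>0\<close> coefficient.\<close>

section \<open>Square roots and positive elements\<close>

text \<open>Two obstacles shape the development. First, the size of a matrix is not part of its
  type, so matrices over a C*-algebra are not an instance of the class of C*-algebras, and the
  theory of positive elements does not apply to them. Forms with values in the algebra carry that
  theory over to matrices, and the square root is built a second time, entry by entry.

  Second, the Poisson kernel of a row contraction calls for a vacuum vector, orthogonal to the
  ranges of all S_i, and the relation sum S_i star(S_i) = 1 excludes one. The element S_1^M S_2
  behaves like a vacuum only as seen from words of length at most M; this forces the truncation and
  the limit, and it is where n >= 2 enters. The contribution of the omitted long words decays
  geometrically for a strict contraction, whence the scaling by s < 1. All computations stay inside
  the Cuntz algebra.

  In the same way F(1) may be singular; adding e to it makes its root invertible.\<close>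

fun sqrt_coeff :: "nat \<Rightarrow> real" where
  "sqrt_coeff 0 = 0"
| "sqrt_coeff (Suc 0) = 1 / 2"
| "sqrt_coeff (Suc (Suc m)) = (\<Sum>j\<le>m. sqrt_coeff (Suc j) * sqrt_coeff (Suc (m - j))) / 2"

lemma sqrt_coeff_nonneg: "0 \<le> sqrt_coeff m"
  by (induction m rule: sqrt_coeff.induct) (auto intro!: sum_nonneg)

text \<open>The term at m = 1 is the x in the functional equation. The coefficient at 0 vanishes, so
  both end terms of the convolution drop out and the recursion only sees smaller indices.\<close>

lemma sqrt_coeff_convolution:
  "(\<Sum>i\<le>m. sqrt_coeff i * sqrt_coeff (m - i)) = 2 * sqrt_coeff m - (if m = 1 then 1 else 0)"
proof (cases m rule: sqrt_coeff.cases)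
  case (3 k)
  have "(\<Sum>i\<le>m. sqrt_coeff i * sqrt_coeff (m - i))
      = (\<Sum>i\<le>k. sqrt_coeff (Suc i) * sqrt_coeff (Suc (k - i)))"
    unfolding 3 by (subst sum.atMost_Suc_shift, subst sum.atMost_Suc) (simp add: Suc_diff_le del: sqrt_coeff.simps(3) sum.atMost_Suc)
  then show ?thesis by (simp add: 3)
qed auto

text \<open>The generating function \<open>D\<close> satisfies \<open>2 D = x + D\<^sup>2\<close>, that is \<open>D = 1 - \<surd>(1 - x)\<close>;
  the same recursion keeps the partial sums below the fixed point \<open>1\<close>.\<close>

lemma sum_sqrt_coeff_le: "(\<Sum>m\<le>N. sqrt_coeff m) \<le> 1"
proof (induction N)
  case (Suc N)
  have "2 * (\<Sum>m\<le>Suc N. sqrt_coeff m)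
      = (\<Sum>m\<le>Suc N. (\<Sum>i\<le>m. sqrt_coeff i * sqrt_coeff (m - i)) + (if m = 1 then 1 else 0))"
    by (simp add: sqrt_coeff_convolution sum_distrib_left del: sum.atMost_Suc)
  also have "\<dots> = (\<Sum>m\<le>Suc N. \<Sum>i\<le>m. sqrt_coeff i * sqrt_coeff (m - i)) + 1"
    by (subst sum.distrib) (simp add: sum.delta del: sum.atMost_Suc)
  also have "(\<Sum>m\<le>Suc N. \<Sum>i\<le>m. sqrt_coeff i * sqrt_coeff (m - i))
      = (\<Sum>(m, i)\<in>(SIGMA m:{..Suc N}. {..m}). sqrt_coeff i * sqrt_coeff (m - i))"
    by (rule sum.Sigma) auto
  \<comment> \<open>Terms with \<open>i = 0\<close> or \<open>i = m\<close> vanish. In the others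
    both \<open>i\<close> and \<open>m - i\<close> lie between 1 and \<open>N\<close>, so the
    triangle fits into a square of side \<open>N\<close>.\<close>
  also have "\<dots> = (\<Sum>(m, i)\<in>(SIGMA m:{..Suc N}. {1..<m}). sqrt_coeff i * sqrt_coeff (m - i))"
  proof (rule sum.mono_neutral_right)
    show "\<forall>p\<in>(SIGMA m:{..Suc N}. {..m}) - (SIGMA m:{..Suc N}. {1..<m}).
        (case p of (m, i) \<Rightarrow> sqrt_coeff i * sqrt_coeff (m - i)) = 0"
    proof
      fix p assume "p \<in> (SIGMA m:{..Suc N}. {..m}) - (SIGMA m:{..Suc N}. {1..<m})"
      then obtain m i where "p = (m, i)" "i = 0 \<or> i = m" by fastforce
      then show "(case p of (m, i) \<Rightarrow> sqrt_coeff i * sqrt_coeff (m - i)) = 0" by auto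
    qed
  qed auto
  also have "\<dots> \<le> (\<Sum>(i, j)\<in>{..N} \<times> {..N}. sqrt_coeff i * sqrt_coeff j)"
  proof (rule sum_le_included[where i = "\<lambda>(i, j). (i + j, i)"])
    show "\<forall>p\<in>(SIGMA m:{..Suc N}. {1..<m}). \<exists>q\<in>{..N} \<times> {..N}. (case q of (i, j) \<Rightarrow> (i + j, i)) = p \<and>
        (case p of (m, i) \<Rightarrow> sqrt_coeff i * sqrt_coeff (m - i))
          \<le> (case q of (i, j) \<Rightarrow> sqrt_coeff i * sqrt_coeff j)"
    proof
      fix p assume "p \<in> (SIGMA m:{..Suc N}. {1..<m})"
      then obtain m i where "p = (m, i)" "i < m" "1 \<le> i" "m \<le> Suc N" by auto
      then show "\<exists>q\<in>{..N} \<times> {..N}. (case q of (i, j) \<Rightarrow> (i + j, i)) = p \<and>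
        (case p of (m, i) \<Rightarrow> sqrt_coeff i * sqrt_coeff (m - i))
          \<le> (case q of (i, j) \<Rightarrow> sqrt_coeff i * sqrt_coeff j)"
        by (intro bexI[of _ "(i, m - i)"]) auto
    qed
  qed (auto simp: sqrt_coeff_nonneg)
  also have "\<dots> = (\<Sum>m\<le>N. sqrt_coeff m)\<^sup>2"
    by (simp add: sum.cartesian_product[symmetric] sum_product power2_eq_square)
  also have "\<dots> \<le> 1"
    using Suc by (simp add: power_le_one sum_nonneg sqrt_coeff_nonneg)
  finally show ?case by simp
qed simp

lemma summable_sqrt_coeff: "summable sqrt_coeff"
  using sum_sqrt_coeff_le
  by (intro bounded_imp_summable[where B = 1]) (auto simp: sqrt_coeff_nonneg)

lemma suminf_sqrt_coeff_le: "suminf sqrt_coeff \<le> 1"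
proof (rule suminf_le_const[OF summable_sqrt_coeff])
  fix N show "sum sqrt_coeff {..<N} \<le> 1"
    using sum_sqrt_coeff_le[of N] sqrt_coeff_nonneg[of N]
    by (simp add: lessThan_Suc_atMost[symmetric])
qed

section \<open>Arithmetic of the involution and of the complex scaling\<close>

lemma star_0 [simp]: "star (0::'a::unital_cstar_algebra) = 0"
  using star_add[of "0::'a" 0] by simp

lemma star_minus [simp]: "star (- x) = - star (x::'a::unital_cstar_algebra)"
  using star_add[of x "- x"] by (simp add: eq_neg_iff_add_eq_0 add.commute)

lemma star_diff [simp]: "star (x - y) = star x - star (y::'a::unital_cstar_algebra)"
  using star_add[of x "- y"] by simp

declare star_star [simp] star_add [simp] star_scaleC [simp] star_mult [simp] scaleC_of_real [simp]

lemma star_1 [simp]: "star (1::'a::unital_cstar_algebra) = 1"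
  by (metis mult.right_neutral mult_1 star_mult star_star)

lemma scaleC_1 [simp]: "1 *\<^sub>C x = x"
  using scaleC_of_real[of 1 x] by simp

lemma scaleC_0_left [simp]: "0 *\<^sub>C x = 0"
  using scaleC_of_real[of 0 x] by simp

lemma scaleC_0_right [simp]: "c *\<^sub>C 0 = 0"
  using scaleC_add_right[of c 0 0] by simp

lemma scaleC_minus_left: "(- c) *\<^sub>C x = - (c *\<^sub>C x)"
  using scaleC_add_left[of c "- c" x] by (simp add: eq_neg_iff_add_eq_0 add.commute)

lemma scaleC_minus_right: "c *\<^sub>C (- x) = - (c *\<^sub>C x)"
  using scaleC_add_right[of c x "- x"] by (simp add: eq_neg_iff_add_eq_0 add.commute)

lemma scaleC_diff_right: "c *\<^sub>C (x - y) = c *\<^sub>C x - c *\<^sub>C y"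
  using scaleC_add_right[of c x "- y"] by (simp add: scaleC_minus_right)

lemma scaleC_diff_left: "(c - d) *\<^sub>C x = c *\<^sub>C x - d *\<^sub>C x"
  using scaleC_add_left[of c "- d" x] by (simp add: scaleC_minus_left)

lemma scaleC_sum_right: "c *\<^sub>C (\<Sum>i\<in>I. f i) = (\<Sum>i\<in>I. c *\<^sub>C f i)"
  by (induction I rule: infinite_finite_induct) (auto simp: scaleC_add_right)

lemma scaleC_sum_left: "(\<Sum>i\<in>I. f i) *\<^sub>C x = (\<Sum>i\<in>I. f i *\<^sub>C x)"
  by (induction I rule: infinite_finite_induct) (auto simp: scaleC_add_left)

lemma star_scaleR [simp]: "star (r *\<^sub>R x) = r *\<^sub>R star (x::'a::unital_cstar_algebra)"
  using star_scaleC[of "complex_of_real r" x] by simp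

lemma star_of_real [simp]: "star (of_real r :: 'a::unital_cstar_algebra) = of_real r"
  by (simp add: of_real_def)

lemma star_sum: "star (\<Sum>i\<in>I. f i) = (\<Sum>i\<in>I. star (f i :: 'a::unital_cstar_algebra))"
  by (induction I rule: infinite_finite_induct) auto

lemma star_power: "star (x ^ m) = star (x::'a::unital_cstar_algebra) ^ m"
  by (induction m) (auto simp: power_commutes)

lemma norm_star [simp]: "norm (star x) = norm (x::'a::unital_cstar_algebra)"
proof -
  have le: "norm y \<le> norm (star y)" for y :: 'a
  proof (cases "y = 0")
    case False
    have "norm y * norm y \<le> norm (star y) * norm y"
      using cstar_identity[of y] norm_mult_ineq[of "star y" y] by (simp add: power2_eq_square)
    then show ?thesis using False by simp
  qed simp
  show ?thesis using le[of x] le[of "star x"] by simp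
qed

lemma bounded_linear_star: "bounded_linear (star :: 'a::unital_cstar_algebra \<Rightarrow> 'a)"
  by (intro bounded_linear_intro[where K = 1]) auto

lemma norm_square_self_adjoint:
  "star x = x \<Longrightarrow> norm (x * x) = (norm (x::'a::unital_cstar_algebra))\<^sup>2"
  using cstar_identity[of x] by simp

section \<open>Square roots and the cone of positive elements\<close>

lemma commute_suminf:
  fixes f :: "nat \<Rightarrow> 'a::{real_normed_algebra, banach}"
  assumes "summable f" "\<And>m. z * f m = f m * z"
  shows "z * suminf f = suminf f * z"
  using suminf_mult[OF assms(1), of z] suminf_mult2[OF assms(1), of z] assms(2) by simp

text \<open>The coefficients are summable, so the boundary case \<open>norm k = 1\<close> is
  included. The last two conclusions stand in for functional calculus:
  \<open>norm (1 - y) \<le> 1\<close> will make the root itself positive, and the commutation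
  property lets roots of commuting elements be multiplied.\<close>

lemma square_root_series:
  fixes k :: "'a::unital_cstar_algebra"
  assumes "star k = k" "norm k \<le> 1"
  obtains y where "star y = y" "y * y = 1 - k" "norm (1 - y) \<le> 1"
    "\<And>z. z * k = k * z \<Longrightarrow> z * y = y * z"
proof -
  let ?f = "\<lambda>m. sqrt_coeff m *\<^sub>R k ^ m"
  define D where "D = suminf ?f"
  have bound: "norm (?f m) \<le> sqrt_coeff m" for m
    using power_le_one[of "norm k" m] assms(2) norm_power_ineq[of k m] sqrt_coeff_nonneg[of m]
    by (simp add: mult_left_le)
  have sn: "summable (\<lambda>m. norm (?f m))"
    by (rule summable_comparison_test'[OF summable_sqrt_coeff, of 0]) (use bound in auto)
  then have s: "summable ?f" by (rule summable_norm_cancel)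
  have "norm D \<le> (\<Sum>m. norm (?f m))" unfolding D_def by (rule summable_norm[OF sn])
  also have "\<dots> \<le> suminf sqrt_coeff" by (rule suminf_le[OF bound sn summable_sqrt_coeff])
  finally have nD: "norm D \<le> 1" using suminf_sqrt_coeff_le by simp
  have "D * D = (\<Sum>m. \<Sum>i\<le>m. ?f i * ?f (m - i))"
    unfolding D_def by (rule Cauchy_product[OF sn sn])
  also have "(\<lambda>m. \<Sum>i\<le>m. ?f i * ?f (m - i)) = (\<lambda>m. 2 *\<^sub>R ?f m - (if m = 1 then k else 0))"
  proof
    fix m
    have "(\<Sum>i\<le>m. ?f i * ?f (m - i)) = (\<Sum>i\<le>m. sqrt_coeff i * sqrt_coeff (m - i)) *\<^sub>R k ^ m"
      by (simp add: scaleR_sum_left mult.commute flip: power_add)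
    then show "(\<Sum>i\<le>m. ?f i * ?f (m - i)) = 2 *\<^sub>R ?f m - (if m = 1 then k else 0)"
      by (simp add: sqrt_coeff_convolution scaleR_diff_left)
  qed
  also have "suminf \<dots> = 2 *\<^sub>R D - k"
    unfolding D_def
    by (intro sums_unique[symmetric] sums_diff sums_scaleR_right summable_sums s sums_single)
  finally have DD: "D * D = 2 *\<^sub>R D - k" .
  have sD: "star D = D"
    unfolding D_def bounded_linear.suminf[OF bounded_linear_star s] by (simp add: star_power assms)
  show ?thesis
  proof (rule that[of "1 - D"])
    show "(1 - D) * (1 - D) = 1 - k" by (simp add: algebra_simps DD scaleR_2)
    fix z assume z: "z * k = k * z"
    have "z * k ^ m = k ^ m * z" for m by (rule power_commuting_commutes[symmetric]) (simp add: z)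
    then have "z * D = D * z" unfolding D_def by (intro commute_suminf s) simp
    then show "z * (1 - D) = (1 - D) * z" by (simp add: algebra_simps)
  qed (use sD nD in auto)
qed

text \<open>Squares of self-adjoint elements have commuting roots and a norm criterion at once. That
  every \<open>star x * x\<close> is such a square is the hard direction, settled only in
  \<open>pos_star_mult\<close>.\<close>

definition pos :: "'a::unital_cstar_algebra \<Rightarrow> bool" where
  "pos h \<longleftrightarrow> (\<exists>y. star y = y \<and> h = y * y)"

lemma pos_self_adjoint: "pos h \<Longrightarrow> star h = h"
  by (auto simp: pos_def)

lemma pos_square: "star y = y \<Longrightarrow> pos (y * y)"
  by (auto simp: pos_def)

lemma pos_scaleR: "0 \<le> r \<Longrightarrow> pos h \<Longrightarrow> pos (r *\<^sub>R h)"
proof -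
  assume "0 \<le> r" "pos h"
  then obtain y where "star y = y" "h = y * y" by (auto simp: pos_def)
  with \<open>0 \<le> r\<close> show ?thesis using pos_square[of "sqrt r *\<^sub>R y"] by simp
qed

lemma pos_0 [simp]: "pos 0" using pos_square[of 0] by simp
lemma pos_1 [simp]: "pos 1" using pos_square[of 1] by simp
lemma pos_of_real: "0 \<le> r \<Longrightarrow> pos (of_real r)"
  by (simp add: of_real_def pos_scaleR)

text \<open>The element \<open>y + i z\<close> is unitary.\<close>

lemma norm_le_1_of_square_sum:
  fixes y z :: "'a::unital_cstar_algebra"
  assumes "star y = y" "star z = z" "y * z = z * y" "y * y + z * z = 1"
  shows "norm y \<le> 1"
proof -
  define u where "u = y + \<i> *\<^sub>C z"
  have su: "star u = y - \<i> *\<^sub>C z" by (simp add: u_def assms scaleC_minus_left)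
  have "star u * u = 1"
    unfolding su unfolding u_def using assms(3,4)
    by (simp add: algebra_simps mult_scaleC_left mult_scaleC_right scaleC_scaleC scaleC_minus_left
        scaleC_diff_right)
  then have "(norm u)\<^sup>2 = 1" using cstar_identity[of u] by simp
  then have "norm u = 1" using norm_ge_zero[of u] by (auto simp: power2_eq_1_iff)
  moreover have "2 *\<^sub>R y = u + star u" by (simp add: su) (simp add: u_def scaleR_2)
  then have "2 * norm y \<le> norm u + norm (star u)"
    by (metis abs_numeral norm_scaleR norm_triangle_ineq)
  ultimately show ?thesis by simp
qed

text \<open>One half of the norm criterion for positivity, obtained without the spectrum: a root of
  \<open>h / t\<close> and a commuting root \<open>z\<close> of \<open>1 - h / t\<close> have
  squares adding up to 1, so \<open>norm z \<le> 1\<close> and therefore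
  \<open>norm (z * z) \<le> 1\<close>. The converse half is \<open>pos_of_norm_diff\<close>.\<close>

lemma pos_norm_diff_le:
  assumes "pos h" "norm h \<le> t"
  shows "norm (of_real t - h) \<le> t"
proof (cases "t = 0")
  case False
  with assms(2) have t: "0 < t" using norm_ge_zero[of h] by linarith
  obtain y where y: "star y = y" "h = y * y" using assms(1) by (auto simp: pos_def)
  define y' where "y' = (1 / sqrt t) *\<^sub>R y"
  define k where "k = (1 / t) *\<^sub>R h"
  have k: "k = y' * y'" "star y' = y'" using t by (simp_all add: k_def y'_def y)
  have "star k = k" by (simp add: k)
  moreover have "norm k \<le> 1" using assms(2) t by (simp add: k_def)
  ultimately obtain z where
    z: "star z = z" "z * z = 1 - k" "\<And>x. x * k = k * x \<Longrightarrow> x * z = z * x"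
    by (rule square_root_series) blast
  have "y' * z = z * y'" by (rule z(3)) (simp add: k mult.assoc)
  from z(1) k(2) this[symmetric] have "norm z \<le> 1"
    by (rule norm_le_1_of_square_sum) (simp add: z(2) k(1))
  then have "norm (1 - k) \<le> 1"
    using norm_square_self_adjoint[OF z(1)] z(2) by (simp add: power_le_one)
  moreover have "of_real t - h = t *\<^sub>R (1 - k)"
    using t by (simp add: k_def algebra_simps of_real_def)
  ultimately show ?thesis using t by (simp add: mult_left_le)
qed (use assms in auto)

lemma pos_of_norm_diff:
  fixes h :: "'a::unital_cstar_algebra"
  assumes "star h = h" "norm (of_real t - h) \<le> t"
  obtains y where "star y = y" "y * y = h" "norm (of_real (sqrt t) - y) \<le> sqrt t"
    "\<And>z. z * h = h * z \<Longrightarrow> z * y = y * z"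
proof (cases "t = 0")
  case True
  with assms that[of 0] show ?thesis by auto
next
  case False
  with assms(2) have t: "0 < t" using norm_ge_zero[of "of_real t - h"] by linarith
  define k where "k = (1 / t) *\<^sub>R (of_real t - h)"
  have "star k = k" "norm k \<le> 1" using assms t by (auto simp: k_def)
  from square_root_series[OF this] obtain y where y: "star y = y" "y * y = 1 - k" "norm (1 - y) \<le> 1"
    "\<And>z. z * k = k * z \<Longrightarrow> z * y = y * z" by blast
  have "h = t *\<^sub>R (1 - k)" using t by (simp add: k_def algebra_simps of_real_def)
  show ?thesis
  proof (rule that[of "sqrt t *\<^sub>R y"])
    have "of_real (sqrt t) - sqrt t *\<^sub>R y = sqrt t *\<^sub>R (1 - y)"
      by (simp add: algebra_simps of_real_def)
    then show "norm (of_real (sqrt t) - sqrt t *\<^sub>R y) \<le> sqrt t"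
      using y(3) t by (simp add: mult_left_le)
    fix z assume "z * h = h * z"
    then have "z * k = k * z" by (simp add: k_def algebra_simps of_real_def)
    then have "z * y = y * z" by (rule y(4))
    then show "z * sqrt t *\<^sub>R y = sqrt t *\<^sub>R y * z" by simp
  qed (use y(1,2) t \<open>h = _\<close> in auto)
qed

lemma posI_norm:
  assumes "star h = h" "norm (of_real t - h) \<le> t"
  shows "pos h"
  by (rule pos_of_norm_diff[OF assms]) (use pos_square in blast)

lemma pos_rootE:
  assumes "pos h"
  obtains y where "star y = y" "pos y" "y * y = h" "\<And>z. z * h = h * z \<Longrightarrow> z * y = y * z"
proof (rule pos_of_norm_diff[OF pos_self_adjoint[OF assms] pos_norm_diff_le[OF assms order_refl]])
  fix y assume y: "star y = y" "y * y = h" "norm (of_real (sqrt (norm h)) - y) \<le> sqrt (norm h)"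
    "\<And>z. z * h = h * z \<Longrightarrow> z * y = y * z"
  show thesis using y(1) posI_norm[OF y(1,3)] y(2,4) by (rule that)
qed

text \<open>The norm criterion reduces convexity of the cone to the triangle inequality.\<close>

lemma pos_add:
  assumes "pos h" "pos k"
  shows "pos (h + k)"
proof (rule posI_norm[of _ "norm h + norm k"])
  have "norm (of_real (norm h + norm k) - (h + k))
      \<le> norm (of_real (norm h) - h) + norm (of_real (norm k) - k)"
    by (rule order_trans[OF eq_refl norm_triangle_ineq]) (simp add: algebra_simps)
  then show "norm (of_real (norm h + norm k) - (h + k)) \<le> norm h + norm k"
    using pos_norm_diff_le[OF assms(1) order_refl] pos_norm_diff_le[OF assms(2) order_refl] by simp
qed (simp add: assms pos_self_adjoint)

lemma pos_sum: "(\<And>i. i \<in> I \<Longrightarrow> pos (f i)) \<Longrightarrow> pos (\<Sum>i\<in>I. f i)"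
  by (induction I rule: infinite_finite_induct) (auto intro: pos_add)

lemma pos_conj_self_adjoint: "pos a \<Longrightarrow> star z = z \<Longrightarrow> z * a = a * z \<Longrightarrow> pos (z * a * z)"
proof -
  assume *: "pos a" "star z = z" "z * a = a * z"
  then obtain y where y: "star y = y" "y * y = a" "z * y = y * z" by (metis pos_rootE)
  then have "z * a * z = (z * y) * (z * y)" by (metis mult.assoc)
  with y * show ?thesis using pos_square[of "z * y"] by simp
qed

lemma pos_mult:
  assumes "pos a" "pos b" "a * b = b * a"
  shows "pos (a * b)"
proof -
  obtain y where y: "star y = y" "y * y = a" "b * y = y * b" using assms by (metis pos_rootE)
  have "a * b = y * b * y" using y by (metis mult.assoc)
  then show ?thesis using pos_conj_self_adjoint[OF assms(2) y(1)] y(3) by simp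
qed

text \<open>A convergent sequence is bounded, so one radius \<open>K\<close> serves in the norm
  criterion for all its members, and the criterion with a fixed radius is a closed
  condition.\<close>

lemma pos_limit:
  assumes "\<And>m. pos (h m)" "h \<longlonglongrightarrow> l"
  shows "pos l"
proof -
  obtain K where K: "\<And>m. norm (h m) \<le> K"
    using convergent_imp_Bseq[of h] assms(2) by (auto simp: Bseq_def convergent_def)
  show ?thesis
  proof (rule posI_norm)
    have "(\<lambda>m. star (h m)) \<longlonglongrightarrow> star l" by (rule bounded_linear.tendsto[OF bounded_linear_star assms(2)])
    then have "h \<longlonglongrightarrow> star l" by (simp add: pos_self_adjoint[OF assms(1)])
    then show "star l = l" using assms(2) by (rule LIMSEQ_unique)
    have "(\<lambda>m. norm (of_real K - h m)) \<longlonglongrightarrow> norm (of_real K - l)"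
      by (intro tendsto_intros assms)
    then show "norm (of_real K - l) \<le> K"
      by (rule LIMSEQ_le_const2) (use pos_norm_diff_le[OF assms(1) K] in auto)
  qed
qed

lemma pos_of_real_iff [simp]: "pos (of_real t :: 'a::unital_cstar_algebra) \<longleftrightarrow> 0 \<le> t"
proof
  assume "pos (of_real t :: 'a)"
  from pos_norm_diff_le[OF this, of "\<bar>t\<bar>"] have "norm (of_real (\<bar>t\<bar> - t) :: 'a) \<le> \<bar>t\<bar>" by simp
  then have "\<bar>\<bar>t\<bar> - t\<bar> \<le> \<bar>t\<bar>" unfolding norm_of_real .
  then show "0 \<le> t" by linarith
qed (rule pos_of_real)

text \<open>Commuting roots of \<open>h\<close> and \<open>t - h\<close>, divided by
  \<open>sqrt t\<close>, play the roles of cosine and sine in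
  \<open>norm_le_1_of_square_sum\<close>.\<close>

lemma pos_norm_le_of_pos:
  assumes "pos h" "pos (of_real t - h)" "0 < t"
  shows "norm h \<le> t"
proof -
  obtain y where y: "star y = y" "y * y = h" "\<And>z. z * h = h * z \<Longrightarrow> z * y = y * z"
    using assms(1) by (metis pos_rootE)
  obtain w where w: "star w = w" "w * w = of_real t - h"
      "\<And>z. z * (of_real t - h) = (of_real t - h) * z \<Longrightarrow> z * w = w * z"
    using assms(2) by (metis pos_rootE)
  have "y * w = w * y" by (rule w(3)) (simp add: algebra_simps of_real_def flip: y(2))
  then have "norm ((1 / sqrt t) *\<^sub>R y) \<le> 1"
    using y(1,2) w(1,2) assms(3)
    by (intro norm_le_1_of_square_sum[of _ "(1 / sqrt t) *\<^sub>R w"])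
      (auto simp: of_real_def simp flip: scaleR_add_right)
  then have "norm y \<le> sqrt t" using assms(3) by (simp add: field_simps)
  then have "(norm y)\<^sup>2 \<le> t" by (metis assms(3) less_eq_real_def norm_ge_zero power_mono real_sqrt_pow2)
  then show ?thesis using norm_square_self_adjoint[OF y(1)] y(2) by simp
qed

lemma pos_norm_le:
  assumes "pos h" "pos (of_real t - h)"
  shows "norm h \<le> t"
proof (rule field_le_epsilon)
  fix e :: real assume "0 < e"
  have "pos (h + (of_real t - h))" by (intro pos_add assms)
  then have "0 \<le> t" by simp
  moreover have "pos (of_real e + (of_real t - h))"
    using \<open>0 < e\<close> by (intro pos_add assms pos_of_real) auto
  then have "pos (of_real (t + e) - h)" by (simp add: algebra_simps)
  ultimately show "norm h \<le> t + e" using \<open>0 < e\<close> by (intro pos_norm_le_of_pos assms) auto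
qed

lemma pos_norm_minus: "star h = h \<Longrightarrow> norm h \<le> t \<Longrightarrow> pos (of_real t - h)"
  by (rule posI_norm[of _ t]) auto

lemma pos_norm_mono: "pos a \<Longrightarrow> pos (d - a) \<Longrightarrow> norm a \<le> norm d"
proof -
  assume *: "pos a" "pos (d - a)"
  then have "pos d" using pos_add[OF *] by simp
  then have "pos ((of_real (norm d) - d) + (d - a))"
    by (intro pos_add * pos_norm_minus) (auto simp: pos_self_adjoint)
  then show ?thesis by (intro pos_norm_le *) simp
qed

text \<open>With \<open>b = - k\<^sup>* k\<close> and \<open>c = k k\<^sup>*\<close> both positive, \<open>- b (1 + b)\<^sup>m = k\<^sup>* (1 - c)\<^sup>m k\<close> stays bounded,
  while \<open>b (1 + b)\<^sup>m \<ge> m b\<^sup>2\<close>.\<close>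

lemma zero_of_pos_minus_star_mult:
  fixes k :: "'a::unital_cstar_algebra"
  assumes "pos (- (star k * k))"
  shows "k = 0"
proof (rule ccontr)
  assume k0: "k \<noteq> 0"
  define u where "u = (1 / norm k) *\<^sub>R k"
  define b c where "b = - (star u * u)" and "c = u * star u"
  have nu: "norm u = 1" using k0 by (simp add: u_def)
  have "b = ((1 / norm k) * (1 / norm k)) *\<^sub>R (- (star k * k))" by (simp add: b_def u_def)
  then have b: "pos b" using assms by (metis pos_scaleR zero_le_square)
  \<comment> \<open>Up to real factors these are the real and imaginary parts of \<open>u\<close>.
    Their squares add up to \<open>2 *\<^sub>R (star u * u + u * star u)\<close>, so
    \<open>c\<close> is \<open>b\<close> plus a positive element.\<close>
  define v w where "v = u + star u" and "w = \<i> *\<^sub>C (u - star u)"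
  have "star v = v" "star w = w"
    by (simp_all add: v_def w_def add.commute scaleC_minus_left scaleC_diff_right)
  then have "pos (v * v + w * w)" by (intro pos_add pos_square)
  also have "v * v + w * w = 2 *\<^sub>R (c - b)"
    by (simp add: v_def w_def b_def c_def mult_scaleC_left mult_scaleC_right scaleC_scaleC
        scaleC_minus_left scaleC_diff_right algebra_simps scaleR_2)
  finally have "pos (2 *\<^sub>R (c - b))" .
  then have "pos ((1/2) *\<^sub>R (2 *\<^sub>R (c - b)))" by (rule pos_scaleR[rotated]) simp
  from pos_add[OF this b] have c: "pos c" by simp
  have "norm c \<le> 1" unfolding c_def using norm_mult_ineq[of u "star u"] nu by simp
  then have n1c: "norm (1 - c) \<le> 1" using pos_norm_diff_le[OF c, of 1] by simp
  have intertwine: "u * (1 + b) ^ m = (1 - c) ^ m * u" for m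
  proof (induction m)
    case (Suc m)
    have "u * (1 + b) ^ Suc m = (u * (1 + b)) * (1 + b) ^ m" by (simp add: mult.assoc)
    also have "u * (1 + b) = (1 - c) * u" by (simp add: algebra_simps b_def c_def)
    finally show ?case by (simp add: mult.assoc Suc)
  qed simp
  have bound: "norm (b * (1 + b) ^ m) \<le> 1" for m
  proof -
    have "b * (1 + b) ^ m = - (star u * ((1 - c) ^ m * u))"
      unfolding intertwine[symmetric] by (simp add: b_def mult.assoc)
    also have "norm \<dots> \<le> norm (star u) * (norm ((1 - c) ^ m) * norm u)"
      unfolding norm_minus_cancel
      by (intro order_trans[OF norm_mult_ineq] mult_left_mono norm_mult_ineq norm_ge_zero)
    also have "norm ((1 - c) ^ m) \<le> 1"
      by (rule order_trans[OF norm_power_ineq]) (use n1c in \<open>auto intro: power_le_one\<close>)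
    finally show ?thesis by (simp add: nu)
  qed
  have comm: "b * (1 + b) ^ m = (1 + b) ^ m * b" for m
    by (rule power_commuting_commutes[symmetric]) (simp add: algebra_simps)
  \<comment> \<open>Bernoulli's inequality in the order of the algebra, in two inductions. All
    factors are polynomials in \<open>b\<close>, hence commute, so \<open>pos_mult\<close>
    applies.\<close>
  have pow: "pos ((1 + b) ^ m - 1)" for m
  proof (induction m)
    case (Suc m)
    have "pos (((1 + b) ^ m - 1) * (1 + b) + b)"
      by (intro pos_add pos_mult Suc b pos_1) (simp add: algebra_simps comm)
    also have "((1 + b) ^ m - 1) * (1 + b) + b = (1 + b) ^ Suc m - 1"
      by (simp add: algebra_simps comm)
    finally show ?case .
  qed simp
  have "pos (b * (1 + b) ^ m - real m *\<^sub>R (b * b))" for m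
  proof (induction m)
    case (Suc m)
    have "b * b * (1 + b) ^ m = (1 + b) ^ m * (b * b)" by (metis comm mult.assoc)
    then have "pos ((b * b) * ((1 + b) ^ m - 1))"
      by (intro pos_mult pow pos_square) (auto simp: algebra_simps pos_self_adjoint b)
    with Suc have "pos ((b * (1 + b) ^ m - real m *\<^sub>R (b * b)) + (b * b) * ((1 + b) ^ m - 1))"
      by (rule pos_add)
    then show ?case by (simp add: algebra_simps)
  qed (use b in simp)
  then have "norm (real m *\<^sub>R (b * b)) \<le> norm (b * (1 + b) ^ m)" for m
    by (intro pos_norm_mono pos_scaleR pos_square) (auto simp: pos_self_adjoint b)
  then have "real m * (norm b)\<^sup>2 \<le> 1" for m
    using order_trans[OF _ bound[of m]] norm_square_self_adjoint[OF pos_self_adjoint[OF b]] by simp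
  then have "\<not> 0 < (norm b)\<^sup>2" using reals_Archimedean3[of "(norm b)\<^sup>2"] by (meson not_less)
  then have "norm (star u * u) = 0" by (simp add: b_def zero_less_power2)
  then show False using cstar_identity[of u] nu by simp
qed

text \<open>Kelley--Vaught: with \<open>a = \<bar>h\<bar>\<close> and \<open>p = a - h\<close> one has \<open>(x p)\<^sup>* (x p) = p h p = - p a p\<close>.\<close>

lemma pos_star_mult: "pos (star x * x)"
proof -
  define h where "h = star x * x"
  have sh: "star h = h" by (simp add: h_def)
  obtain a where a: "star a = a" "pos a" "a * a = h * h" "\<And>z. z * (h * h) = (h * h) * z \<Longrightarrow> z * a = a * z"
    using pos_rootE[OF pos_square[OF sh]] by blast
  have ha: "h * a = a * h" by (rule a(4)) (simp add: mult.assoc)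
  define p where "p = a - h"
  have sp: "star p = p" by (simp add: p_def a sh)
  have pa: "p * a = a * p" and ph: "h * p = - (a * p)" by (simp_all add: p_def algebra_simps ha a(3))
  have xp: "star (x * p) * (x * p) = - (p * a * p)"
  proof -
    have "star (x * p) * (x * p) = p * (h * p)" by (simp add: sp h_def mult.assoc)
    then show ?thesis by (simp add: ph mult.assoc)
  qed
  have "pos (p * a * p)" by (rule pos_conj_self_adjoint[OF a(2) sp pa])
  then have "x * p = 0" by (intro zero_of_pos_minus_star_mult, unfold xp) simp
  then have pap: "p * a * p = 0" using xp by simp
  \<comment> \<open>This gives p^3 = 2 p a p = 0. Since p is self-adjoint, the norm of p^4 is the
    fourth power of the norm of p, so p = 0 and h equals its absolute value.\<close>
  have "p * p = 2 *\<^sub>R (p * a)" by (simp add: p_def algebra_simps ha a(3) scaleR_2)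
  then have "(p * p) * p = 0" using pap by simp
  then have "norm ((p * p) * (p * p)) = 0" by (simp flip: mult.assoc)
  then have "p = 0"
    using norm_square_self_adjoint[OF sp] norm_square_self_adjoint[of "p * p"] sp by simp
  then show ?thesis using a(2) by (simp add: p_def h_def)
qed

lemma pos_conj:
  assumes "pos a"
  shows "pos (star z * a * z)"
proof -
  obtain y where "star y = y" "a = y * y" using assms by (auto simp: pos_def)
  then show ?thesis using pos_star_mult[of "y * z"] by (simp add: mult.assoc)
qed

section \<open>States\<close>

definition real_cone :: "'v::real_vector set \<Rightarrow> bool" where
  "real_cone Q \<longleftrightarrow> (\<forall>x\<in>Q. \<forall>y\<in>Q. x + y \<in> Q) \<and> (\<forall>r\<ge>0. \<forall>x\<in>Q. r *\<^sub>R x \<in> Q)"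

text \<open>A cone maximal among those that do not contain \<open>- e\<close> satisfies \<open>Q \<union> - Q = UNIV\<close>.\<close>

lemma total_cone_extension:
  fixes N :: "'v::real_vector set"
  assumes "real_cone N" "e \<in> N" "- e \<notin> N"
  obtains M where "real_cone M" "N \<subseteq> M" "- e \<notin> M" "\<And>x. x \<in> M \<or> - x \<in> M"
proof -
  let ?A = "{Q. real_cone Q \<and> N \<subseteq> Q \<and> - e \<notin> Q}"
  have "\<exists>M\<in>?A. \<forall>X\<in>?A. M \<subseteq> X \<longrightarrow> X = M"
  proof (rule subset_Zorn_nonempty)
    show "?A \<noteq> {}" using assms by auto
    fix C assume C: "C \<noteq> {}" "subset.chain ?A C"
    have "x + y \<in> \<Union>C" if xy: "x \<in> \<Union>C" "y \<in> \<Union>C" for x y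
    proof -
      obtain X Y where "X \<in> C" "x \<in> X" "Y \<in> C" "y \<in> Y" using xy by blast
      moreover from this C have "X \<subseteq> Y \<or> Y \<subseteq> X" by (auto simp: subset.chain_def)
      ultimately obtain Z where "Z \<in> C" "x \<in> Z" "y \<in> Z" by blast
      moreover from this have "real_cone Z" using C by (auto simp: subset.chain_def)
      ultimately show ?thesis by (auto simp: real_cone_def)
    qed
    moreover have "r *\<^sub>R x \<in> \<Union>C" if "0 \<le> r" "x \<in> \<Union>C" for r x
      using that C by (fastforce simp: subset.chain_def real_cone_def)
    ultimately have "real_cone (\<Union>C)" unfolding real_cone_def by blast
    moreover have "N \<subseteq> \<Union>C" "- e \<notin> \<Union>C"
      using C unfolding subset.chain_def by blast+
    ultimately show "\<Union>C \<in> ?A" by blast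
  qed
  then obtain M where MA: "M \<in> ?A" and max': "\<forall>X\<in>?A. M \<subseteq> X \<longrightarrow> X = M" by blast
  then have M: "real_cone M" "N \<subseteq> M" "- e \<notin> M" by auto
  have max: "X = M" if "real_cone X" "- e \<notin> X" "M \<subseteq> X" for X
    using max' that M(2) by blast
  have e: "e \<in> M" using assms M by auto
  have add: "x \<in> M \<Longrightarrow> y \<in> M \<Longrightarrow> x + y \<in> M" and sc: "0 \<le> r \<Longrightarrow> x \<in> M \<Longrightarrow> r *\<^sub>R x \<in> M" for x y r
    using M(1) by (auto simp: real_cone_def)
  have zero: "0 \<in> M" using sc[of 0 e] e by simp
  \<comment> \<open>By maximality, the cone generated by \<open>M\<close> and an \<open>x\<close>
    outside \<open>M\<close> must contain \<open>- e\<close>.\<close>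
  have split: "\<exists>q\<in>M. \<exists>s>0. - e = q + s *\<^sub>R x" if x: "x \<notin> M" for x
  proof -
    define X where "X = {q + s *\<^sub>R x | q s. q \<in> M \<and> 0 \<le> s}"
    have "real_cone X" unfolding real_cone_def
    proof (intro conjI ballI allI impI)
      fix y z assume "y \<in> X" "z \<in> X"
      then obtain q s q' s' where "y = q + s *\<^sub>R x" "z = q' + s' *\<^sub>R x" "q \<in> M" "q' \<in> M" "0 \<le> s" "0 \<le> s'"
        by (auto simp: X_def)
      then have "y + z = (q + q') + (s + s') *\<^sub>R x" "q + q' \<in> M" "0 \<le> s + s'"
        by (auto simp: algebra_simps add)
      then show "y + z \<in> X" unfolding X_def by blast
    next
      fix r :: real and y assume "0 \<le> r" "y \<in> X"
      then obtain q s where "y = q + s *\<^sub>R x" "q \<in> M" "0 \<le> s" by (auto simp: X_def)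
      then have "r *\<^sub>R y = r *\<^sub>R q + (r * s) *\<^sub>R x" "r *\<^sub>R q \<in> M" "0 \<le> r * s"
        using \<open>0 \<le> r\<close> by (auto simp: algebra_simps sc)
      then show "r *\<^sub>R y \<in> X" unfolding X_def by blast
    qed
    moreover have "M \<subseteq> X"
    proof
      fix q assume "q \<in> M"
      then show "q \<in> X" unfolding X_def by (intro CollectI exI[of _ q] exI[of _ 0]) simp
    qed
    moreover have "x \<in> X" unfolding X_def using zero by (intro CollectI exI[of _ 0] exI[of _ 1]) simp
    ultimately have "- e \<in> X" using max x by blast
    then obtain q s where qs: "- e = q + s *\<^sub>R x" "q \<in> M" "0 \<le> s" by (auto simp: X_def)
    then have "s \<noteq> 0" using M(3) by auto
    then show ?thesis using qs by (intro bexI[of _ q] exI[of _ s]) auto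
  qed
  have "x \<in> M \<or> - x \<in> M" for x
  proof (rule ccontr)
    assume "\<not> (x \<in> M \<or> - x \<in> M)"
    then obtain q s q' s' where *: "q \<in> M" "0 < s" "- e = q + s *\<^sub>R x"
      "q' \<in> M" "0 < s'" "- e = q' + s' *\<^sub>R (- x)" using split[of x] split[of "- x"] by auto
    have "q = - e - s *\<^sub>R x" unfolding *(3) by simp
    moreover have "q' = - e - s' *\<^sub>R (- x)" unfolding *(6) by simp
    \<comment> \<open>The weights \<open>s'\<close> and \<open>s\<close> cancel \<open>x\<close> and
      leave a positive multiple of \<open>- e\<close> in \<open>M\<close>.\<close>
    ultimately have "s' *\<^sub>R q + s *\<^sub>R q' = s' *\<^sub>R (- e - s *\<^sub>R x) + s *\<^sub>R (- e - s' *\<^sub>R (- x))"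
      by simp
    also have "\<dots> = (s + s') *\<^sub>R (- e)" by (simp add: algebra_simps)
    finally have "(1 / (s + s')) *\<^sub>R (s' *\<^sub>R q + s *\<^sub>R q') = - e" using *(2,5) by simp
    moreover have "(1 / (s + s')) *\<^sub>R (s' *\<^sub>R q + s *\<^sub>R q') \<in> M" using * by (intro add sc) auto
    ultimately show False using M(3) by simp
  qed
  with M that show thesis by blast
qed

text \<open>Over a total cone \<open>M\<close> the functional is a Dedekind cut: \<open>f x\<close>
  is the supremum of the \<open>t\<close> with \<open>x - t *\<^sub>R e\<close> in \<open>M\<close>,
  and \<open>unit\<close> makes these sets nonempty and bounded above. Adding members of
  \<open>M\<close> gives superadditivity; totality gives \<open>f (- x) = - f x\<close>, and the two
  together force additivity.\<close>

lemma positive_functional_exists: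
  fixes N :: "'v::real_vector set"
  assumes N: "real_cone N" "e \<in> N" "- e \<notin> N" and unit: "\<And>x. \<exists>t. t *\<^sub>R e - x \<in> N"
  obtains f :: "'v \<Rightarrow> real" where "linear f" "\<And>x. x \<in> N \<Longrightarrow> 0 \<le> f x" "f e = 1"
proof -
  obtain M where M: "real_cone M" "N \<subseteq> M" "- e \<notin> M" "\<And>x. x \<in> M \<or> - x \<in> M"
    by (rule total_cone_extension[OF N]) blast
  have e: "e \<in> M" using N M by auto
  have add: "x \<in> M \<Longrightarrow> y \<in> M \<Longrightarrow> x + y \<in> M" and sc: "0 \<le> r \<Longrightarrow> x \<in> M \<Longrightarrow> r *\<^sub>R x \<in> M" for x y r
    using M(1) by (auto simp: real_cone_def)
  have mult_e: "0 \<le> r" if "r *\<^sub>R e \<in> M" for r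
  proof (rule ccontr)
    assume "\<not> 0 \<le> r"
    then have "(1 / (- r)) *\<^sub>R (r *\<^sub>R e) \<in> M" by (intro sc that) auto
    with M(3) \<open>\<not> 0 \<le> r\<close> show False by simp
  qed
  define L where "L x = {t. x - t *\<^sub>R e \<in> M}" for x
  define f where "f x = Sup (L x)" for x
  have above: "\<exists>u. \<forall>t\<in>L x. t \<le> u" for x
  proof -
    obtain u where "u *\<^sub>R e - x \<in> M" using unit M(2) by blast
    then have "(u - t) *\<^sub>R e \<in> M" if "t \<in> L x" for t
      using add[of "u *\<^sub>R e - x" "x - t *\<^sub>R e"] that by (simp add: L_def algebra_simps)
    then show ?thesis using mult_e by (meson diff_ge_0_iff_ge)
  qed
  have upper: "t \<le> f x" if "x - t *\<^sub>R e \<in> M" for t x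
    unfolding f_def using above[of x] that by (intro cSup_upper) (auto simp: L_def bdd_above_def)
  have least: "f x \<le> u" if "\<And>t. x - t *\<^sub>R e \<in> M \<Longrightarrow> t \<le> u" for x u
  proof -
    obtain t where "t *\<^sub>R e - (- x) \<in> M" using unit M(2) by blast
    then have "- t \<in> L x" by (simp add: L_def add.commute)
    then have "L x \<noteq> {}" by blast
    then show ?thesis unfolding f_def using that by (rule cSup_least) (simp add: L_def)
  qed
  have super: "f x + f y \<le> f (x + y)" for x y
  proof -
    have "f x \<le> f (x + y) - f y"
    proof (rule least)
      fix t assume t: "x - t *\<^sub>R e \<in> M"
      have "f y \<le> f (x + y) - t"
      proof (rule least)
        fix s assume "y - s *\<^sub>R e \<in> M"
        then have "(x + y) - (t + s) *\<^sub>R e \<in> M" using add[OF t, of "y - s *\<^sub>R e"] by (simp add: algebra_simps)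
        from upper[OF this] show "s \<le> f (x + y) - t" by simp
      qed
      then show "t \<le> f (x + y) - f y" by simp
    qed
    then show ?thesis by simp
  qed
  have f0: "f 0 \<le> 0" by (rule least) (use mult_e[of "- _"] in auto)
  have minus: "f (- x) = - f x" for x
  proof (rule antisym)
    show "f (- x) \<le> - f x" using super[of x "- x"] f0 by simp
    have "- f (- x) \<le> f x"
    proof (rule field_le_epsilon)
      fix d :: real assume "0 < d"
      then have "x - (f x + d) *\<^sub>R e \<notin> M" using upper[of x "f x + d"] by auto
      then have "- x - (- (f x + d)) *\<^sub>R e \<in> M" using M(4)[of "x - (f x + d) *\<^sub>R e"] by (simp add: algebra_simps)
      from upper[OF this] show "- f (- x) \<le> f x + d" by simp
    qed
    then show "- f x \<le> f (- x)" by simp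
  qed
  have fadd: "f (x + y) = f x + f y" for x y
    using super[of x y] super[of "x + y" "- y"] by (simp add: minus)
  have scale_ge: "r * f x \<le> f (r *\<^sub>R x)" if "0 < r" for r x
  proof -
    have "f x \<le> f (r *\<^sub>R x) / r"
    proof (rule least)
      fix t assume "x - t *\<^sub>R e \<in> M"
      then have "r *\<^sub>R (x - t *\<^sub>R e) \<in> M" using that by (intro sc) auto
      then have "r *\<^sub>R x - (r * t) *\<^sub>R e \<in> M" by (simp add: algebra_simps)
      from upper[OF this] show "t \<le> f (r *\<^sub>R x) / r" using that by (simp add: field_simps)
    qed
    then show ?thesis using that by (simp add: field_simps)
  qed
  have scale_pos: "f (r *\<^sub>R x) = r * f x" if "0 < r" for r x
    using scale_ge[OF that, of x] scale_ge[OF that, of "- x"] by (simp add: minus)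
  have "f 0 = 0" using fadd[of 0 0] by simp
  then have scale: "f (r *\<^sub>R x) = r * f x" for r x
    using scale_pos[of r x] scale_pos[of "- r" x] minus[of "r *\<^sub>R x"]
    by (cases r "0::real" rule: linorder_cases) auto
  show thesis
  proof (rule that)
    show "linear f" by (rule linearI) (auto simp: fadd scale)
    show "0 \<le> f x" if "x \<in> N" for x using upper[of x 0] M(2) that by auto
    show "f e = 1"
    proof (rule antisym)
      show "f e \<le> 1" by (rule least) (use mult_e[of "1 - _"] in \<open>simp add: algebra_simps\<close>)
      show "1 \<le> f e" by (rule upper) (use sc[of 0 e] e in simp)
    qed
  qed
qed

text \<open>Separation by a cone argument gives only a weak inequality. Strictness comes from first
  replacing \<open>a\<close> by \<open>b = a + d\<close>, which is still not positive for some
  \<open>d > 0\<close> because the positive cone is closed; a functional nonpositive at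
  \<open>b\<close> is then at most \<open>- d\<close> at \<open>a\<close>.\<close>

lemma separating_state:
  fixes a :: "'a::unital_cstar_algebra"
  assumes a: "star a = a" "\<not> pos a"
  obtains g :: "'a \<Rightarrow> complex"
  where "\<And>x y. g (x + y) = g x + g y" "\<And>c x. g (c *\<^sub>C x) = c * g x"
    "\<And>x. g (star x * x) \<in> \<real> \<and> 0 \<le> Re (g (star x * x))" "g 1 = 1" "Re (g a) < 0"
proof -
  have "\<exists>d>0. \<not> pos (a + of_real d)"
  proof (rule ccontr)
    assume "\<not> ?thesis"
    then have "pos (a + of_real (1 / real (Suc m)))" for m by auto
    moreover have "(\<lambda>m. a + of_real (1 / real (Suc m))) \<longlonglongrightarrow> a + of_real 0"
      by (intro tendsto_intros lim_inverse_n'[THEN LIMSEQ_Suc])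
    ultimately have "pos (a + of_real 0)" by (rule pos_limit)
    with a show False by simp
  qed
  then obtain d where d: "0 < d" "\<not> pos (a + of_real d)" by blast
  define b where "b = a + of_real d"
  \<comment> \<open>The cone generated by \<open>- b\<close> and all elements with positive real
    part. If it contained \<open>- 1\<close>, then some multiple of \<open>b\<close> would dominate
    2, and \<open>b\<close> would be positive.\<close>
  define N where "N = {x. \<exists>s\<ge>0. pos (x + star x + s *\<^sub>R b)}"
  have NI: "x \<in> N" if "pos (x + star x)" for x
    unfolding N_def using that by (intro CollectI exI[of _ 0]) simp
  have cone: "real_cone N" unfolding real_cone_def
  proof (intro conjI ballI allI impI)
    fix x y assume "x \<in> N" "y \<in> N"
    then obtain s s' where *: "0 \<le> s" "0 \<le> s'" and "pos (x + star x + s *\<^sub>R b)" "pos (y + star y + s' *\<^sub>R b)"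
      by (auto simp: N_def)
    from pos_add[OF this(3,4)] have "pos (x + y + star (x + y) + (s + s') *\<^sub>R b)"
      by (simp add: algebra_simps)
    with * show "x + y \<in> N" unfolding N_def by (intro CollectI exI[of _ "s + s'"]) auto
  next
    fix r :: real and x assume r: "0 \<le> r" and "x \<in> N"
    then obtain s where *: "0 \<le> s" and "pos (x + star x + s *\<^sub>R b)" by (auto simp: N_def)
    from pos_scaleR[OF r this(2)] have "pos (r *\<^sub>R x + star (r *\<^sub>R x) + (r * s) *\<^sub>R b)"
      by (simp add: algebra_simps)
    with * r show "r *\<^sub>R x \<in> N" unfolding N_def by (intro CollectI exI[of _ "r * s"]) auto
  qed
  have one: "1 \<in> N" using pos_of_real[of 2] by (intro NI) simp
  have minus_one: "- 1 \<notin> N"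
  proof
    assume "- 1 \<in> N"
    then obtain s where s: "0 \<le> s" "pos (of_real (- 2) + s *\<^sub>R b)" by (auto simp: N_def)
    then have "s \<noteq> 0" using pos_of_real_iff[of "- 2"] by auto
    have "pos ((of_real (- 2) + s *\<^sub>R b) + of_real 2)" by (intro pos_add s pos_of_real) auto
    then have "pos (s *\<^sub>R b)" by simp
    from pos_scaleR[OF _ this, of "1 / s"] have "pos ((1 / s) *\<^sub>R (s *\<^sub>R b))" using s(1) by simp
    with \<open>s \<noteq> 0\<close> d show False by (simp add: b_def)
  qed
  have unit: "\<exists>t. t *\<^sub>R 1 - x \<in> N" for x
  proof
    have "norm (x + star x) \<le> norm x + norm x" using norm_triangle_ineq[of x "star x"] by simp
    then have "pos (of_real (norm x + norm x) - (x + star x))"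
      by (intro pos_norm_minus) (auto simp: add.commute)
    also have "of_real (norm x + norm x) - (x + star x) = (norm x *\<^sub>R 1 - x) + star (norm x *\<^sub>R 1 - x)"
      unfolding of_real_add by (simp add: of_real_def)
    finally show "norm x *\<^sub>R 1 - x \<in> N" by (rule NI)
  qed
  obtain f :: "'a \<Rightarrow> real" where f: "linear f" "\<And>x. x \<in> N \<Longrightarrow> 0 \<le> f x" "f 1 = 1"
    by (rule positive_functional_exists[OF cone one minus_one unit]) blast
  have fs: "f (x + y) = f x + f y" "f (r *\<^sub>R x) = r * f x" "f (- x) = - f x" for x y r
    using f(1) by (auto simp: linear_add linear_scale linear_neg)
  \<comment> \<open>A skew-adjoint element lies in \<open>N\<close> together with its negative, so
    \<open>f\<close> only sees real parts.\<close>
  have skew: "f x = 0" if "x + star x = 0" for x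
  proof -
    have "star x = - x" using that by (simp add: eq_neg_iff_add_eq_0 add.commute)
    then have "x \<in> N" "- x \<in> N" by (auto intro!: NI)
    then show ?thesis using f(2)[of x] f(2)[of "- x"] fs(3)[of x] by simp
  qed
  have decomp: "c *\<^sub>C x = Re c *\<^sub>R x + Im c *\<^sub>R (\<i> *\<^sub>C x)" for c and x :: 'a
    unfolding scaleC_of_real[symmetric] scaleC_scaleC scaleC_add_left[symmetric]
    by (rule arg_cong[of _ _ "\<lambda>c. c *\<^sub>C x"]) (simp add: complex_eq_iff)
  \<comment> \<open>The complex linear functional whose real part is \<open>f\<close>.\<close>
  define g where "g x = Complex (f x) (- f (\<i> *\<^sub>C x))" for x
  show thesis
  proof (rule that[of g])
    show "g (x + y) = g x + g y" for x y by (simp add: g_def fs scaleC_add_right complex_eq_iff)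
    show "g (c *\<^sub>C x) = c * g x" for c x
    proof -
      have 1: "f (c *\<^sub>C x) = Re c * f x + Im c * f (\<i> *\<^sub>C x)" for c x
        by (subst decomp) (simp add: fs)
      have "f (\<i> *\<^sub>C c *\<^sub>C x) = Re (\<i> * c) * f x + Im (\<i> * c) * f (\<i> *\<^sub>C x)"
        unfolding scaleC_scaleC by (rule 1)
      then show ?thesis by (simp add: g_def 1[of c x] complex_eq_iff algebra_simps)
    qed
    show "g (star x * x) \<in> \<real> \<and> 0 \<le> Re (g (star x * x))" for x
    proof -
      have "f (\<i> *\<^sub>C (star x * x)) = 0" by (rule skew) (simp add: scaleC_minus_left)
      moreover have "0 \<le> f (star x * x)"
        using pos_scaleR[OF _ pos_star_mult[of x], of 2] by (intro f(2) NI) (simp add: scaleR_2)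
      ultimately show ?thesis by (simp add: g_def complex_is_Real_iff)
    qed
    have "f (\<i> *\<^sub>C 1) = 0" by (rule skew) (simp add: scaleC_minus_left)
    then show "g 1 = 1" by (simp add: g_def f complex_eq_iff)
    have "- b \<in> N" unfolding N_def by (intro CollectI exI[of _ 2]) (simp add: b_def a scaleR_2)
    then have "f b \<le> 0" using f(2)[of "- b"] by (simp add: fs)
    then show "Re (g a) < 0" using d(1) f(3) by (simp add: g_def b_def of_real_def fs)
  qed
qed

section \<open>Positive matrices over a C*-algebra\<close>

text \<open>The algebra-valued inner product of the Hilbert module of columns, conjugate linear on
  the left. The entries of vectors come from the algebra: scalar vectors would detect only block
  positivity. Only the first \<open>p\<close> values of a vector count, which is why identities
  between vectors pass through \<open>ip_cong\<close>.\<close>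

definition ip :: "nat \<Rightarrow> (nat \<Rightarrow> 'a::unital_cstar_algebra) \<Rightarrow> (nat \<Rightarrow> 'a) \<Rightarrow> 'a" where
  "ip p v w = (\<Sum>i<p. star (v i) * w i)"

definition app :: "nat \<Rightarrow> 'a::unital_cstar_algebra mat \<Rightarrow> (nat \<Rightarrow> 'a) \<Rightarrow> nat \<Rightarrow> 'a" where
  "app p X v i = (\<Sum>j<p. X $$ (i, j) * v j)"

definition form :: "nat \<Rightarrow> 'a::unital_cstar_algebra mat \<Rightarrow> (nat \<Rightarrow> 'a) \<Rightarrow> (nat \<Rightarrow> 'a) \<Rightarrow> 'a" where
  "form p X v w = ip p v (app p X w)"

lemma form_altdef: "form p X v w = (\<Sum>i<p. \<Sum>j<p. star (v i) * X $$ (i, j) * w j)"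
  by (simp add: form_def ip_def app_def sum_distrib_left mult.assoc)

lemma star_ip: "star (ip p v w) = ip p w v"
  by (simp add: ip_def star_sum)

lemma pos_ip: "pos (ip p v v)"
  unfolding ip_def by (intro pos_sum pos_star_mult)

lemma mat_star_carrier [simp]: "X \<in> carrier_mat m k \<Longrightarrow> mat_star X \<in> carrier_mat k m"
  by (simp add: mat_star_def)

lemma mat_star_index [simp]:
  "X \<in> carrier_mat m k \<Longrightarrow> i < k \<Longrightarrow> j < m \<Longrightarrow> mat_star X $$ (i, j) = star (X $$ (j, i))"
  by (simp add: mat_star_def)

lemma mat_star_mat_star [simp]: "mat_star (mat_star X) = X"
  by (rule eq_matI) (auto simp: mat_star_def)

lemma mult_mat_index:
  assumes "X \<in> carrier_mat m k" "Z \<in> carrier_mat k l" "i < m" "j < l"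
  shows "(X * Z) $$ (i, j) = (\<Sum>r<k. X $$ (i, r) * Z $$ (r, j))"
  using assms by (simp add: scalar_prod_def atLeast0LessThan)

lemma mat_star_mult:
  assumes "X \<in> carrier_mat m k" "Z \<in> carrier_mat k l"
  shows "mat_star (X * Z) = mat_star Z * mat_star X"
proof (rule eq_matI)
  fix i j assume "i < dim_row (mat_star Z * mat_star X)" "j < dim_col (mat_star Z * mat_star X)"
  then have ij: "i < l" "j < m" using assms by (auto simp: mat_star_def)
  have XZ: "X * Z \<in> carrier_mat m l" using assms by simp
  have "mat_star (X * Z) $$ (i, j) = (\<Sum>r<k. star (Z $$ (r, i)) * star (X $$ (j, r)))"
    using ij by (simp add: mat_star_index[OF XZ] mult_mat_index[OF assms] star_sum del: index_mult_mat)
  also have "\<dots> = (mat_star Z * mat_star X) $$ (i, j)"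
    using ij assms
    by (subst mult_mat_index[OF mat_star_carrier[OF assms(2)] mat_star_carrier[OF assms(1)]]) auto
  finally show "mat_star (X * Z) $$ (i, j) = (mat_star Z * mat_star X) $$ (i, j)" .
qed (use assms in \<open>auto simp: mat_star_def\<close>)

lemma mat_star_one [simp]: "mat_star (1\<^sub>m p) = 1\<^sub>m p"
  by (rule eq_matI) (auto simp: mat_star_def)

lemma mat_star_add:
  assumes "X \<in> carrier_mat m k" "Z \<in> carrier_mat m k"
  shows "mat_star (X + Z) = mat_star X + mat_star Z"
  using assms by (intro eq_matI) (auto simp: mat_star_def)

lemma app_mult:
  assumes "X \<in> carrier_mat p p" "Z \<in> carrier_mat p p" "i < p"
  shows "app p (X * Z) v i = app p X (app p Z v) i"
proof -
  have "app p (X * Z) v i = (\<Sum>j<p. \<Sum>r<p. X $$ (i, r) * Z $$ (r, j) * v j)"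
    unfolding app_def using assms by (simp add: mult_mat_index[OF assms(1,2)] sum_distrib_right del: index_mult_mat)
  also have "\<dots> = app p X (app p Z v) i"
    unfolding app_def by (subst sum.swap) (simp add: sum_distrib_left mult.assoc)
  finally show ?thesis .
qed

lemma ip_cong: "(\<And>i. i < p \<Longrightarrow> v i = v' i) \<Longrightarrow> (\<And>i. i < p \<Longrightarrow> w i = w' i) \<Longrightarrow> ip p v w = ip p v' w'"
  by (simp add: ip_def)

lemma ip_adjoint:
  assumes "X \<in> carrier_mat p p"
  shows "ip p v (app p (mat_star X) w) = ip p (app p X v) w"
proof -
  have "ip p v (app p (mat_star X) w) = (\<Sum>i<p. \<Sum>j<p. star (v i) * star (X $$ (j, i)) * w j)"
    using assms by (simp add: ip_def app_def sum_distrib_left mult.assoc)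
  also have "\<dots> = ip p (app p X v) w"
    by (subst sum.swap) (simp add: ip_def app_def star_sum sum_distrib_right)
  finally show ?thesis .
qed

lemma app_one: "i < p \<Longrightarrow> app p (1\<^sub>m p) v i = v i"
  by (simp add: app_def if_distrib[of "\<lambda>x. x * _"] sum.delta' cong: if_cong)

lemma form_one: "form p (1\<^sub>m p) v w = ip p v w"
  unfolding form_def by (rule ip_cong) (auto simp: app_one)

lemma form_mat_star_mult:
  assumes "Z \<in> carrier_mat p p" "X \<in> carrier_mat p p"
  shows "form p (mat_star Z * X) v w = form p X (app p Z v) w"
proof -
  have "form p (mat_star Z * X) v w = ip p v (app p (mat_star Z) (app p X w))"
    unfolding form_def by (rule ip_cong) (auto simp: app_mult assms)
  then show ?thesis by (simp add: ip_adjoint assms form_def)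
qed

lemma form_mult:
  assumes "Z \<in> carrier_mat p p" "X \<in> carrier_mat p p"
  shows "form p (X * Z) v w = form p X v (app p Z w)"
  unfolding form_def by (rule ip_cong) (auto simp: app_mult assms)

lemma form_gram:
  assumes "Z \<in> carrier_mat p p"
  shows "form p (mat_star Z * Z) v w = ip p (app p Z v) (app p Z w)"
  by (simp add: form_mat_star_mult assms) (simp add: form_def)

lemma form_add:
  assumes "X \<in> carrier_mat p p" "Z \<in> carrier_mat p p"
  shows "form p (X + Z) v w = form p X v w + form p Z v w"
  using assms by (simp add: form_altdef algebra_simps sum.distrib)

lemma form_diff:
  assumes "X \<in> carrier_mat p p" "Z \<in> carrier_mat p p"
  shows "form p (X - Z) v w = form p X v w - form p Z v w"
  using assms by (simp add: form_altdef algebra_simps sum_subtractf)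

lemma form_scaleC:
  assumes "X \<in> carrier_mat p p"
  shows "form p (map_mat (scaleC c) X) v w = c *\<^sub>C form p X v w"
  using assms by (simp add: form_altdef mult_scaleC_left mult_scaleC_right scaleC_sum_right)

lemma form_add_right: "form p X v (\<lambda>i. w i + w' i) = form p X v w + form p X v w'"
  by (simp add: form_altdef algebra_simps sum.distrib)

lemma form_add_left: "form p X (\<lambda>i. v i + v' i) w = form p X v w + form p X v' w"
  by (simp add: form_altdef algebra_simps sum.distrib)

lemma form_diff_right: "form p X v (\<lambda>i. w i - w' i) = form p X v w - form p X v w'"
  by (simp add: form_altdef algebra_simps sum_subtractf)

lemma form_diff_left: "form p X (\<lambda>i. v i - v' i) w = form p X v w - form p X v' w"
  by (simp add: form_altdef algebra_simps sum_subtractf)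

lemma form_scaleC_right: "form p X v (\<lambda>i. c *\<^sub>C w i) = c *\<^sub>C form p X v w"
  by (simp add: form_altdef mult_scaleC_right scaleC_sum_right)

lemma form_scaleC_left: "form p X (\<lambda>i. c *\<^sub>C v i) w = cnj c *\<^sub>C form p X v w"
  by (simp add: form_altdef mult_scaleC_left scaleC_sum_right)

lemmas form_sesquilinear = form_add_right form_add_left form_diff_right form_diff_left
  form_scaleC_right form_scaleC_left

definition unit_fun :: "nat \<Rightarrow> nat \<Rightarrow> 'a::unital_cstar_algebra" where
  "unit_fun i k = (if k = i then 1 else 0)"

lemma form_unit_fun: "i < p \<Longrightarrow> j < p \<Longrightarrow> form p X (unit_fun i) (unit_fun j) = X $$ (i, j)"
  by (simp add: form_def ip_def app_def unit_fun_def if_distrib[of star]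
      if_distrib[of "\<lambda>x. x * _"] if_distrib[of "\<lambda>x. _ * x"] sum.delta cong: if_cong)

lemma scaleR_4: "4 *\<^sub>R x = x + x + (x + (x::'v::real_vector))"
proof -
  have "4 *\<^sub>R x = 2 *\<^sub>R (2 *\<^sub>R x)" by simp
  then show ?thesis by (simp only: scaleR_2)
qed

lemma polarization:
  "4 *\<^sub>R form p X v w =
     (form p X (\<lambda>i. v i + w i) (\<lambda>i. v i + w i) - form p X (\<lambda>i. v i - w i) (\<lambda>i. v i - w i))
     - \<i> *\<^sub>C (form p X (\<lambda>i. v i + \<i> *\<^sub>C w i) (\<lambda>i. v i + \<i> *\<^sub>C w i)
          - form p X (\<lambda>i. v i - \<i> *\<^sub>C w i) (\<lambda>i. v i - \<i> *\<^sub>C w i))"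
  unfolding scaleR_4
  by (simp add: form_sesquilinear algebra_simps scaleC_add_right scaleC_diff_right scaleC_scaleC
      scaleC_minus_left scaleC_minus_right)

text \<open>Self-adjointness at \<open>v + w\<close> and at \<open>w + \<i> v\<close> yields the sum
  and the difference of the two mixed terms, and these determine the adjoint; unit vectors then read
  off the entries.\<close>

lemma hermitian_of_form:
  assumes X: "X \<in> carrier_mat p p" and sa: "\<And>v. star (form p X v v) = form p X v v"
  shows "mat_star X = X"
proof -
  have herm: "star (form p X v w) = form p X w v" for v w
  proof -
    let ?b = "form p X w v" and ?c = "form p X v w"
    have 1: "star ?b + star ?c = ?b + ?c"
      using sa[of "\<lambda>i. v i + w i"] sa[of v] sa[of w]
      by (simp add: form_sesquilinear algebra_simps)
    have "\<i> *\<^sub>C (?b - ?c) = (- \<i>) *\<^sub>C (star ?b - star ?c)"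
      using sa[of "\<lambda>i. w i + \<i> *\<^sub>C v i"] sa[of v] sa[of w]
      by (simp add: form_sesquilinear algebra_simps scaleC_diff_right scaleC_add_right scaleC_minus_left
          scaleC_minus_right scaleC_scaleC)
    then have "(- \<i>) *\<^sub>C (\<i> *\<^sub>C (?b - ?c)) = (- \<i>) *\<^sub>C ((- \<i>) *\<^sub>C (star ?b - star ?c))" by simp
    then have 2: "?b - ?c = star ?c - star ?b" unfolding scaleC_scaleC by (simp add: scaleC_minus_left)
    have "star ?c + star ?c = (star ?c - star ?b) + (star ?b + star ?c)" by simp
    also have "\<dots> = ?b + ?b" by (simp only: 2[symmetric] 1) simp
    finally show ?thesis by (simp flip: scaleR_2)
  qed
  show ?thesis
  proof (rule eq_matI)
    fix i j assume "i < dim_row X" "j < dim_col X"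
    then have ij: "i < p" "j < p" using X by auto
    then show "mat_star X $$ (i, j) = X $$ (i, j)"
      using herm[of "unit_fun j" "unit_fun i"] X by (simp add: form_unit_fun)
  qed (use X in \<open>auto simp: mat_star_def\<close>)
qed

lemma form_hermitian:
  assumes "X \<in> carrier_mat p p" "mat_star X = X"
  shows "star (form p X v w) = form p X w v"
  using ip_adjoint[OF assms(1), of w v] by (simp add: form_def star_ip assms(2))

lemma two_star_mult_le: "pos ((star a * a + star b * b) - (star a * b + star b * (a::'a::unital_cstar_algebra)))"
  using pos_star_mult[of "a - b"] by (simp add: algebra_simps)

text \<open>Each mixed term is split by \<open>two_star_mult_le\<close> with \<open>a = v i\<close>
  and \<open>b = X $$ (i, j) * v j\<close>, where \<open>C\<close> dominates every squared entry
  norm. Summing over all pairs bounds twice the form by \<open>p + p * C\<close> times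
  \<open>ip p v v\<close>; the extra 1 in \<open>t\<close> keeps it positive for
  \<open>p = 0\<close> as well.\<close>

lemma hermitian_bounded:
  assumes X: "X \<in> carrier_mat p p" "mat_star X = X"
  obtains t where "0 < t" "\<And>v. pos (t *\<^sub>R ip p v v - form p X v v)"
proof -
  define C where "C = (\<Sum>i<p. \<Sum>j<p. (norm (X $$ (i, j)))\<^sup>2)"
  define t where "t = (real p + real p * C + 1) / 2"
  have C0: "0 \<le> C" unfolding C_def by (intro sum_nonneg) auto
  have C: "(norm (X $$ (i, j)))\<^sup>2 \<le> C" if "i < p" "j < p" for i j
  proof -
    have "(norm (X $$ (i, j)))\<^sup>2 \<le> (\<Sum>j<p. (norm (X $$ (i, j)))\<^sup>2)"
      using that by (intro member_le_sum) auto
    also have "\<dots> \<le> C" unfolding C_def using that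
      by (intro member_le_sum[of i _ "\<lambda>i. \<Sum>j<p. (norm (X $$ (i, j)))\<^sup>2"]) (auto intro: sum_nonneg)
    finally show ?thesis .
  qed
  have "pos (t *\<^sub>R ip p v v - form p X v v)" for v
  proof -
    let ?x = "\<lambda>i j. X $$ (i, j)"
    have xs: "star (?x i j) = ?x j i" if "i < p" "j < p" for i j
      using mat_star_index[OF X(1) that(2,1)] X(2) by simp
    have swap: "form p X v v = (\<Sum>i<p. \<Sum>j<p. star (?x i j * v j) * v i)"
      unfolding form_altdef by (subst sum.swap) (auto intro!: sum.cong simp: xs mult.assoc)
    have "pos (star (v i) * v i + C *\<^sub>R (star (v j) * v j)
        - (star (v i) * (?x i j * v j) + star (?x i j * v j) * v i))" (is "pos ?d")
      if "i < p" "j < p" for i j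
    proof -
      have "norm (star (?x i j) * ?x i j) \<le> C" using C[OF that] by (simp add: cstar_identity)
      then have "pos (of_real C - star (?x i j) * ?x i j)" by (intro pos_norm_minus) auto
      from pos_conj[OF this, of "v j"]
      have "pos (C *\<^sub>R (star (v j) * v j) - star (?x i j * v j) * (?x i j * v j))"
        by (simp add: algebra_simps of_real_def)
      from pos_add[OF this two_star_mult_le[of "v i" "?x i j * v j"]]
      show ?thesis by (simp add: algebra_simps)
    qed
    then have "pos (\<Sum>i<p. \<Sum>j<p. star (v i) * v i + C *\<^sub>R (star (v j) * v j)
        - (star (v i) * (?x i j * v j) + star (?x i j * v j) * v i))" (is "pos ?s")
      by (intro pos_sum) auto
    also have "?s = real p *\<^sub>R ip p v v + (real p * C) *\<^sub>R ip p v v - (form p X v v + form p X v v)"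
    proof -
      have "form p X v v + form p X v v = (\<Sum>i<p. \<Sum>j<p. star (v i) * (?x i j * v j)) + (\<Sum>i<p. \<Sum>j<p. star (?x i j * v j) * v i)"
        by (subst (2) swap) (simp add: form_altdef mult.assoc)
      moreover have "(\<Sum>i<p. \<Sum>j<p. star (v i) * v i) = real p *\<^sub>R ip p v v"
        by (simp add: ip_def sum_distrib_left scaleR_conv_of_real)
      moreover have "(\<Sum>i<p. \<Sum>j<p. C *\<^sub>R (star (v j) * v j)) = (real p * C) *\<^sub>R ip p v v"
        by (simp add: ip_def sum_distrib_left scaleR_conv_of_real mult.assoc)
      ultimately show ?thesis by (simp only: sum.distrib sum_subtractf)
    qed
    finally have "pos (real p *\<^sub>R ip p v v + (real p * C) *\<^sub>R ip p v v - (form p X v v + form p X v v))" .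
    from pos_scaleR[OF _ pos_add[OF this pos_ip[of p v]], of "1 / 2"]
    have "pos ((1/2) *\<^sub>R ((real p *\<^sub>R ip p v v + (real p * C) *\<^sub>R ip p v v - (form p X v v + form p X v v)) + ip p v v))"
      by simp
    also have "(1/2) *\<^sub>R ((real p *\<^sub>R ip p v v + (real p * C) *\<^sub>R ip p v v - (form p X v v + form p X v v)) + ip p v v)
      = t *\<^sub>R ip p v v - form p X v v"
      unfolding scaleR_2[of "form p X v v", symmetric]
      by (simp add: t_def scaleR_add_right scaleR_diff_right scaleR_add_left add_divide_distrib)
    finally show ?thesis .
  qed
  moreover have "0 < t" unfolding t_def using C0 by (simp add: add_nonneg_pos)
  ultimately show thesis using that by blast
qed

section \<open>Square roots of positive matrices\<close>

lemma pow_mat_add: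
  assumes "K \<in> carrier_mat p p"
  shows "K ^\<^sub>m (a + b) = K ^\<^sub>m a * K ^\<^sub>m b"
proof (induction b)
  case (Suc b)
  then show ?case
    using assms by (simp add: assoc_mult_mat[of _ p p _ p _ p] pow_carrier_mat)
qed (use assms in \<open>simp add: pow_carrier_mat right_mult_one_mat'\<close>)

lemma pow_mat_one: "K \<in> carrier_mat p p \<Longrightarrow> K ^\<^sub>m 1 = K"
  by simp

lemma mat_star_pow:
  assumes "K \<in> carrier_mat p p" "mat_star K = K"
  shows "mat_star (K ^\<^sub>m m) = K ^\<^sub>m m"
proof (induction m)
  case (Suc m)
  have "mat_star (K ^\<^sub>m Suc m) = K ^\<^sub>m 1 * K ^\<^sub>m m"
    using assms Suc by (simp add: mat_star_mult[of _ p p _ p] pow_carrier_mat)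
  also have "\<dots> = K ^\<^sub>m (1 + m)" by (rule pow_mat_add[OF assms(1), symmetric])
  also have "\<dots> = K ^\<^sub>m Suc m" by simp
  finally show ?case .
qed (use assms in simp)

text \<open>The order interval \<open>[0, 1]\<close> is closed under powers: \<open>K - K\<^sup>2 = (1 - K) K (1 - K) + K (1 - K) K\<close>.\<close>

lemma form_pow_le:
  assumes K: "K \<in> carrier_mat p p" "mat_star K = K"
    and pK: "\<And>v. pos (form p K v v)" and pK1: "\<And>v. pos (ip p v v - form p K v v)"
  shows "pos (form p (K ^\<^sub>m m) v v) \<and> pos (ip p v v - form p (K ^\<^sub>m m) v v)"
proof -
  have even: "form p (K ^\<^sub>m (a + a)) v v = ip p (app p (K ^\<^sub>m a) v) (app p (K ^\<^sub>m a) v)" for a v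
    using form_gram[of "K ^\<^sub>m a" p v v] mat_star_pow[OF K, of a] K
    by (simp add: pow_mat_add[OF K(1)] pow_carrier_mat)
  have odd: "form p (K ^\<^sub>m Suc (a + a)) v v = form p K (app p (K ^\<^sub>m a) v) (app p (K ^\<^sub>m a) v)" for a v
  proof -
    have "K ^\<^sub>m Suc (a + a) = K ^\<^sub>m (a + (1 + a))" by (simp add: add.commute)
    also have "\<dots> = mat_star (K ^\<^sub>m a) * (K * K ^\<^sub>m a)"
      unfolding pow_mat_add[OF K(1), of a "1 + a"] pow_mat_add[OF K(1), of 1 a]
      using K by (simp add: mat_star_pow)
    finally have e: "K ^\<^sub>m Suc (a + a) = mat_star (K ^\<^sub>m a) * (K * K ^\<^sub>m a)" .
    have Ka: "K ^\<^sub>m a \<in> carrier_mat p p" "K * K ^\<^sub>m a \<in> carrier_mat p p"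
      using K by (auto simp: pow_carrier_mat intro!: mult_carrier_mat[of _ p p])
    show ?thesis unfolding e form_mat_star_mult[OF Ka] form_mult[OF Ka(1) K(1)] ..
  qed
  have step: "pos (form p K u u - ip p (app p K u) (app p K u))" for u
  proof -
    let ?y = "app p K u"
    define z where "z i = u i - ?y i" for i
    have "form p K u ?y = ip p ?y ?y" using ip_adjoint[OF K(1), of u ?y] K(2) by (simp add: form_def)
    moreover have "form p K ?y u = ip p ?y ?y" by (simp add: form_def)
    ultimately have "form p K z z + (ip p ?y ?y - form p K ?y ?y) = form p K u u - ip p ?y ?y"
      by (simp add: z_def[abs_def] form_diff_right form_diff_left algebra_simps)
    then show ?thesis using pos_add[OF pK[of z] pK1[of ?y]] by simp
  qed
  \<comment> \<open>At the vector \<open>K ^\<^sub>m a\<close> applied to \<open>v\<close>, the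
    difference is the form of 1 - K when m = 2 a, and the form of K - K^2 when m = 2 a + 1.\<close>
  have dec: "pos (form p (K ^\<^sub>m m) v v - form p (K ^\<^sub>m Suc m) v v)" for m v
  proof (cases "even m")
    case True
    then obtain a where "m = a + a" by (auto elim!: evenE simp: mult_2)
    then show ?thesis using even[of a v] odd[of a v] pK1 by simp
  next
    case False
    then obtain a where a: "m = Suc (a + a)" by (auto elim!: oddE simp: mult_2)
    define u where "u = app p (K ^\<^sub>m a) v"
    have "app p (K ^\<^sub>m (1 + a)) v i = app p K u i" if "i < p" for i
      unfolding pow_mat_add[OF K(1)] u_def using K(1) that by (simp add: app_mult pow_carrier_mat)
    then have "ip p (app p (K ^\<^sub>m (1 + a)) v) (app p (K ^\<^sub>m (1 + a)) v) = ip p (app p K u) (app p K u)"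
      by (intro ip_cong)
    then have "form p (K ^\<^sub>m Suc m) v v = ip p (app p K u) (app p K u)"
      using even[of "1 + a" v] by (simp add: a)
    then show ?thesis using odd[of a v] step[of u] unfolding a u_def by simp
  qed
  have "pos (form p (K ^\<^sub>m m) v v)"
  proof (cases "even m")
    case True
    then obtain a where "m = a + a" by (auto elim!: evenE simp: mult_2)
    then show ?thesis using even[of a v] by (simp add: pos_ip)
  next
    case False
    then obtain a where a: "m = Suc (a + a)" by (auto elim!: oddE simp: mult_2)
    show ?thesis unfolding a odd by (rule pK)
  qed
  moreover have "pos (ip p v v - form p (K ^\<^sub>m m) v v)"
  proof (induction m)
    case 0
    then show ?case using K by (simp add: form_one)
  next
    case (Suc m)
    from pos_add[OF this dec[of m v]] show ?case by simp
  qed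
  ultimately show ?thesis ..
qed

text \<open>Takes the place of an operator norm bound: the quadratic forms of all powers are bounded
  by \<open>ip\<close>, uniformly in the exponent, and polarization transfers this bound to each
  entry.\<close>

lemma pow_mat_bounded:
  assumes K: "K \<in> carrier_mat p p" "mat_star K = K"
    and pK: "\<And>v. pos (form p K v v)" and pK1: "\<And>v. pos (ip p v v - form p K v v)"
    and ij: "i < p" "j < p"
  obtains B where "\<And>m. norm ((K ^\<^sub>m m) $$ (i, j)) \<le> B"
proof -
  have q: "norm (form p (K ^\<^sub>m m) u u) \<le> norm (ip p u u)" for m u
    using form_pow_le[OF K pK pK1, of m u] by (intro pos_norm_mono) auto
  let ?u1 = "\<lambda>k. unit_fun i k + unit_fun j k :: 'a" and ?u2 = "\<lambda>k. unit_fun i k - unit_fun j k :: 'a"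
    and ?u3 = "\<lambda>k. unit_fun i k + \<i> *\<^sub>C unit_fun j k :: 'a"
    and ?u4 = "\<lambda>k. unit_fun i k - \<i> *\<^sub>C unit_fun j k :: 'a"
  have "norm ((K ^\<^sub>m m) $$ (i, j))
      \<le> norm (ip p ?u1 ?u1) + norm (ip p ?u2 ?u2) + (norm (ip p ?u3 ?u3) + norm (ip p ?u4 ?u4))" for m
  proof -
    let ?X = "K ^\<^sub>m m"
    have "4 * norm (?X $$ (i, j)) = norm (4 *\<^sub>R form p ?X (unit_fun i) (unit_fun j))"
      by (simp add: form_unit_fun ij)
    also have "\<dots> \<le> norm (form p ?X ?u1 ?u1 - form p ?X ?u2 ?u2)
        + norm (\<i> *\<^sub>C (form p ?X ?u3 ?u3 - form p ?X ?u4 ?u4))"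
      unfolding polarization by (rule norm_triangle_ineq4)
    also have "\<dots> \<le> (norm (form p ?X ?u1 ?u1) + norm (form p ?X ?u2 ?u2))
        + (norm (form p ?X ?u3 ?u3) + norm (form p ?X ?u4 ?u4))"
      unfolding norm_scaleC by (intro add_mono) (simp_all add: norm_triangle_ineq4)
    also have "\<dots> \<le> norm (ip p ?u1 ?u1) + norm (ip p ?u2 ?u2) + (norm (ip p ?u3 ?u3) + norm (ip p ?u4 ?u4))"
      by (intro add_mono q)
    finally show ?thesis using norm_ge_zero[of "?X $$ (i, j)"] by linarith
  qed
  then show thesis by (rule that)
qed

text \<open>The argument of \<open>square_root_series\<close> entry by entry, with absolute
  convergence supplied by the uniform bound on the entries of the powers.\<close>

lemma matrix_square_root_series:
  fixes K :: "'a::unital_cstar_algebra mat"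
  assumes K: "K \<in> carrier_mat p p" "mat_star K = K"
    and pK: "\<And>v. pos (form p K v v)" and pK1: "\<And>v. pos (ip p v v - form p K v v)"
  obtains Y where "Y \<in> carrier_mat p p" "mat_star Y = Y" "Y * Y = 1\<^sub>m p - K"
proof -
  let ?P = "\<lambda>m i j. (K ^\<^sub>m m) $$ (i, j)"
  define D where "D = mat p p (\<lambda>(i, j). \<Sum>m. sqrt_coeff m *\<^sub>R ?P m i j)"
  have D: "D \<in> carrier_mat p p" by (simp add: D_def)
  have Dij: "D $$ (i, j) = (\<Sum>m. sqrt_coeff m *\<^sub>R ?P m i j)" if "i < p" "j < p" for i j
    using that by (simp add: D_def)
  have sn: "summable (\<lambda>m. norm (sqrt_coeff m *\<^sub>R ?P m i j))" if ij: "i < p" "j < p" for i j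
  proof -
    obtain B where B: "\<And>m. norm (?P m i j) \<le> B" using pow_mat_bounded[OF K pK pK1 ij] by blast
    show ?thesis
    proof (rule summable_comparison_test'[where N = 0])
      show "summable (\<lambda>m. sqrt_coeff m * B)" by (intro summable_mult2 summable_sqrt_coeff)
      show "norm (norm (sqrt_coeff m *\<^sub>R ?P m i j)) \<le> sqrt_coeff m * B" for m
        using B[of m] by (simp add: sqrt_coeff_nonneg mult_left_mono)
    qed
  qed
  have s: "summable (\<lambda>m. sqrt_coeff m *\<^sub>R ?P m i j)" if "i < p" "j < p" for i j
    by (rule summable_norm_cancel[OF sn[OF that]])
  have DD: "(\<Sum>l<p. D $$ (i, l) * D $$ (l, j)) = 2 *\<^sub>R D $$ (i, j) - K $$ (i, j)" if ij: "i < p" "j < p" for i j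
  proof -
    let ?c = "\<lambda>l m. \<Sum>a\<le>m. (sqrt_coeff a *\<^sub>R ?P a i l) * (sqrt_coeff (m - a) *\<^sub>R ?P (m - a) l j)"
    have "(\<Sum>l<p. D $$ (i, l) * D $$ (l, j)) = (\<Sum>l<p. \<Sum>m. ?c l m)"
      using ij by (intro sum.cong refl) (simp only: Dij lessThan_iff, intro Cauchy_product sn)
    also have "\<dots> = (\<Sum>m. \<Sum>l<p. ?c l m)"
      using ij by (intro suminf_sum[symmetric] summable_Cauchy_product sn) auto
    also have "(\<lambda>m. \<Sum>l<p. ?c l m)
        = (\<lambda>m. 2 *\<^sub>R (sqrt_coeff m *\<^sub>R ?P m i j) - (if m = 1 then K $$ (i, j) else 0))"
    proof
      fix m
      have "(\<Sum>l<p. ?c l m) = (\<Sum>a\<le>m. (sqrt_coeff a * sqrt_coeff (m - a)) *\<^sub>R (\<Sum>l<p. ?P a i l * ?P (m - a) l j))"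
        by (subst sum.swap) (simp add: scaleR_sum_right mult.commute)
      also have "\<dots> = (\<Sum>a\<le>m. (sqrt_coeff a * sqrt_coeff (m - a)) *\<^sub>R ?P m i j)"
      proof (rule sum.cong[OF refl])
        fix a assume "a \<in> {..m}"
        then have "K ^\<^sub>m m = K ^\<^sub>m a * K ^\<^sub>m (m - a)" by (simp flip: pow_mat_add[OF K(1)])
        then have "?P m i j = (\<Sum>l<p. ?P a i l * ?P (m - a) l j)"
          using ij K(1) by (simp only:) (subst mult_mat_index[of _ p p _ p], auto simp: pow_carrier_mat)
        then show "(sqrt_coeff a * sqrt_coeff (m - a)) *\<^sub>R (\<Sum>l<p. ?P a i l * ?P (m - a) l j)
            = (sqrt_coeff a * sqrt_coeff (m - a)) *\<^sub>R ?P m i j" by simp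
      qed
      also have "\<dots> = (2 * sqrt_coeff m - (if m = 1 then 1 else 0)) *\<^sub>R ?P m i j"
        by (simp only: scaleR_sum_left[symmetric] sqrt_coeff_convolution)
      also have "\<dots> = 2 *\<^sub>R (sqrt_coeff m *\<^sub>R ?P m i j) - (if m = 1 then K $$ (i, j) else 0)"
        using pow_mat_one[OF K(1)] by (simp add: scaleR_diff_left)
      finally show "(\<Sum>l<p. ?c l m) = 2 *\<^sub>R (sqrt_coeff m *\<^sub>R ?P m i j) - (if m = 1 then K $$ (i, j) else 0)" .
    qed
    also have "suminf \<dots> = 2 *\<^sub>R D $$ (i, j) - K $$ (i, j)"
      unfolding Dij[OF ij]
      by (intro sums_unique[symmetric] sums_diff sums_scaleR_right summable_sums s ij sums_single)
    finally show ?thesis .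
  qed
  have sD: "mat_star D = D"
  proof (rule eq_matI)
    fix i j assume "i < dim_row D" "j < dim_col D"
    then have ij: "i < p" "j < p" using D by auto
    have "star (?P m j i) = ?P m i j" for m
      using mat_star_index[OF pow_carrier_mat[OF K(1)] ij, of m] by (simp add: mat_star_pow[OF K])
    then have "star (D $$ (j, i)) = D $$ (i, j)"
      unfolding Dij[OF ij] Dij[OF ij(2,1)] bounded_linear.suminf[OF bounded_linear_star s[OF ij(2,1)]] by simp
    then show "mat_star D $$ (i, j) = D $$ (i, j)" using D ij by simp
  qed (auto simp: mat_star_def D_def)
  show thesis
  proof (rule that[of "1\<^sub>m p - D"])
    show "1\<^sub>m p - D \<in> carrier_mat p p" using D by (rule minus_carrier_mat)
    show "mat_star (1\<^sub>m p - D) = 1\<^sub>m p - D"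
    proof (rule eq_matI)
      fix i j assume "i < dim_row (1\<^sub>m p - D)" "j < dim_col (1\<^sub>m p - D)"
      then have ij: "i < p" "j < p" using D by auto
      have "star (D $$ (j, i)) = D $$ (i, j)" using mat_star_index[OF D ij] sD by simp
      then show "mat_star (1\<^sub>m p - D) $$ (i, j) = (1\<^sub>m p - D) $$ (i, j)"
        using D ij by (simp add: mat_star_def)
    qed (use D in \<open>auto simp: mat_star_def\<close>)
    show "(1\<^sub>m p - D) * (1\<^sub>m p - D) = 1\<^sub>m p - K"
    proof (rule eq_matI)
      fix i j assume "i < dim_row (1\<^sub>m p - K)" "j < dim_col (1\<^sub>m p - K)"
      then have ij: "i < p" "j < p" using K by auto
      have D1: "1\<^sub>m p - D \<in> carrier_mat p p" using D by (rule minus_carrier_mat)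
      let ?d = "\<lambda>i j. if i = j then 1 else (0::'a)"
      have "((1\<^sub>m p - D) * (1\<^sub>m p - D)) $$ (i, j)
          = (\<Sum>l<p. (?d i l - D $$ (i, l)) * (?d l j - D $$ (l, j)))"
        unfolding mult_mat_index[OF D1 D1 ij] using D ij by (intro sum.cong) auto
      also have "\<dots> = ?d i j - D $$ (i, j) - D $$ (i, j) + (\<Sum>l<p. D $$ (i, l) * D $$ (l, j))"
        using ij by (simp add: algebra_simps sum.distrib sum_subtractf if_distrib[of "\<lambda>x. x * _"]
            if_distrib[of "\<lambda>x. _ * x"] sum.delta sum.delta' cong: if_cong)
      finally show "((1\<^sub>m p - D) * (1\<^sub>m p - D)) $$ (i, j) = (1\<^sub>m p - K) $$ (i, j)"
        using K ij by (simp add: DD scaleR_2)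
    qed (use D K in auto)
  qed
qed

theorem mat_positive_iff:
  "X \<in> mat_positive p \<longleftrightarrow> X \<in> carrier_mat p p \<and> (\<forall>v. pos (form p X v v))"
proof (intro iffI conjI allI)
  assume "X \<in> mat_positive p"
  then obtain Y where Y: "X = mat_star Y * Y" "Y \<in> carrier_mat p p" by (auto simp: mat_positive_def)
  show "X \<in> carrier_mat p p" using Y mult_carrier_mat[OF mat_star_carrier] by blast
  show "pos (form p X v v)" for v by (simp add: Y form_gram pos_ip)
next
  assume "X \<in> carrier_mat p p \<and> (\<forall>v. pos (form p X v v))"
  then have X: "X \<in> carrier_mat p p" and pX: "\<And>v. pos (form p X v v)" by auto
  have sX: "mat_star X = X" by (rule hermitian_of_form[OF X]) (simp add: pX pos_self_adjoint)
  obtain t where t: "0 < t" "\<And>v. pos (t *\<^sub>R ip p v v - form p X v v)"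
    using hermitian_bounded[OF X sX] by blast
  let ?s = "complex_of_real (1 / t)"
  \<comment> \<open>Scaling by the bound \<open>t\<close> puts \<open>K = 1 - X / t\<close> into the
    order interval from 0 to 1. Then \<open>X = t (1 - K)\<close>, so a root of \<open>X\<close> is
    \<open>sqrt t\<close> times a root of \<open>1 - K\<close>.\<close>
  define K where "K = 1\<^sub>m p - map_mat (scaleC ?s) X"
  have K: "K \<in> carrier_mat p p" using X by (simp add: K_def minus_carrier_mat)
  have fK: "form p K v v = ip p v v - (1 / t) *\<^sub>R form p X v v" for v
    unfolding K_def using X by (simp add: form_diff form_one form_scaleC del: of_real_divide)
  have pK: "pos (form p K v v)" for v
    using pos_scaleR[OF _ t(2)[of v], of "1 / t"] t(1) by (simp add: fK scaleR_diff_right)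
  have sK: "mat_star K = K" by (rule hermitian_of_form[OF K]) (simp add: pK pos_self_adjoint)
  have pK1: "pos (ip p v v - form p K v v)" for v
    using pos_scaleR[OF _ pX[of v], of "1 / t"] t(1) by (simp add: fK)
  obtain Y where Y: "Y \<in> carrier_mat p p" "mat_star Y = Y" "Y * Y = 1\<^sub>m p - K"
    using matrix_square_root_series[OF K sK pK pK1] by blast
  define Z where "Z = map_mat (scaleR (sqrt t)) Y"
  have Z: "Z \<in> carrier_mat p p" using Y by (simp add: Z_def)
  have "X = mat_star Z * Z"
  proof (rule eq_matI)
    fix i j assume "i < dim_row (mat_star Z * Z)" "j < dim_col (mat_star Z * Z)"
    then have ij: "i < p" "j < p" using Z by (auto simp: mat_star_def)
    have sY: "star (Y $$ (l, i)) = Y $$ (i, l)" if "l < p" for l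
      using mat_star_index[OF Y(1) ij(1) that] Y(2) by simp
    have "(mat_star Z * Z) $$ (i, j) = (\<Sum>l<p. star (Z $$ (l, i)) * Z $$ (l, j))"
      unfolding mult_mat_index[OF mat_star_carrier[OF Z] Z ij]
      using ij Z by (intro sum.cong) auto
    also have "\<dots> = t *\<^sub>R (\<Sum>l<p. Y $$ (i, l) * Y $$ (l, j))"
      unfolding scaleR_sum_right using ij Y(1) t(1) by (intro sum.cong) (auto simp: Z_def sY)
    also have "\<dots> = t *\<^sub>R ((Y * Y) $$ (i, j))" unfolding mult_mat_index[OF Y(1) Y(1) ij] ..
    also have "\<dots> = X $$ (i, j)" unfolding Y(3) using ij X t(1) by (simp add: K_def del: of_real_divide)
    finally show "X $$ (i, j) = (mat_star Z * Z) $$ (i, j)" by simp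
  qed (use X Z in \<open>auto simp: mat_star_def\<close>)
  then show "X \<in> mat_positive p" using Z by (auto simp: mat_positive_def)
qed

text \<open>Positivity makes a state real on Gram matrices. Expanding the Gram matrix of
  \<open>1 + Z\<close> shows that \<open>f (mat_star Z) + f Z\<close> is real; \<open>Z = X\<close>
  and \<open>Z = \<i> X\<close> give the imaginary and the real part of the claim.\<close>

lemma mat_state_star:
  assumes f: "mat_state p f" and X: "X \<in> carrier_mat p p"
  shows "f (mat_star X) = cnj (f X)"
proof -
  have real: "f (mat_star Z) + f Z \<in> \<real>" if Z: "Z \<in> carrier_mat p p" for Z
  proof -
    have add4: "(A + B) + (C + D) = (A + D) + (B + C)"
      if "A \<in> carrier_mat p p" "B \<in> carrier_mat p p" "C \<in> carrier_mat p p" "D \<in> carrier_mat p p"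
      for A B C D :: "'a mat"
      using that by (intro eq_matI) (auto simp: algebra_simps)
    let ?Y = "1\<^sub>m p + Z"
    have fadd: "f (A + B) = f A + f B" if "A \<in> carrier_mat p p" "B \<in> carrier_mat p p" for A B
      using f that by (simp add: mat_state_def)
    have sZ: "mat_star Z \<in> carrier_mat p p" using Z by simp
    have gram: "mat_star A * A \<in> mat_positive p" if "A \<in> carrier_mat p p" for A :: "'a mat"
      using that by (auto simp: mat_positive_def)
    have "mat_star ?Y * ?Y = (1\<^sub>m p + mat_star Z * Z) + (mat_star Z + Z)"
    proof -
      have "mat_star ?Y * ?Y = (1\<^sub>m p + mat_star Z) * (1\<^sub>m p + Z)"
        using Z by (simp add: mat_star_add[of _ p p])
      also have "\<dots> = (1\<^sub>m p + mat_star Z) * 1\<^sub>m p + (1\<^sub>m p + mat_star Z) * Z"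
        using Z sZ by (intro mult_add_distrib_mat[of _ p p _ p]) auto
      also have "(1\<^sub>m p + mat_star Z) * Z = 1\<^sub>m p * Z + mat_star Z * Z"
        using Z sZ by (intro add_mult_distrib_mat[of _ p p _ _ p]) auto
      finally have "mat_star ?Y * ?Y = (1\<^sub>m p + mat_star Z) * 1\<^sub>m p + (1\<^sub>m p * Z + mat_star Z * Z)" .
      also have "(1\<^sub>m p + mat_star Z) * 1\<^sub>m p = 1\<^sub>m p + mat_star Z"
        using sZ by (intro right_mult_one_mat[of _ p p]) auto
      also have "1\<^sub>m p * Z = Z" using Z by (rule left_mult_one_mat)
      also have "(1\<^sub>m p + mat_star Z) + (Z + mat_star Z * Z) = (1\<^sub>m p + mat_star Z * Z) + (mat_star Z + Z)"
        using add4[OF one_carrier_mat sZ Z mult_carrier_mat[OF sZ Z]] .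
      finally show ?thesis .
    qed
    then have "f (mat_star ?Y * ?Y) = (f (1\<^sub>m p) + f (mat_star Z * Z)) + (f (mat_star Z) + f Z)"
      using Z sZ mult_carrier_mat[OF sZ Z] by (simp add: fadd)
    then have "f (mat_star Z) + f Z = f (mat_star ?Y * ?Y) - (f (1\<^sub>m p) + f (mat_star Z * Z))" by simp
    also have "\<dots> \<in> \<real>"
      using f gram[of ?Y] gram[OF Z] Z unfolding mat_state_def by (intro Reals_diff Reals_add) auto
    finally show ?thesis .
  qed
  let ?iX = "map_mat (scaleC \<i>) X"
  have "mat_star ?iX = map_mat (scaleC (- \<i>)) (mat_star X)"
    using X by (intro eq_matI) (auto simp: mat_star_def)
  then have "- \<i> * f (mat_star X) + \<i> * f X \<in> \<real>"
    using real[of ?iX] f X by (simp add: mat_state_def)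
  with real[OF X] show ?thesis by (auto simp: complex_is_Real_iff complex_eq_iff)
qed

text \<open>If the form at some \<open>v\<close> is not positive, a functional \<open>g\<close> of
  the algebra separates it, and compressing by \<open>v\<close>, that is \<open>Z\<close> to
  \<open>g (form p Z v v)\<close>, gives a positive functional on matrices that is negative at
  \<open>X\<close>.\<close>

lemma mat_positive_of_states:
  assumes X: "X \<in> carrier_mat p p" "mat_star X = X"
    and states: "\<And>f. mat_state p f \<Longrightarrow> 0 \<le> Re (f X)"
  shows "X \<in> mat_positive p"
proof (rule ccontr)
  assume "X \<notin> mat_positive p"
  then obtain v where v: "\<not> pos (form p X v v)" using X(1) mat_positive_iff by blast
  obtain g where g: "\<And>x y. g (x + y) = g x + g y" "\<And>c x. g (c *\<^sub>C x) = c * g x"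
    "\<And>x. g (star x * x) \<in> \<real> \<and> 0 \<le> Re (g (star x * x))" "g 1 = 1" "Re (g (form p X v v)) < 0"
    using separating_state[OF form_hermitian[OF X, of v v] v] by blast
  have gpos: "g h \<in> \<real> \<and> 0 \<le> Re (g h)" if "pos h" for h
    using that g(3) by (metis pos_def)
  let ?X = "map_mat (scaleC (- 1)) X"
  have "star (X $$ (j, i)) = X $$ (i, j)" if "i < p" "j < p" for i j
    using mat_star_index[OF X(1) that] X(2) by simp
  then have mX: "?X \<in> carrier_mat p p" "mat_star ?X = ?X"
    using X(1) by (auto simp: mat_star_def scaleC_minus_left intro!: eq_matI)
  \<comment> \<open>Normalization must not divide by 0. The bound for \<open>- X\<close> gives
    \<open>0 \<le> t * c + Re (g (form p X v v))\<close>, and the second term is negative, so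
    \<open>c\<close> is positive.\<close>
  obtain t where t: "0 < t" "pos (t *\<^sub>R ip p v v - form p ?X v v)"
    using hermitian_bounded[OF mX] by blast
  define c where "c = Re (g (ip p v v))"
  have gip: "g (ip p v v) = of_real c" using gpos[OF pos_ip[of p v]] by (simp add: c_def)
  have "t *\<^sub>R ip p v v - form p ?X v v = of_real t *\<^sub>C ip p v v + form p X v v"
    using X(1) by (simp add: form_scaleC scaleC_minus_left)
  then have "0 \<le> t * c + Re (g (form p X v v))"
    using gpos[OF t(2)] by (simp only: g gip) simp
  with g(5) have "0 < t * c" by linarith
  with t(1) have c: "0 < c" by (simp add: zero_less_mult_iff)
  define f where "f Z = g (form p Z v v) / of_real c" for Z
  have "mat_state p f" unfolding mat_state_def
  proof (intro conjI ballI allI)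
    show "f (Y + Z) = f Y + f Z" if "Y \<in> carrier_mat p p" "Z \<in> carrier_mat p p" for Y Z
      using that by (simp add: f_def form_add g add_divide_distrib)
    show "f (map_mat (scaleC d) Y) = d * f Y" if "Y \<in> carrier_mat p p" for d Y
      using that by (simp add: f_def form_scaleC g)
    fix Y :: "'a mat" assume "Y \<in> mat_positive p"
    then have "pos (form p Y v v)" by (simp add: mat_positive_iff)
    from gpos[OF this] c show "f Y \<in> \<real>" "0 \<le> Re (f Y)"
      by (auto simp: f_def Re_divide_of_real intro: Reals_divide)
  next
    show "f (1\<^sub>m p) = 1" using c by (simp add: f_def form_one gip)
  qed
  from states[OF this] g(5) c show False by (simp add: f_def Re_divide_of_real zero_le_divide_iff)
qed

lemma mat_positive_star: "X \<in> mat_positive p \<Longrightarrow> mat_star X = X"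
  unfolding mat_positive_iff by (metis hermitian_of_form pos_self_adjoint)

section \<open>Compressing the Cuntz algebra to row contractions\<close>

lemma pos_scaleC_one:
  assumes "pos (s *\<^sub>C (1::'o::unital_cstar_algebra))"
  shows "pos s"
proof -
  have "(cnj s - s) *\<^sub>C (1::'o) = 0" using pos_self_adjoint[OF assms] by (simp add: scaleC_diff_left)
  then have "cmod (cnj s - s) = 0" using norm_scaleC[of "cnj s - s" "1::'o"] by simp
  then have s: "s = of_real (Re s)" by (simp add: complex_eq_iff)
  have "s *\<^sub>C (1::'o) = of_real (Re s)"
    using arg_cong[OF s, of "\<lambda>t. t *\<^sub>C (1::'o)"] unfolding scaleC_of_real by (simp add: of_real_def[where 'a = 'o])
  then have "pos (of_real (Re s) :: complex)" using assms by simp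
  then show ?thesis by (simp only: s[symmetric])
qed

lemma pos_complex: "pos (s::complex) \<Longrightarrow> s = of_real (Re s) \<and> 0 \<le> Re s"
proof -
  assume "pos s"
  then have "s = of_real (Re s)" using pos_self_adjoint[of s] by (simp add: star_complex_def complex_eq_iff)
  with \<open>pos s\<close> show ?thesis by (metis pos_of_real_iff)
qed

text \<open>Cauchy-Schwarz weakened to arithmetic means: the right side is a sum of a term in
  \<open>y\<close> and a term in \<open>z\<close>, so it can be summed over the generators and
  combined with the contraction estimate.\<close>

lemma cmod_ip_le: "cmod (ip p y z) \<le> (Re (ip p y y) + Re (ip p z z)) / 2"
proof -
  have "cmod (ip p y z) \<le> (\<Sum>a<p. cmod (cnj (y a) * z a))"
    unfolding ip_def star_complex_def by (rule norm_sum)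
  also have "\<dots> \<le> (\<Sum>a<p. ((cmod (y a))\<^sup>2 + (cmod (z a))\<^sup>2) / 2)"
  proof (rule sum_mono)
    fix a
    show "cmod (cnj (y a) * z a) \<le> ((cmod (y a))\<^sup>2 + (cmod (z a))\<^sup>2) / 2"
      using sum_squares_bound[of "cmod (y a)" "cmod (z a)"] by (simp add: norm_mult)
  qed
  also have "\<dots> = (Re (ip p y y) + Re (ip p z z)) / 2"
    by (simp add: ip_def star_complex_def sum_divide_distrib sum.distrib add_divide_distrib
        cmod_power2 flip: power2_eq_square)
  finally show ?thesis .
qed

section \<open>A truncated Fock space inside the Cuntz algebra and the Poisson kernel\<close>

locale cuntz =
  fixes n :: nat and S :: "nat \<Rightarrow> 'o::unital_cstar_algebra"
  assumes two_le: "2 \<le> n" and cuntz: "cuntz_algebra n S"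
begin

lemma isometry: "i \<in> {1..n} \<Longrightarrow> star (S i) * S i = 1"
  using cuntz by (simp add: cuntz_algebra_def)

lemma isometry_left: "i \<in> {1..n} \<Longrightarrow> star (S i) * (S i * x) = x"
  by (simp flip: mult.assoc add: isometry)

text \<open>Compressing \<open>\<Sum> S\<^sub>i S\<^sub>i\<^sup>* = 1\<close> to \<open>S\<^sub>j\<^sup>* \<cdot> S\<^sub>j\<close> leaves a vanishing sum of positive elements.\<close>

lemma orthogonal:
  assumes ij: "i \<in> {1..n}" "j \<in> {1..n}" "i \<noteq> j"
  shows "star (S i) * S j = 0"
proof -
  define y where "y k = star (S k) * S j" for k
  have "(\<Sum>k\<in>{1..n}. star (y k) * y k) = star (S j) * (\<Sum>k\<in>{1..n}. S k * star (S k)) * S j"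
    by (simp add: y_def sum_distrib_left sum_distrib_right mult.assoc)
  also have "\<dots> = 1" using cuntz ij by (simp add: cuntz_algebra_def)
  also have "(\<Sum>k\<in>{1..n}. star (y k) * y k) = 1 + (\<Sum>k\<in>{1..n} - {j}. star (y k) * y k)"
    using ij by (subst sum.remove[of _ j]) (auto simp: y_def isometry)
  also have "(\<Sum>k\<in>{1..n} - {j}. star (y k) * y k)
      = star (y i) * y i + (\<Sum>k\<in>{1..n} - {j} - {i}. star (y k) * y k)"
    using ij by (intro sum.remove) auto
  finally have "- (star (y i) * y i) = (\<Sum>k\<in>{1..n} - {j} - {i}. star (y k) * y k)"
    by (simp add: minus_unique)
  then have "pos (- (star (y i) * y i))" by (simp only:) (intro pos_sum pos_star_mult)
  then show ?thesis using zero_of_pos_minus_star_mult by (simp only: y_def)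
qed

lemma isometries: "i \<in> {1..n} \<Longrightarrow> j \<in> {1..n} \<Longrightarrow> star (S i) * S j = (if i = j then 1 else 0)"
  using isometry orthogonal by auto

text \<open>The right factor \<open>S\<^sub>1\<^sup>M S\<^sub>2\<close> makes the words of length at most \<open>M\<close> orthonormal, so that the
  \<open>S\<^sub>i\<close> act on them as the left creation operators on the truncated Fock space.\<close>

definition fock :: "nat \<Rightarrow> nat list \<Rightarrow> 'o" where
  "fock M w = prod_list (map S w) * (S 1 ^ M * S 2)"

definition words :: "nat \<Rightarrow> nat list set" where
  "words m = {w. set w \<subseteq> {1..n} \<and> length w \<le> m}"

lemma finite_words [simp]: "finite (words m)"
  unfolding words_def by (rule finite_lists_length_le) simp

lemma isometry_power: "star (S 1 ^ a) * (S 1 ^ a * x) = x"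
proof (induction a arbitrary: x)
  case (Suc a)
  have "star (S 1) * (S 1 * (S 1 ^ a * x)) = S 1 ^ a * x"
    by (rule isometry_left) (use two_le in simp)
  then show ?case by (simp only: power_Suc star_mult mult.assoc Suc)
qed simp

text \<open>Letters of \<open>w\<close> are cancelled one by one against the adjoints of
  \<open>S 1\<close>. A letter other than 1 gives 0 at once; otherwise all of \<open>w\<close>
  disappears, and \<open>a < b + length w\<close> guarantees that the adjoint of \<open>S 2\<close>
  finally meets an \<open>S 1\<close>.\<close>

lemma shift_word_zero:
  "set w \<subseteq> {1..n} \<Longrightarrow> length w \<le> a \<Longrightarrow> a < b + length w \<Longrightarrow>
    star (S 1 ^ a * S 2) * (prod_list (map S w) * (S 1 ^ b * S 2)) = 0"
proof (induction w arbitrary: a)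
  case Nil
  then obtain c where b: "b = a + Suc c" using less_imp_Suc_add[of a b] by auto
  have "star (S 1 ^ a * S 2) * (S 1 ^ b * S 2) = star (S 2) * (S 1 ^ Suc c * S 2)"
    unfolding b power_add star_mult mult.assoc isometry_power ..
  also have "\<dots> = (star (S 2) * S 1) * (S 1 ^ c * S 2)" by (simp add: mult.assoc)
  also have "\<dots> = 0" using two_le by (simp add: isometries)
  finally show ?case by simp
next
  case (Cons i w)
  then obtain a' where a: "a = Suc a'" by (cases a) auto
  have "star (S 1 ^ a * S 2) * (prod_list (map S (i # w)) * (S 1 ^ b * S 2))
      = star (S 1 ^ a' * S 2) * ((star (S 1) * S i) * (prod_list (map S w) * (S 1 ^ b * S 2)))"
    by (simp only: a power_Suc star_mult mult.assoc list.map prod_list.Cons)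
  also have "\<dots> = 0" using Cons a two_le by (auto simp: isometries)
  finally show ?case .
qed

lemma fock_Cons: "fock M (i # w) = S i * fock M w"
  by (simp add: fock_def mult.assoc)

lemma fock_Nil: "fock M [] = S 1 ^ M * S 2"
  by (simp add: fock_def)

lemma fock_gram:
  "w \<in> words M \<Longrightarrow> w' \<in> words M \<Longrightarrow> star (fock M w) * fock M w' = (if w = w' then 1 else 0)"
proof (induction w arbitrary: w')
  case Nil
  show ?case
  proof (cases w')
    case Nil
    show ?thesis unfolding Nil fock_Nil star_mult mult.assoc isometry_power using two_le by (simp add: isometry)
  next
    case (Cons i v)
    then show ?thesis
      using shift_word_zero[of w' M M] Nil.prems by (simp add: fock_def words_def del: star_mult)
  qed
next
  case (Cons i w)
  show ?case
  proof (cases w')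
    case Nil
    have "star (fock M []) * fock M (i # w) = 0"
      using shift_word_zero[of "i # w" M M] Cons.prems by (simp add: fock_def words_def del: star_mult)
    from arg_cong[OF this, of star] show ?thesis by (simp add: Nil)
  next
    case w': (Cons j v)
    have "star (fock M (i # w)) * fock M w' = star (fock M w) * ((star (S i) * S j) * fock M v)"
      by (simp add: w' fock_Cons mult.assoc)
    then show ?thesis using Cons w' by (auto simp: isometries words_def)
  qed
qed

lemma fock_sum_gram:
  assumes "finite W" "finite W'" "W \<subseteq> words M" "W' \<subseteq> words M"
  shows "star (\<Sum>w\<in>W. c w *\<^sub>C fock M w) * (\<Sum>w\<in>W'. d w *\<^sub>C fock M w)
    = (\<Sum>w\<in>W \<inter> W'. cnj (c w) * d w) *\<^sub>C 1"
proof -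
  have "star (\<Sum>w\<in>W. c w *\<^sub>C fock M w) * (\<Sum>w\<in>W'. d w *\<^sub>C fock M w)
      = (\<Sum>w\<in>W. \<Sum>w'\<in>W'. (cnj (c w) * d w') *\<^sub>C (star (fock M w) * fock M w'))"
    by (simp add: star_sum sum_product mult_scaleC_left mult_scaleC_right scaleC_scaleC)
      (simp add: mult.commute)
  also have "\<dots> = (\<Sum>w\<in>W. \<Sum>w'\<in>W'. if w = w' then (cnj (c w) * d w) *\<^sub>C 1 else 0)"
    using assms(3,4) by (intro sum.cong refl) (auto simp: fock_gram subset_iff)
  also have "\<dots> = (\<Sum>w\<in>W \<inter> W'. (cnj (c w) * d w) *\<^sub>C 1)"
    using assms(1,2) by (simp add: sum.inter_restrict sum.delta)
  finally show ?thesis by (simp add: scaleC_sum_left)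
qed

text \<open>The coefficient of the Poisson kernel at a word. The first letter acts first, so if each
  \<open>B i\<close> is the adjoint of a matrix, the product of the \<open>B i\<close> is the
  adjoint of the product of these matrices in the order of the word.\<close>

primrec coef :: "((nat \<Rightarrow> complex) \<Rightarrow> nat \<Rightarrow> complex) \<Rightarrow> (nat \<Rightarrow> (nat \<Rightarrow> complex) \<Rightarrow> nat \<Rightarrow> complex)
    \<Rightarrow> nat list \<Rightarrow> (nat \<Rightarrow> complex) \<Rightarrow> nat \<Rightarrow> complex" where
  "coef Y B [] = Y"
| "coef Y B (i # w) = (\<lambda>z. coef Y B w (B i z))"

definition gram :: "nat \<Rightarrow> ((nat \<Rightarrow> complex) \<Rightarrow> nat \<Rightarrow> complex) \<Rightarrow> (nat \<Rightarrow> (nat \<Rightarrow> complex) \<Rightarrow> nat \<Rightarrow> complex)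
    \<Rightarrow> nat \<Rightarrow> (nat \<Rightarrow> complex) \<Rightarrow> (nat \<Rightarrow> complex) \<Rightarrow> complex" where
  "gram p Y B m y z = (\<Sum>w\<in>words m. ip p (coef Y B w y) (coef Y B w z))"

text \<open>Component \<open>c\<close> of the truncated Poisson kernel applied to \<open>z\<close>.
  Words have length at most \<open>m + 1\<close> while \<open>fock\<close> is taken at
  \<open>m + 2\<close>: multiplication by some \<open>S i\<close> lengthens a word by one, and the
  result must still belong to the orthonormal family.\<close>

definition embed :: "((nat \<Rightarrow> complex) \<Rightarrow> nat \<Rightarrow> complex) \<Rightarrow> (nat \<Rightarrow> (nat \<Rightarrow> complex) \<Rightarrow> nat \<Rightarrow> complex)
    \<Rightarrow> nat \<Rightarrow> nat \<Rightarrow> (nat \<Rightarrow> complex) \<Rightarrow> 'o" where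
  "embed Y B m c z = (\<Sum>w\<in>words (Suc m). coef Y B w z c *\<^sub>C fock (Suc (Suc m)) w)"

lemma words_mono: "m \<le> m' \<Longrightarrow> words m \<subseteq> words m'"
  by (auto simp: words_def)

lemma Cons_words: "i \<in> {1..n} \<Longrightarrow> (#) i ` words m \<subseteq> words (Suc m)"
  by (auto simp: words_def)

lemma embed_gram: "(\<Sum>c<p. star (embed Y B m c y) * embed Y B m c z) = gram p Y B (Suc m) y z *\<^sub>C 1"
proof -
  have "star (embed Y B m c y) * embed Y B m c z
      = (\<Sum>w\<in>words (Suc m). cnj (coef Y B w y c) * coef Y B w z c) *\<^sub>C 1" for c
    unfolding embed_def by (subst fock_sum_gram) (auto simp: words_mono)
  then have "(\<Sum>c<p. star (embed Y B m c y) * embed Y B m c z)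
      = (\<Sum>c<p. \<Sum>w\<in>words (Suc m). cnj (coef Y B w y c) * coef Y B w z c) *\<^sub>C 1"
    by (simp add: scaleC_sum_left)
  also have "(\<Sum>c<p. \<Sum>w\<in>words (Suc m). cnj (coef Y B w y c) * coef Y B w z c) = gram p Y B (Suc m) y z"
    unfolding gram_def ip_def star_complex_def by (rule sum.swap)
  finally show ?thesis .
qed

text \<open>Only words starting with \<open>i\<close> survive the pairing. Removing that letter
  turns the coefficient of \<open>y\<close> into a coefficient of \<open>B i y\<close> and lowers
  the truncation level from \<open>m + 1\<close> to \<open>m\<close>.\<close>

lemma embed_shift:
  assumes i: "i \<in> {1..n}"
  shows "(\<Sum>c<p. star (embed Y B m c y) * (S i * embed Y B m c z)) = gram p Y B m (B i y) z *\<^sub>C 1"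
proof -
  have shift: "S i * embed Y B m c z
      = (\<Sum>w\<in>(#) i ` words (Suc m). coef Y B (tl w) z c *\<^sub>C fock (Suc (Suc m)) w)" for c
    unfolding embed_def
    by (subst sum.reindex) (auto simp: sum_distrib_left fock_Cons mult_scaleC_right)
  have int: "words (Suc m) \<inter> (#) i ` words (Suc m) = (#) i ` words m"
    using i by (auto simp: words_def)
  have "star (embed Y B m c y) * (S i * embed Y B m c z)
      = (\<Sum>w\<in>words m. cnj (coef Y B w (B i y) c) * coef Y B w z c) *\<^sub>C 1" for c
    unfolding shift unfolding embed_def
    by (subst fock_sum_gram)
      (use Cons_words[OF i, of "Suc m"] in \<open>auto simp: int words_mono sum.reindex\<close>)
  then have "(\<Sum>c<p. star (embed Y B m c y) * (S i * embed Y B m c z))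
      = (\<Sum>c<p. \<Sum>w\<in>words m. cnj (coef Y B w (B i y) c) * coef Y B w z c) *\<^sub>C 1"
    by (simp add: scaleC_sum_left)
  also have "(\<Sum>c<p. \<Sum>w\<in>words m. cnj (coef Y B w (B i y) c) * coef Y B w z c) = gram p Y B m (B i y) z"
    unfolding gram_def ip_def star_complex_def by (rule sum.swap)
  finally show ?thesis .
qed

lemma cnj_gram: "cnj (gram p Y B m y z) = gram p Y B m z y"
proof -
  have "cnj (ip p v w) = ip p w v" for v w :: "nat \<Rightarrow> complex"
    using star_ip[of p v w] by (simp add: star_complex_def)
  then show ?thesis by (simp add: gram_def)
qed

lemma embed_shift_star:
  assumes i: "i \<in> {1..n}"
  shows "(\<Sum>c<p. star (embed Y B m c y) * (star (S i) * embed Y B m c z)) = gram p Y B m y (B i z) *\<^sub>C 1"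
proof -
  have "(\<Sum>c<p. star (embed Y B m c y) * (star (S i) * embed Y B m c z))
      = star (\<Sum>c<p. star (embed Y B m c z) * (S i * embed Y B m c y))"
    by (simp add: star_sum mult.assoc)
  also have "\<dots> = gram p Y B m y (B i z) *\<^sub>C 1" unfolding embed_shift[OF i] by (simp add: cnj_gram)
  finally show ?thesis .
qed

lemma words_Suc: "words (Suc m) = insert [] (\<Union>i\<in>{1..n}. (#) i ` words m)"
proof (intro equalityI subsetI)
  fix w assume "w \<in> words (Suc m)"
  then show "w \<in> insert [] (\<Union>i\<in>{1..n}. (#) i ` words m)"
    by (cases w) (auto simp: words_def)
qed (auto simp: words_def)

lemma gram_Suc:
  "gram p Y B (Suc m) y z = ip p (Y y) (Y z) + (\<Sum>i\<in>{1..n}. gram p Y B m (B i y) (B i z))"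
  unfolding gram_def words_Suc
  by (subst sum.insert, simp, force, subst sum.UNION_disjoint) (auto simp: sum.reindex)

lemma gram_0: "gram p Y B 0 y z = ip p (Y y) (Y z)"
proof -
  have "words 0 = {[]}" by (auto simp: words_def)
  then show ?thesis by (simp add: gram_def)
qed

text \<open>By \<open>iso\<close>, the defect \<open>ip - gram\<close> at level \<open>m + 1\<close>
  is the sum over \<open>i\<close> of the defects at level \<open>m\<close> of the pairs
  \<open>B i y\<close>, \<open>B i z\<close>. Each level contributes a factor \<open>r\<close>
  through \<open>contr\<close>, so the defect decays geometrically.\<close>

lemma gram_tendsto:
  assumes iso: "\<And>y z. ip p (Y y) (Y z) + (\<Sum>i\<in>{1..n}. ip p (B i y) (B i z)) = ip p y z"
    and contr: "\<And>y. (\<Sum>i\<in>{1..n}. Re (ip p (B i y) (B i y))) \<le> r * Re (ip p y y)"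
    and r: "0 \<le> r" "r < 1"
  shows "(\<lambda>m. gram p Y B m y z) \<longlonglongrightarrow> ip p y z"
proof -
  have step: "(\<Sum>i\<in>{1..n}. (Re (ip p (B i y) (B i y)) + Re (ip p (B i z) (B i z))) / 2)
      \<le> r * ((Re (ip p y y) + Re (ip p z z)) / 2)" for y z
    using contr[of y] contr[of z]
    by (simp add: sum.distrib field_simps flip: sum_divide_distrib)
  have bound: "cmod (ip p y z - gram p Y B m y z) \<le> r ^ Suc m * ((Re (ip p y y) + Re (ip p z z)) / 2)" for m y z
  proof (induction m arbitrary: y z)
    case 0
    have "ip p y z - gram p Y B 0 y z = (\<Sum>i\<in>{1..n}. ip p (B i y) (B i z))"
      using iso[of y z] by (simp add: gram_0 algebra_simps)
    also have "cmod \<dots> \<le> (\<Sum>i\<in>{1..n}. (Re (ip p (B i y) (B i y)) + Re (ip p (B i z) (B i z))) / 2)"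
      by (intro sum_norm_le cmod_ip_le)
    also note step
    finally show ?case by simp
  next
    case (Suc m)
    let ?b = "\<lambda>i. (Re (ip p (B i y) (B i y)) + Re (ip p (B i z) (B i z))) / 2"
    have eq: "ip p y z - gram p Y B (Suc m) y z
        = (\<Sum>i\<in>{1..n}. ip p (B i y) (B i z) - gram p Y B m (B i y) (B i z))"
      using iso[of y z] by (simp add: gram_Suc sum_subtractf algebra_simps)
    have "cmod (\<Sum>i\<in>{1..n}. ip p (B i y) (B i z) - gram p Y B m (B i y) (B i z))
        \<le> (\<Sum>i\<in>{1..n}. r ^ Suc m * ?b i)"
      by (rule sum_norm_le) (rule Suc.IH)
    moreover have "r ^ Suc m * (\<Sum>i\<in>{1..n}. ?b i) \<le> r ^ Suc m * (r * ((Re (ip p y y) + Re (ip p z z)) / 2))"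
      by (rule mult_left_mono[OF step zero_le_power[OF r(1)]])
    ultimately show ?case by (simp only: eq sum_distrib_left) (simp only: power_Suc mult_ac)
  qed
  have "(\<lambda>m. r ^ Suc m * ((Re (ip p y y) + Re (ip p z z)) / 2)) \<longlonglongrightarrow> 0 * ((Re (ip p y y) + Re (ip p z z)) / 2)"
    using r by (intro tendsto_mult tendsto_const LIMSEQ_Suc[OF LIMSEQ_power_zero]) auto
  then have "(\<lambda>m. r ^ Suc m * ((Re (ip p y y) + Re (ip p z z)) / 2)) \<longlonglongrightarrow> 0" by simp
  then have "(\<lambda>m. ip p y z - gram p Y B m y z) \<longlonglongrightarrow> 0"
  proof (rule tendsto_0_le[where K = 1], intro always_eventually allI)
    fix m
    show "cmod (ip p y z - gram p Y B m y z) \<le> norm (r ^ Suc m * ((Re (ip p y y) + Re (ip p z z)) / 2)) * 1"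
      using bound[of y z m] abs_ge_self[of "r ^ Suc m * ((Re (ip p y y) + Re (ip p z z)) / 2)"]
      unfolding real_norm_def mult_1_right by (rule order_trans)
  qed
  from tendsto_diff[OF tendsto_const[of "ip p y z"] this] show ?thesis by simp
qed

definition lin :: "complex \<Rightarrow> (nat \<Rightarrow> complex) \<Rightarrow> (nat \<Rightarrow> complex) \<Rightarrow> 'o" where
  "lin a b c = a *\<^sub>C 1 + (\<Sum>i\<in>{1..n}. b i *\<^sub>C S i) + (\<Sum>i\<in>{1..n}. c i *\<^sub>C star (S i))"

lemma embed_lin:
  "(\<Sum>e<p. star (embed Y B m e y) * lin a b c * embed Y B m e z)
    = (a * gram p Y B (Suc m) y z + (\<Sum>i\<in>{1..n}. b i * gram p Y B m (B i y) z)
        + (\<Sum>i\<in>{1..n}. c i * gram p Y B m y (B i z))) *\<^sub>C 1"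
proof -
  let ?u = "\<lambda>e. embed Y B m e y" and ?v = "\<lambda>e. embed Y B m e z"
  have "(\<Sum>e<p. star (?u e) * lin a b c * ?v e)
      = a *\<^sub>C (\<Sum>e<p. star (?u e) * ?v e) + (\<Sum>e<p. \<Sum>i\<in>{1..n}. b i *\<^sub>C (star (?u e) * (S i * ?v e)))
        + (\<Sum>e<p. \<Sum>i\<in>{1..n}. c i *\<^sub>C (star (?u e) * (star (S i) * ?v e)))"
    by (simp add: lin_def distrib_left distrib_right sum.distrib sum_distrib_left sum_distrib_right
        mult_scaleC_left mult_scaleC_right scaleC_sum_right mult.assoc)
  also have "(\<Sum>e<p. \<Sum>i\<in>{1..n}. b i *\<^sub>C (star (?u e) * (S i * ?v e)))
      = (\<Sum>i\<in>{1..n}. b i *\<^sub>C (\<Sum>e<p. star (?u e) * (S i * ?v e)))"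
    by (subst sum.swap) (simp add: scaleC_sum_right)
  also have "(\<Sum>e<p. \<Sum>i\<in>{1..n}. c i *\<^sub>C (star (?u e) * (star (S i) * ?v e)))
      = (\<Sum>i\<in>{1..n}. c i *\<^sub>C (\<Sum>e<p. star (?u e) * (star (S i) * ?v e)))"
    by (subst sum.swap) (simp add: scaleC_sum_right)
  finally show ?thesis
    by (simp add: embed_gram embed_shift embed_shift_star scaleC_scaleC scaleC_add_left scaleC_sum_left)
qed

text \<open>For finite \<open>m\<close>, compressing \<open>X\<close> by the embedded vectors gives
  a positive multiple of 1 whose factor is the displayed sum with \<open>gram\<close> in place of
  \<open>ip\<close>. Positivity survives the limit.\<close>

lemma compression:
  assumes iso: "\<And>y z. ip p (Y y) (Y z) + (\<Sum>i\<in>{1..n}. ip p (B i y) (B i z)) = ip p y z"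
    and contr: "\<And>y. (\<Sum>i\<in>{1..n}. Re (ip p (B i y) (B i y))) \<le> r * Re (ip p y y)"
    and r: "0 \<le> r" "r < 1"
    and X: "X \<in> mat_positive q"
    and Xkl: "\<And>k l. k < q \<Longrightarrow> l < q \<Longrightarrow> X $$ (k, l) = lin (a k l) (b k l) (c k l)"
  shows "pos (\<Sum>k<q. \<Sum>l<q. a k l * ip p (z k) (z l) + (\<Sum>i\<in>{1..n}. b k l i * ip p (B i (z k)) (z l))
      + (\<Sum>i\<in>{1..n}. c k l i * ip p (z k) (B i (z l))))"
proof -
  define T where "T m = (\<Sum>k<q. \<Sum>l<q. a k l * gram p Y B (Suc m) (z k) (z l)
      + (\<Sum>i\<in>{1..n}. b k l i * gram p Y B m (B i (z k)) (z l))
      + (\<Sum>i\<in>{1..n}. c k l i * gram p Y B m (z k) (B i (z l))))" for m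
  have "pos (T m)" for m
  proof -
    let ?e = "\<lambda>e k. embed Y B m e (z k)"
    have "pos (\<Sum>e<p. form q X (?e e) (?e e))"
      using X by (intro pos_sum) (auto simp: mat_positive_iff)
    also have "(\<Sum>e<p. form q X (?e e) (?e e))
        = (\<Sum>e<p. \<Sum>k<q. \<Sum>l<q. star (?e e k) * lin (a k l) (b k l) (c k l) * ?e e l)"
      unfolding form_altdef by (intro sum.cong refl) (simp add: Xkl)
    also have "\<dots> = (\<Sum>k<q. \<Sum>l<q. \<Sum>e<p. star (?e e k) * lin (a k l) (b k l) (c k l) * ?e e l)"
      by (subst sum.swap) (intro sum.cong refl sum.swap)
    also have "\<dots> = T m *\<^sub>C 1" unfolding embed_lin T_def by (simp add: scaleC_sum_left)
    finally show ?thesis by (rule pos_scaleC_one)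
  qed
  moreover have g: "(\<lambda>m. gram p Y B m y z) \<longlonglongrightarrow> ip p y z" for y z by (rule gram_tendsto[OF iso contr r])
  have "T \<longlonglongrightarrow> (\<Sum>k<q. \<Sum>l<q. a k l * ip p (z k) (z l) + (\<Sum>i\<in>{1..n}. b k l i * ip p (B i (z k)) (z l))
      + (\<Sum>i\<in>{1..n}. c k l i * ip p (z k) (B i (z l))))"
    unfolding T_def by (intro tendsto_intros g LIMSEQ_Suc[OF g])
  ultimately show ?thesis by (rule pos_limit)
qed

end

section \<open>The dual of the Cuntz operator system\<close>

interpretation scaleC: vector_space "scaleC :: complex \<Rightarrow> 'a \<Rightarrow> 'a::unital_cstar_algebra"
  by (rule vector_space_scaleC)

context cuntz
begin

lemma lin_add: "lin a b c + lin a' b' c' = lin (a + a') (\<lambda>i. b i + b' i) (\<lambda>i. c i + c' i)"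
  by (simp add: lin_def scaleC_add_left sum.distrib algebra_simps)

lemma lin_scaleC: "t *\<^sub>C lin a b c = lin (t * a) (\<lambda>i. t * b i) (\<lambda>i. t * c i)"
  by (simp add: lin_def scaleC_add_right scaleC_sum_right scaleC_scaleC)

lemma star_lin: "star (lin a b c) = lin (cnj a) (\<lambda>i. cnj (c i)) (\<lambda>i. cnj (b i))"
  by (simp add: lin_def star_sum algebra_simps)

lemma lin_basis:
  "1 = lin 1 (\<lambda>_. 0) (\<lambda>_. 0)"
  "i \<in> {1..n} \<Longrightarrow> S i = lin 0 (\<lambda>j. if j = i then 1 else 0) (\<lambda>_. 0)"
  "i \<in> {1..n} \<Longrightarrow> star (S i) = lin 0 (\<lambda>_. 0) (\<lambda>j. if j = i then 1 else 0)"
  by (simp_all add: lin_def if_distrib[of "\<lambda>t. t *\<^sub>C _"] sum.delta cong: if_cong)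

lemma lin_in_system: "lin a b c \<in> cuntz_system n S"
  unfolding lin_def cuntz_system_def cspan_def
  by (intro scaleC.span_add scaleC.span_scale scaleC.span_sum scaleC.span_base) auto

lemma system_iff: "x \<in> cuntz_system n S \<longleftrightarrow> (\<exists>a b c. x = lin a b c)"
proof
  assume "x \<in> cuntz_system n S"
  then have "x \<in> scaleC.span ({1} \<union> S ` {1..n} \<union> (star \<circ> S) ` {1..n})"
    by (simp add: cuntz_system_def cspan_def)
  then show "\<exists>a b c. x = lin a b c"
  proof (induction rule: scaleC.span_induct_alt)
    case base
    have "0 = lin 0 (\<lambda>_. 0) (\<lambda>_. 0)" by (simp add: lin_def)
    then show ?case by blast
  next
    case (step t x y)
    from step(1) have "\<exists>a b c. x = lin a b c" using lin_basis by fastforce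
    then show ?case using step(2) lin_scaleC lin_add by metis
  qed
qed (auto simp: lin_in_system)

lemma system_closed:
  "x \<in> cuntz_system n S \<Longrightarrow> y \<in> cuntz_system n S \<Longrightarrow> x + y \<in> cuntz_system n S"
  "x \<in> cuntz_system n S \<Longrightarrow> t *\<^sub>C x \<in> cuntz_system n S"
  "x \<in> cuntz_system n S \<Longrightarrow> star x \<in> cuntz_system n S"
  by (auto simp: system_iff lin_add lin_scaleC star_lin) blast+

lemma generators_in_system:
  "1 \<in> cuntz_system n S"
  "i \<in> {1..n} \<Longrightarrow> S i \<in> cuntz_system n S"
  "i \<in> {1..n} \<Longrightarrow> star (S i) \<in> cuntz_system n S"
  using lin_basis lin_in_system by metis+

section \<open>Linear independence of the generators and the dual basis\<close>

lemma scaleC_one_inject: "s *\<^sub>C (1::'o) = t *\<^sub>C 1 \<Longrightarrow> s = t"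
  using norm_scaleC[of "s - t" "1::'o"] by (simp add: scaleC_diff_left)

text \<open>The coordinates are the matrix entries of \<open>x\<close> at the Fock vectors of length at most one.\<close>

lemma lin_coordinates:
  shows "star (fock 2 []) * lin a b c * fock 2 [] = a *\<^sub>C 1"
    and "i \<in> {1..n} \<Longrightarrow> star (fock 2 [i]) * lin a b c * fock 2 [] = b i *\<^sub>C 1"
    and "i \<in> {1..n} \<Longrightarrow> star (fock 2 []) * lin a b c * fock 2 [i] = c i *\<^sub>C 1"
proof -
  have left: "star (fock 2 w) * lin a b c * fock 2 v
      = a *\<^sub>C (star (fock 2 w) * fock 2 v) + (\<Sum>j\<in>{1..n}. b j *\<^sub>C (star (fock 2 w) * fock 2 (j # v)))
        + (\<Sum>j\<in>{1..n}. c j *\<^sub>C (star (fock 2 (j # w)) * fock 2 v))" for w v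
    by (simp add: lin_def distrib_left distrib_right sum_distrib_left sum_distrib_right fock_Cons
        mult_scaleC_left mult_scaleC_right mult.assoc)
  show "star (fock 2 []) * lin a b c * fock 2 [] = a *\<^sub>C 1"
    unfolding left by (simp add: fock_gram words_def)
  show "star (fock 2 [i]) * lin a b c * fock 2 [] = b i *\<^sub>C 1" if "i \<in> {1..n}"
    using that unfolding left
    by (simp add: fock_gram words_def if_distrib[of "\<lambda>t. _ *\<^sub>C t"] sum.delta' cong: if_cong)
  show "star (fock 2 []) * lin a b c * fock 2 [i] = c i *\<^sub>C 1" if "i \<in> {1..n}"
    using that unfolding left
    by (simp add: fock_gram words_def if_distrib[of "\<lambda>t. _ *\<^sub>C t"] sum.delta' cong: if_cong)
qed

lemma lin_inject:
  assumes "lin a b c = lin a' b' c'"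
  shows "a = a'" "i \<in> {1..n} \<Longrightarrow> b i = b' i" "i \<in> {1..n} \<Longrightarrow> c i = c' i"
proof -
  note coords = lin_coordinates[where a = a and b = b and c = c, unfolded assms lin_coordinates]
  show "a = a'" using coords(1) by (rule scaleC_one_inject[symmetric])
  show "b i = b' i" if "i \<in> {1..n}" using coords(2)[OF that] lin_coordinates(2)[OF that, of a' b' c']
    by (intro scaleC_one_inject) simp
  show "c i = c' i" if "i \<in> {1..n}" using coords(3)[OF that] lin_coordinates(3)[OF that, of a' b' c']
    by (intro scaleC_one_inject) simp
qed

text \<open>The functional with prescribed values at the generators. The description is well defined
  because \<open>lin_inject\<close> makes the coordinates unique up to irrelevant indices, and the
  value 0 elsewhere is what membership in \<open>cuntz_dual\<close> asks for.\<close>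

definition dual_fun :: "complex \<Rightarrow> (nat \<Rightarrow> complex) \<Rightarrow> (nat \<Rightarrow> complex) \<Rightarrow> 'o \<Rightarrow> complex" where
  "dual_fun \<alpha> \<beta> \<gamma> x = (if x \<in> cuntz_system n S
     then THE s. \<exists>a b c. x = lin a b c \<and> s = a * \<alpha> + (\<Sum>i\<in>{1..n}. b i * \<beta> i) + (\<Sum>i\<in>{1..n}. c i * \<gamma> i)
     else 0)"

lemma dual_fun_lin:
  "dual_fun \<alpha> \<beta> \<gamma> (lin a b c) = a * \<alpha> + (\<Sum>i\<in>{1..n}. b i * \<beta> i) + (\<Sum>i\<in>{1..n}. c i * \<gamma> i)"
proof -
  have "(THE s. \<exists>a' b' c'. lin a b c = lin a' b' c' \<and>
      s = a' * \<alpha> + (\<Sum>i\<in>{1..n}. b' i * \<beta> i) + (\<Sum>i\<in>{1..n}. c' i * \<gamma> i))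
    = a * \<alpha> + (\<Sum>i\<in>{1..n}. b i * \<beta> i) + (\<Sum>i\<in>{1..n}. c i * \<gamma> i)"
  proof (rule the_equality)
    fix s assume "\<exists>a' b' c'. lin a b c = lin a' b' c' \<and>
      s = a' * \<alpha> + (\<Sum>i\<in>{1..n}. b' i * \<beta> i) + (\<Sum>i\<in>{1..n}. c' i * \<gamma> i)"
    then obtain a' b' c' where e: "lin a b c = lin a' b' c'"
      and s: "s = a' * \<alpha> + (\<Sum>i\<in>{1..n}. b' i * \<beta> i) + (\<Sum>i\<in>{1..n}. c' i * \<gamma> i)" by blast
    show "s = a * \<alpha> + (\<Sum>i\<in>{1..n}. b i * \<beta> i) + (\<Sum>i\<in>{1..n}. c i * \<gamma> i)"
      unfolding s using lin_inject[OF e] by simp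
  qed blast
  then show ?thesis by (simp add: dual_fun_def lin_in_system)
qed

lemma dual_fun_in_dual: "dual_fun \<alpha> \<beta> \<gamma> \<in> cuntz_dual n S"
  unfolding cuntz_dual_def
proof (intro CollectI conjI ballI allI impI)
  fix x y assume "x \<in> cuntz_system n S" "y \<in> cuntz_system n S"
  then show "dual_fun \<alpha> \<beta> \<gamma> (x + y) = dual_fun \<alpha> \<beta> \<gamma> x + dual_fun \<alpha> \<beta> \<gamma> y"
    by (auto simp: system_iff lin_add dual_fun_lin algebra_simps sum.distrib)
next
  fix t x assume "x \<in> cuntz_system n S"
  then show "dual_fun \<alpha> \<beta> \<gamma> (t *\<^sub>C x) = t * dual_fun \<alpha> \<beta> \<gamma> x"
    by (auto simp: system_iff lin_scaleC dual_fun_lin algebra_simps sum_distrib_left)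
qed (simp add: dual_fun_def)

lemma dual_fun_values:
  "dual_fun \<alpha> \<beta> \<gamma> 1 = \<alpha>"
  "i \<in> {1..n} \<Longrightarrow> dual_fun \<alpha> \<beta> \<gamma> (S i) = \<beta> i"
  "i \<in> {1..n} \<Longrightarrow> dual_fun \<alpha> \<beta> \<gamma> (star (S i)) = \<gamma> i"
proof -
  show "dual_fun \<alpha> \<beta> \<gamma> 1 = \<alpha>" by (simp add: lin_basis(1) dual_fun_lin)
  show "dual_fun \<alpha> \<beta> \<gamma> (S i) = \<beta> i" if "i \<in> {1..n}"
    unfolding lin_basis(2)[OF that] dual_fun_lin
    using that by (simp add: if_distrib[of "\<lambda>t. t * _"] sum.delta cong: if_cong)
  show "dual_fun \<alpha> \<beta> \<gamma> (star (S i)) = \<gamma> i" if "i \<in> {1..n}"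
    unfolding lin_basis(3)[OF that] dual_fun_lin
    using that by (simp add: if_distrib[of "\<lambda>t. t * _"] sum.delta cong: if_cong)
qed

lemma dual_sum:
  assumes "f \<in> cuntz_dual n S" "finite I" "\<And>i. i \<in> I \<Longrightarrow> x i \<in> cuntz_system n S"
  shows "f (\<Sum>i\<in>I. t i *\<^sub>C x i) = (\<Sum>i\<in>I. t i * f (x i)) \<and> (\<Sum>i\<in>I. t i *\<^sub>C x i) \<in> cuntz_system n S"
  using assms(2,3)
proof (induction I rule: finite_induct)
  case empty
  have "0 = lin 0 (\<lambda>_. 0) (\<lambda>_. 0)" by (simp add: lin_def)
  then have "0 \<in> cuntz_system n S" using lin_in_system by metis
  moreover have "f (0 *\<^sub>C 1) = 0 * f 1"
    using assms(1) generators_in_system(1) unfolding cuntz_dual_def by blast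
  ultimately show ?case by simp
next
  case (insert i I)
  then show ?case using assms(1) by (auto simp: cuntz_dual_def system_closed)
qed

lemma dual_lin:
  assumes f: "f \<in> cuntz_dual n S"
  shows "f (lin a b c) = a * f 1 + (\<Sum>i\<in>{1..n}. b i * f (S i)) + (\<Sum>i\<in>{1..n}. c i * f (star (S i)))"
proof -
  have add: "f (x + y) = f x + f y" if "x \<in> cuntz_system n S" "y \<in> cuntz_system n S" for x y
    using f that by (simp add: cuntz_dual_def)
  have "f (a *\<^sub>C 1) = a * f 1" using f generators_in_system by (simp add: cuntz_dual_def)
  moreover note dual_sum[OF f, of "{1..n}" S b] dual_sum[OF f, of "{1..n}" "\<lambda>i. star (S i)" c]
  ultimately show ?thesis
    unfolding lin_def by (simp add: add system_closed generators_in_system)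
qed

lemma dual_eq_dual_fun:
  assumes f: "f \<in> cuntz_dual n S"
    and "f 1 = \<alpha>" "\<And>i. i \<in> {1..n} \<Longrightarrow> f (S i) = \<beta> i" "\<And>i. i \<in> {1..n} \<Longrightarrow> f (star (S i)) = \<gamma> i"
  shows "f = dual_fun \<alpha> \<beta> \<gamma>"
proof
  fix x
  show "f x = dual_fun \<alpha> \<beta> \<gamma> x"
  proof (cases "x \<in> cuntz_system n S")
    case True
    then obtain a b c where "x = lin a b c" by (auto simp: system_iff)
    then show ?thesis using assms(2-) by (simp add: dual_lin[OF f] dual_fun_lin)
  next
    case False
    then show ?thesis using f by (simp add: dual_fun_def cuntz_dual_def)
  qed
qed

lemma delta_0_eq: "delta_0 n S = dual_fun 1 (\<lambda>_. 0) (\<lambda>_. 0)"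
  unfolding delta_0_def
  by (rule the_equality) (auto simp: dual_fun_in_dual dual_fun_values intro!: dual_eq_dual_fun)

lemma delta_eq: "delta n S i = dual_fun 0 (\<lambda>j. if i = j then 1 else 0) (\<lambda>_. 0)"
  unfolding delta_def
  by (rule the_equality) (auto simp: dual_fun_in_dual dual_fun_values intro!: dual_eq_dual_fun)

lemma dual_star_dual_fun:
  "dual_star (dual_fun \<alpha> \<beta> \<gamma>) = dual_fun (cnj \<alpha>) (\<lambda>i. cnj (\<gamma> i)) (\<lambda>i. cnj (\<beta> i))"
proof
  fix x
  show "dual_star (dual_fun \<alpha> \<beta> \<gamma>) x = dual_fun (cnj \<alpha>) (\<lambda>i. cnj (\<gamma> i)) (\<lambda>i. cnj (\<beta> i)) x"
  proof (cases "x \<in> cuntz_system n S")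
    case True
    then obtain a b c where "x = lin a b c" by (auto simp: system_iff)
    then show ?thesis by (simp add: dual_star_def star_lin dual_fun_lin cnj_sum)
  next
    case False
    then have "star x \<notin> cuntz_system n S" using system_closed(3)[of "star x"] by auto
    with False show ?thesis by (simp add: dual_star_def dual_fun_def)
  qed
qed

lemma dual_fun_cong:
  "\<alpha> = \<alpha>' \<Longrightarrow> (\<And>i. i \<in> {1..n} \<Longrightarrow> \<beta> i = \<beta>' i) \<Longrightarrow> (\<And>i. i \<in> {1..n} \<Longrightarrow> \<gamma> i = \<gamma>' i) \<Longrightarrow>
    dual_fun \<alpha> \<beta> \<gamma> = dual_fun \<alpha>' \<beta>' \<gamma>'"
  by (rule dual_eq_dual_fun) (auto simp: dual_fun_in_dual dual_fun_values)

lemma dual_linear_dual_fun: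
  fixes \<phi> :: "('o \<Rightarrow> complex) \<Rightarrow> 'a::unital_cstar_algebra"
  assumes \<phi>: "dual_linear n S \<phi>" and unit: "\<phi> (delta_0 n S) = 1"
  shows "\<phi> (dual_fun \<alpha> \<beta> \<gamma>) = \<alpha> *\<^sub>C 1 + (\<Sum>i\<in>{1..n}. \<beta> i *\<^sub>C \<phi> (delta n S i))
    + (\<Sum>i\<in>{1..n}. \<gamma> i *\<^sub>C \<phi> (dual_star (delta n S i)))"
proof -
  have add: "\<phi> (dual_fun \<alpha> \<beta> \<gamma>) + \<phi> (dual_fun \<alpha>' \<beta>' \<gamma>')
      = \<phi> (dual_fun (\<alpha> + \<alpha>') (\<lambda>i. \<beta> i + \<beta>' i) (\<lambda>i. \<gamma> i + \<gamma>' i))" for \<alpha> \<beta> \<gamma> \<alpha>' \<beta>' \<gamma>'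
  proof -
    have "(\<lambda>x. dual_fun \<alpha> \<beta> \<gamma> x + dual_fun \<alpha>' \<beta>' \<gamma>' x)
        = dual_fun (\<alpha> + \<alpha>') (\<lambda>i. \<beta> i + \<beta>' i) (\<lambda>i. \<gamma> i + \<gamma>' i)"
    proof (rule dual_eq_dual_fun)
      show "(\<lambda>x. dual_fun \<alpha> \<beta> \<gamma> x + dual_fun \<alpha>' \<beta>' \<gamma>' x) \<in> cuntz_dual n S"
        using dual_fun_in_dual[of \<alpha> \<beta> \<gamma>] dual_fun_in_dual[of \<alpha>' \<beta>' \<gamma>']
        by (auto simp: cuntz_dual_def algebra_simps)
    qed (auto simp: dual_fun_values)
    then show ?thesis using \<phi> dual_fun_in_dual unfolding dual_linear_def by metis
  qed
  have scale: "\<phi> (dual_fun (t * \<alpha>) (\<lambda>i. t * \<beta> i) (\<lambda>i. t * \<gamma> i)) = t *\<^sub>C \<phi> (dual_fun \<alpha> \<beta> \<gamma>)" for t \<alpha> \<beta> \<gamma>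
  proof -
    have "(\<lambda>x. t * dual_fun \<alpha> \<beta> \<gamma> x) = dual_fun (t * \<alpha>) (\<lambda>i. t * \<beta> i) (\<lambda>i. t * \<gamma> i)"
    proof (rule dual_eq_dual_fun)
      show "(\<lambda>x. t * dual_fun \<alpha> \<beta> \<gamma> x) \<in> cuntz_dual n S"
        using dual_fun_in_dual[of \<alpha> \<beta> \<gamma>] by (auto simp: cuntz_dual_def algebra_simps)
    qed (auto simp: dual_fun_values)
    then show ?thesis using \<phi> dual_fun_in_dual unfolding dual_linear_def by metis
  qed
  let ?z = "\<lambda>_::nat. 0::complex"
  have zero: "\<phi> (dual_fun 0 ?z ?z) = 0" using scale[of 0 0 ?z ?z] by simp
  \<comment> \<open>Linearity is stated for binary sums of functionals, so the expansion is built
    one generator at a time, with the coefficients cut off outside \<open>I\<close>.\<close>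
  let ?on = "\<lambda>I \<beta> i. if i \<in> I then \<beta> i else 0 :: complex"
  have 1: "\<phi> (dual_fun 0 (?on I \<beta>) ?z) = (\<Sum>i\<in>I. \<beta> i *\<^sub>C \<phi> (delta n S i))" if "finite I" for I
    using that
  proof (induction I rule: finite_induct)
    case (insert k I)
    have "(\<Sum>i\<in>insert k I. \<beta> i *\<^sub>C \<phi> (delta n S i)) = \<beta> k *\<^sub>C \<phi> (delta n S k) + \<phi> (dual_fun 0 (?on I \<beta>) ?z)"
      using insert by simp
    also have "\<dots> = \<phi> (dual_fun 0 (?on (insert k I) \<beta>) ?z)"
      unfolding delta_eq scale[symmetric] add
      by (rule arg_cong[of _ _ \<phi>], rule dual_fun_cong) (use insert in auto)
    finally show ?case by simp
  qed (simp add: zero)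
  have 2: "\<phi> (dual_fun 0 ?z (?on I \<gamma>)) = (\<Sum>i\<in>I. \<gamma> i *\<^sub>C \<phi> (dual_star (delta n S i)))" if "finite I" for I
    using that
  proof (induction I rule: finite_induct)
    case (insert k I)
    have "(\<Sum>i\<in>insert k I. \<gamma> i *\<^sub>C \<phi> (dual_star (delta n S i)))
        = \<gamma> k *\<^sub>C \<phi> (dual_star (delta n S k)) + \<phi> (dual_fun 0 ?z (?on I \<gamma>))"
      using insert by simp
    also have "\<dots> = \<phi> (dual_fun 0 ?z (?on (insert k I) \<gamma>))"
      unfolding delta_eq dual_star_dual_fun scale[symmetric] add
      by (rule arg_cong[of _ _ \<phi>], rule dual_fun_cong) (use insert in auto)
    finally show ?case by simp
  qed (simp add: zero)
  have "dual_fun \<alpha> \<beta> \<gamma> = dual_fun (\<alpha> * 1 + 0 + 0) (\<lambda>i. \<alpha> * 0 + ?on {1..n} \<beta> i + 0) (\<lambda>i. \<alpha> * 0 + 0 + ?on {1..n} \<gamma> i)"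
    by (rule dual_fun_cong) auto
  then show ?thesis
    by (simp only: add[symmetric] scale 1[OF finite_atLeastAtMost] 2[OF finite_atLeastAtMost]
        unit[unfolded delta_0_eq])
qed

end

section \<open>Block matrices, tensors and row contractions\<close>

lemma sum_lessThan_mult: "(\<Sum>r<q * p. f r) = (\<Sum>k<q. \<Sum>a<p. f (k * p + a :: nat) :: 'b::comm_monoid_add)"
proof -
  have "sum f {k * p..<k * p + p} = (\<Sum>a<p. f (k * p + a))" for k
    by (rule sum.reindex_bij_witness[of _ "\<lambda>a. k * p + a" "\<lambda>r. r - k * p"]) auto
  then show ?thesis by (simp flip: sum.nat_group)
qed

lemma form_flatten:
  "form (q * p) (mat_flatten q p X) (\<lambda>r. z (r div p) (r mod p)) (\<lambda>r. z (r div p) (r mod p))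
    = (\<Sum>k<q. \<Sum>l<q. form p (X $$ (k, l)) (z k) (z l))"
proof -
  have lt: "k * p + a < q * p" if "k < q" "a < p" for k a
  proof -
    have "k * p + a < Suc k * p" using that by simp
    also have "\<dots> \<le> q * p" using that by (intro mult_le_mono1) simp
    finally show ?thesis .
  qed
  have "form (q * p) (mat_flatten q p X) (\<lambda>r. z (r div p) (r mod p)) (\<lambda>r. z (r div p) (r mod p))
      = (\<Sum>k<q. \<Sum>a<p. \<Sum>l<q. \<Sum>b<p. star (z k a) * X $$ (k, l) $$ (a, b) * z l b)"
    unfolding form_altdef sum_lessThan_mult
    by (intro sum.cong refl) (simp add: mat_flatten_def lt)
  also have "\<dots> = (\<Sum>k<q. \<Sum>l<q. form p (X $$ (k, l)) (z k) (z l))"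
    unfolding form_altdef by (intro sum.cong refl sum.swap)
  finally show ?thesis .
qed

lemma mat_sum_carrier [simp]: "mat_sum p X I \<in> carrier_mat p p"
  by (simp add: mat_sum_def)

text \<open>The shape shared by elements of the system, of its dual and of their images: a constant
  part, a part for the generators and a part for their adjoints.\<close>

lemma form_sum_entries:
  assumes "\<And>k l. k < p \<Longrightarrow> l < p \<Longrightarrow> M $$ (k, l) = P $$ (k, l) + (\<Sum>i\<in>I. Q i $$ (k, l)) + (\<Sum>i\<in>I. R i $$ (k, l))"
  shows "form p M v w = form p P v w + (\<Sum>i\<in>I. form p (Q i) v w) + (\<Sum>i\<in>I. form p (R i) v w)"
proof -
  have swap: "(\<Sum>k<p. \<Sum>l<p. \<Sum>i\<in>I. h k l i) = (\<Sum>i\<in>I. \<Sum>k<p. \<Sum>l<p. h k l i)" for h :: "nat \<Rightarrow> nat \<Rightarrow> _ \<Rightarrow> 'a"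
  proof -
    have "(\<Sum>k<p. \<Sum>l<p. \<Sum>i\<in>I. h k l i) = (\<Sum>k<p. \<Sum>i\<in>I. \<Sum>l<p. h k l i)"
      by (intro sum.cong refl sum.swap)
    also have "\<dots> = (\<Sum>i\<in>I. \<Sum>k<p. \<Sum>l<p. h k l i)" by (rule sum.swap)
    finally show ?thesis .
  qed
  have "form p M v w = (\<Sum>k<p. \<Sum>l<p. star (v k) * P $$ (k, l) * w l + (\<Sum>i\<in>I. star (v k) * Q i $$ (k, l) * w l)
      + (\<Sum>i\<in>I. star (v k) * R i $$ (k, l) * w l))"
    unfolding form_altdef
    by (intro sum.cong refl) (simp add: assms distrib_left distrib_right sum_distrib_left sum_distrib_right)
  then show ?thesis unfolding sum.distrib swap by (simp only: form_altdef)
qed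

lemma form_mat_sum: "form p (mat_sum p X I) v w = (\<Sum>i\<in>I. form p (X i) v w)"
  using form_sum_entries[of p "mat_sum p X I" "0\<^sub>m p p" X I "\<lambda>_. 0\<^sub>m p p" v w]
  by (simp add: mat_sum_def form_altdef)

lemma dim_mat_star [simp]: "dim_row (mat_star X) = dim_col X" "dim_col (mat_star X) = dim_row X"
  by (simp_all add: mat_star_def)

lemma form_mat_star: "X \<in> carrier_mat p p \<Longrightarrow> form p (mat_star X) v w = star (form p X w v)"
  by (simp add: form_def ip_adjoint star_ip)

lemma form_eq_ip: "X \<in> carrier_mat p p \<Longrightarrow> form p X v w = ip p (app p (mat_star X) v) w"
  using ip_adjoint[of "mat_star X" p v w] by (simp add: form_def)

lemma mat_tensor_carrier [simp]: "A \<in> carrier_mat p p \<Longrightarrow> mat_tensor A a \<in> carrier_mat p p"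
  by (simp add: mat_tensor_def)

lemma mat_star_tensor: "mat_star (mat_tensor A a) = mat_tensor (mat_star A) (star a)"
  by (rule eq_matI) (auto simp: mat_star_def mat_tensor_def star_complex_def)

lemma mat_tensor_mult:
  assumes "A \<in> carrier_mat p p" "B \<in> carrier_mat p p"
  shows "mat_tensor A a * mat_tensor B b = mat_tensor (A * B) (a * b)"
proof (rule eq_matI)
  fix i j assume "i < dim_row (mat_tensor (A * B) (a * b))" "j < dim_col (mat_tensor (A * B) (a * b))"
  then have ij: "i < p" "j < p" using assms by (auto simp: mat_tensor_def)
  have "(mat_tensor A a * mat_tensor B b) $$ (i, j) = (\<Sum>r<p. (A $$ (i, r) * B $$ (r, j)) *\<^sub>C (a * b))"
    unfolding mult_mat_index[OF mat_tensor_carrier[OF assms(1)] mat_tensor_carrier[OF assms(2)] ij]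
    using assms ij
    by (intro sum.cong) (auto simp: mat_tensor_def mult_scaleC_left mult_scaleC_right scaleC_scaleC mult.commute)
  also have "\<dots> = ((A * B) $$ (i, j)) *\<^sub>C (a * b)"
    unfolding mult_mat_index[OF assms ij] by (simp add: scaleC_sum_left)
  also have "\<dots> = mat_tensor (A * B) (a * b) $$ (i, j)"
    using assms ij by (simp add: mat_tensor_def del: index_mult_mat(1))
  finally show "(mat_tensor A a * mat_tensor B b) $$ (i, j) = mat_tensor (A * B) (a * b) $$ (i, j)" .
qed (use assms in \<open>auto simp: mat_tensor_def\<close>)

text \<open>Conjugation by \<open>mat_tensor R 1\<close> touches only the matrix factor. This is how
  \<open>R\<close> moves from the coefficients of a dual element into the vector.\<close>

lemma form_tensor_conj:
  assumes "R \<in> carrier_mat p p" "B \<in> carrier_mat p p"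
  shows "form p (mat_tensor B a) (app p (mat_tensor R 1) v) (app p (mat_tensor R 1) v)
    = form p (mat_tensor (mat_star R * (B * R)) a) v v"
proof -
  have BR: "B * R \<in> carrier_mat p p" using assms by simp
  have Rt: "mat_tensor R 1 \<in> carrier_mat p p" "mat_tensor B a \<in> carrier_mat p p" using assms by auto
  have eq: "mat_tensor (mat_star R * (B * R)) a = mat_star (mat_tensor R 1) * (mat_tensor B a * mat_tensor R 1)"
    by (simp only: mat_star_tensor star_1 mat_tensor_mult[OF assms(2,1)]
        mat_tensor_mult[OF mat_star_carrier[OF assms(1)] BR] mult_1_left mult_1_right)
  show ?thesis
    unfolding eq form_mat_star_mult[OF Rt(1) mult_carrier_mat[OF Rt(2,1)]] form_mult[OF Rt(1,2)] ..
qed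

lemma form_defect:
  assumes "\<And>i. i \<in> I \<Longrightarrow> A i \<in> carrier_mat p p"
  shows "form p (1\<^sub>m p - mat_sum p (\<lambda>i. A i * mat_star (A i)) I) v w
    = ip p v w - (\<Sum>i\<in>I. ip p (app p (mat_star (A i)) v) (app p (mat_star (A i)) w))"
proof -
  have "form p (A i * mat_star (A i)) v w = ip p (app p (mat_star (A i)) v) (app p (mat_star (A i)) w)"
    if "i \<in> I" for i
    using form_gram[OF mat_star_carrier[OF assms[OF that]], of v w] by simp
  then show ?thesis
    unfolding form_diff[OF one_carrier_mat mat_sum_carrier] form_mat_sum form_one by simp
qed

lemma row_contraction_iff:
  "row_contraction n p A \<longleftrightarrow> (\<forall>i\<in>{1..n}. A i \<in> carrier_mat p p) \<and>
    (\<forall>v. pos (ip p v v - (\<Sum>i\<in>{1..n}. ip p (app p (mat_star (A i)) v) (app p (mat_star (A i)) v))))"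
proof (cases "\<forall>i\<in>{1..n}. A i \<in> carrier_mat p p")
  case True
  then have "form p (1\<^sub>m p - mat_sum p (\<lambda>i. A i * mat_star (A i)) {1..n}) v v
      = ip p v v - (\<Sum>i\<in>{1..n}. ip p (app p (mat_star (A i)) v) (app p (mat_star (A i)) v))" for v
    by (intro form_defect) blast
  with True show ?thesis
    by (simp add: row_contraction_def mat_positive_iff minus_carrier_mat)
qed (auto simp: row_contraction_def)

lemma pos_perturb:
  assumes "\<And>e. 0 < e \<Longrightarrow> pos (h + e *\<^sub>R k)"
  shows "pos h"
proof (rule pos_limit)
  show "pos (h + inverse (real (Suc m)) *\<^sub>R k)" for m by (rule assms) simp
  have "(\<lambda>m. h + inverse (real (Suc m)) *\<^sub>R k) \<longlonglongrightarrow> h + 0 *\<^sub>R k"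
    by (intro tendsto_intros LIMSEQ_inverse_real_of_nat)
  then show "(\<lambda>m. h + inverse (real (Suc m)) *\<^sub>R k) \<longlonglongrightarrow> h" by simp
qed

lemma ip_scaleC: "ip p (\<lambda>a. c *\<^sub>C v a) (\<lambda>a. d *\<^sub>C w a) = (cnj c * d) *\<^sub>C ip p v w"
  by (simp add: ip_def mult_scaleC_left mult_scaleC_right scaleC_scaleC scaleC_sum_right mult.commute)

lemma row_contraction_rotate:
  assumes A: "row_contraction n p A" and c: "cmod c = 1"
  shows "row_contraction n p (\<lambda>i. map_mat (scaleC c) (A i))"
  unfolding row_contraction_iff
proof (intro conjI allI ballI)
  fix v
  have cc: "c * cnj c = 1" using c complex_norm_square[of c] by simp
  have Ai: "A i \<in> carrier_mat p p" if "i \<in> {1..n}" for i using A that by (simp add: row_contraction_iff)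
  have "mat_star (map_mat (scaleC c) (A i)) = map_mat (scaleC (cnj c)) (mat_star (A i))" for i
    by (rule eq_matI) (auto simp: mat_star_def)
  then have "app p (mat_star (map_mat (scaleC c) (A i))) v a = cnj c *\<^sub>C app p (mat_star (A i)) v a"
    if "i \<in> {1..n}" "a < p" for i a
    using carrier_matD[OF Ai[OF that(1)]] that(2) by (simp add: app_def scaleC_sum_right mult_scaleC_left)
  then have "ip p (app p (mat_star (map_mat (scaleC c) (A i))) v) (app p (mat_star (map_mat (scaleC c) (A i))) v)
      = ip p (app p (mat_star (A i)) v) (app p (mat_star (A i)) v)" if "i \<in> {1..n}" for i
    using ip_cong[of p "app p (mat_star (map_mat (scaleC c) (A i))) v" "\<lambda>a. cnj c *\<^sub>C app p (mat_star (A i)) v a"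
        "app p (mat_star (map_mat (scaleC c) (A i))) v" "\<lambda>a. cnj c *\<^sub>C app p (mat_star (A i)) v a"] c that
    by (simp add: ip_scaleC cc)
  then show "pos (ip p v v - (\<Sum>i\<in>{1..n}. ip p (app p (mat_star (map_mat (scaleC c) (A i))) v)
      (app p (mat_star (map_mat (scaleC c) (A i))) v)))"
    using A by (simp add: row_contraction_iff)
qed (use A in \<open>simp add: row_contraction_iff\<close>)

lemma injective_mat_inverse:
  fixes R :: "complex mat"
  assumes R: "R \<in> carrier_mat p p"
    and inj: "\<forall>v. (\<forall>i<p. app p R v i = 0) \<longrightarrow> (\<forall>i<p. v i = 0)"
  obtains Q where "Q \<in> carrier_mat p p" "R * Q = 1\<^sub>m p" "Q * R = 1\<^sub>m p"
proof -
  have "det R \<noteq> 0"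
  proof
    assume "det R = 0"
    then obtain v where v: "v \<in> carrier_vec p" "v \<noteq> 0\<^sub>v p" "R *\<^sub>v v = 0\<^sub>v p"
      using det_0_iff_vec_prod_zero_field[OF R] by blast
    have "app p R (($) v) i = 0" if "i < p" for i
    proof -
      have "app p R (($) v) i = (R *\<^sub>v v) $ i"
        using R v(1) that by (simp add: app_def scalar_prod_def atLeast0LessThan)
      then show ?thesis using v that by simp
    qed
    then have "v $ i = 0" if "i < p" for i using inj[THEN spec, of "($) v"] that by blast
    then have "v = 0\<^sub>v p" using v(1) by (intro eq_vecI) auto
    with v show False by simp
  qed
  from det_non_zero_imp_unit[OF R this, of "()"] show thesis
    by (auto simp: Units_def ring_mat_def intro: that)
qed

section \<open>Positive elements of the dual and row contractions\<close>

context cuntz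
begin

text \<open>In tensor notation, the identity at \<open>delta_0\<close>, \<open>A i\<close> at each
  \<open>delta n S i\<close>, and the adjoint of \<open>A i\<close> at its involution.\<close>

definition dual_mat :: "nat \<Rightarrow> (nat \<Rightarrow> complex mat) \<Rightarrow> ('o \<Rightarrow> complex) mat" where
  "dual_mat p A = mat p p (\<lambda>(k, l). dual_fun (if k = l then 1 else 0) (\<lambda>i. A i $$ (k, l)) (\<lambda>i. cnj (A i $$ (l, k))))"

text \<open>\<open>compression\<close> for the row contraction \<open>s A\<close>: the maps
  \<open>B i\<close> are \<open>s\<close> times the adjoints of the \<open>A i\<close>, and
  \<open>s\<^sup>2 < 1\<close> is the rate of convergence.\<close>

lemma dilation_positive:
  assumes A: "row_contraction n p A" and s: "0 \<le> s" "s < 1"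
    and X: "X \<in> mat_positive q"
    and Xkl: "\<And>k l. k < q \<Longrightarrow> l < q \<Longrightarrow> X $$ (k, l) = lin (a k l) (b k l) (c k l)"
  shows "pos (\<Sum>k<q. \<Sum>l<q. a k l * ip p (z k) (z l)
      + of_real s * (\<Sum>i\<in>{1..n}. b k l i * form p (A i) (z k) (z l))
      + of_real s * (\<Sum>i\<in>{1..n}. c k l i * form p (mat_star (A i)) (z k) (z l)))"
proof -
  have Ai: "A i \<in> carrier_mat p p" if "i \<in> {1..n}" for i using A that by (simp add: row_contraction_iff)
  let ?A = "\<lambda>i. app p (mat_star (A i))"
  define T where "T = 1\<^sub>m p - mat_sum p (\<lambda>i. A i * mat_star (A i)) {1..n}"
  have T: "T \<in> mat_positive p" "T \<in> carrier_mat p p"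
    using A by (auto simp: row_contraction_def T_def minus_carrier_mat)
  have fT: "form p T v w = ip p v w - (\<Sum>i\<in>{1..n}. ip p (?A i v) (?A i w))" for v w
    unfolding T_def using Ai by (rule form_defect)
  \<comment> \<open>This is the defect of \<open>s A\<close>, written as a convex combination of the
    defect \<open>T\<close> of \<open>A\<close> and the identity, so it is positive. Its root
    \<open>Y\<close> completes the \<open>B i\<close> to an isometry.\<close>
  define D where "D = map_mat (scaleC (of_real (s\<^sup>2))) T + map_mat (scaleC (of_real (1 - s\<^sup>2))) (1\<^sub>m p)"
  have s2: "0 \<le> s\<^sup>2" "s\<^sup>2 < 1" using s by (auto simp: power_less_one_iff abs_square_less_1)
  have fD: "form p D v w = of_real (s\<^sup>2) *\<^sub>C form p T v w + of_real (1 - s\<^sup>2) *\<^sub>C ip p v w" for v w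
    unfolding D_def using T(2)
    by (subst form_add[of _ p]) (auto simp: form_scaleC form_one simp del: of_real_power of_real_diff)
  have "D \<in> mat_positive p"
    unfolding mat_positive_iff fD scaleC_of_real
    using T s2 by (auto simp: D_def mat_positive_iff intro!: pos_add pos_scaleR pos_ip)
  then obtain Y where Y: "D = mat_star Y * Y" "Y \<in> carrier_mat p p" by (auto simp: mat_positive_def)
  define B where "B i v a = of_real s *\<^sub>C ?A i v a" for i v a
  have ipB: "ip p (B i v) (B i w) = of_real (s\<^sup>2) * ip p (?A i v) (?A i w)" for i v w
    unfolding B_def[abs_def] ip_scaleC by (simp add: scaleC_complex_def power2_eq_square)
  have ipB_left: "ip p (B i v) w = of_real s * ip p (?A i v) w" for i v w
    using ip_scaleC[of p "of_real s" "?A i v" 1 w] by (simp add: B_def[abs_def] scaleR_conv_of_real)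
  have ipB_right: "ip p v (B i w) = of_real s * ip p v (?A i w)" for i v w
    using ip_scaleC[of p 1 v "of_real s" "?A i w"] by (simp add: B_def[abs_def] scaleR_conv_of_real)
  have "pos (\<Sum>k<q. \<Sum>l<q. a k l * ip p (z k) (z l) + (\<Sum>i\<in>{1..n}. b k l i * ip p (B i (z k)) (z l))
      + (\<Sum>i\<in>{1..n}. c k l i * ip p (z k) (B i (z l))))"
  proof (rule compression[where Y = "app p Y" and r = "s\<^sup>2", OF _ _ s2 X Xkl])
    fix y w
    have "ip p (app p Y y) (app p Y w) = form p D y w" using form_gram[OF Y(2), of y w] by (simp add: Y(1))
    then show "ip p (app p Y y) (app p Y w) + (\<Sum>i\<in>{1..n}. ip p (B i y) (B i w)) = ip p y w"
      unfolding fD fT by (simp add: ipB sum_distrib_left[symmetric] scaleC_complex_def algebra_simps del: of_real_power)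
  next
    fix y
    have "pos (form p T y y)" using T by (simp add: mat_positive_iff)
    then have "(\<Sum>i\<in>{1..n}. Re (ip p (?A i y) (?A i y))) \<le> Re (ip p y y)"
      using pos_complex[of "form p T y y"] by (simp add: fT)
    then show "(\<Sum>i\<in>{1..n}. Re (ip p (B i y) (B i y))) \<le> s\<^sup>2 * Re (ip p y y)"
      using s2(1) by (simp add: ipB sum_distrib_left[symmetric] mult_left_mono del: of_real_power)
  qed
  moreover have "form p (A i) v w = ip p (?A i v) w" "form p (mat_star (A i)) v w = ip p v (?A i w)"
    if "i \<in> {1..n}" for i v w
    using form_eq_ip[OF Ai[OF that]] by (auto simp: form_def)
  ultimately show ?thesis
    by (simp add: ipB_left ipB_right sum_distrib_left mult.left_commute)
qed

text \<open>The forms in \<open>dilation_positive\<close> depend continuously on \<open>s\<close>,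
  so the strict case passes to all row contractions as \<open>s\<close> tends to 1.\<close>

lemma dual_mat_positive:
  assumes A: "row_contraction n p A"
  shows "dual_mat p A \<in> cuntz_dual_positive n S p"
proof -
  have Ai: "A i \<in> carrier_mat p p" if "i \<in> {1..n}" for i using A that by (simp add: row_contraction_iff)
  then have dims: "dim_row (A i) = p" "dim_col (A i) = p" if "i \<in> {1..n}" for i using that by blast+
  let ?F = "dual_mat p A"
  have F: "?F \<in> carrier_mat p p" by (simp add: dual_mat_def)
  have "map_mat (\<lambda>x. map_mat (\<lambda>f. f x) ?F) X \<in> matalg_positive p q"
    if X: "X \<in> cuntz_system_positive n S q" for q X
  proof -
    let ?M = "map_mat (\<lambda>x. map_mat (\<lambda>f. f x) ?F) X"
    have Xp: "X \<in> mat_positive q" and Xc: "X \<in> carrier_mat q q"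
      using X by (auto simp: cuntz_system_positive_def mat_positive_iff)
    have "\<exists>a b c. X $$ (k, l) = lin a b c" if "k < q" "l < q" for k l
    proof -
      have "X $$ (k, l) \<in> elements_mat X" using Xc that by auto
      then show ?thesis using X by (auto simp: cuntz_system_positive_def system_iff)
    qed
    then obtain a b c where Xkl: "\<And>k l. k < q \<Longrightarrow> l < q \<Longrightarrow> X $$ (k, l) = lin (a k l) (b k l) (c k l)"
      by metis
    have Mkl: "?M $$ (k, l) = map_mat (\<lambda>f. f (X $$ (k, l))) ?F" if "k < q" "l < q" for k l
      using Xc that by simp
    have form_M: "form p (?M $$ (k, l)) v w = a k l * ip p v w
        + (\<Sum>i\<in>{1..n}. b k l i * form p (A i) v w) + (\<Sum>i\<in>{1..n}. c k l i * form p (mat_star (A i)) v w)"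
      if kl: "k < q" "l < q" for k l v w
    proof -
      have "form p (?M $$ (k, l)) v w = form p (map_mat (scaleC (a k l)) (1\<^sub>m p)) v w
        + (\<Sum>i\<in>{1..n}. form p (map_mat (scaleC (b k l i)) (A i)) v w)
        + (\<Sum>i\<in>{1..n}. form p (map_mat (scaleC (c k l i)) (mat_star (A i))) v w)"
      proof (rule form_sum_entries)
        fix r t assume rt: "r < p" "t < p"
        have "(\<Sum>i\<in>{1..n}. map_mat (scaleC (b k l i)) (A i) $$ (r, t)) = (\<Sum>i\<in>{1..n}. b k l i * A i $$ (r, t))"
          "(\<Sum>i\<in>{1..n}. map_mat (scaleC (c k l i)) (mat_star (A i)) $$ (r, t))
            = (\<Sum>i\<in>{1..n}. c k l i * cnj (A i $$ (t, r)))"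
          using dims rt by (auto intro!: sum.cong simp: scaleC_complex_def star_complex_def mat_star_def)
        then show "?M $$ (k, l) $$ (r, t) = map_mat (scaleC (a k l)) (1\<^sub>m p) $$ (r, t)
            + (\<Sum>i\<in>{1..n}. map_mat (scaleC (b k l i)) (A i) $$ (r, t))
            + (\<Sum>i\<in>{1..n}. map_mat (scaleC (c k l i)) (mat_star (A i)) $$ (r, t))"
          unfolding Mkl[OF kl] using rt by (simp add: dual_mat_def Xkl[OF kl] dual_fun_lin scaleC_complex_def)
      qed
      then show ?thesis using Ai by (simp add: form_scaleC form_one scaleC_complex_def)
    qed
    have "mat_flatten q p ?M \<in> mat_positive (q * p)"
      unfolding mat_positive_iff
    proof (intro conjI allI)
      fix v :: "nat \<Rightarrow> complex"
      \<comment> \<open>A vector of length \<open>q * p\<close> is cut into \<open>q\<close> blocks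
        of length \<open>p\<close>, matching the layout of \<open>mat_flatten\<close>.\<close>
      define z where "z k a = v (k * p + a)" for k a
      have "(\<lambda>r. z (r div p) (r mod p)) = v" by (simp add: z_def fun_eq_iff)
      then have eq: "form (q * p) (mat_flatten q p ?M) v v = (\<Sum>k<q. \<Sum>l<q. form p (?M $$ (k, l)) (z k) (z l))"
        using form_flatten[of q p ?M z] by simp
      define s where "s N = 1 + - inverse (real (Suc N))" for N
      have s: "0 \<le> s N" "s N < 1" for N by (auto simp: s_def field_simps)
      have lim: "s \<longlonglongrightarrow> 1"
        unfolding s_def[abs_def] by (rule LIMSEQ_inverse_real_of_nat_add_minus)
      have "(\<lambda>N. \<Sum>k<q. \<Sum>l<q. a k l * ip p (z k) (z l)
          + of_real (s N) * (\<Sum>i\<in>{1..n}. b k l i * form p (A i) (z k) (z l))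
          + of_real (s N) * (\<Sum>i\<in>{1..n}. c k l i * form p (mat_star (A i)) (z k) (z l)))
        \<longlonglongrightarrow> (\<Sum>k<q. \<Sum>l<q. a k l * ip p (z k) (z l)
          + of_real 1 * (\<Sum>i\<in>{1..n}. b k l i * form p (A i) (z k) (z l))
          + of_real 1 * (\<Sum>i\<in>{1..n}. c k l i * form p (mat_star (A i)) (z k) (z l)))"
        by (intro tendsto_intros lim)
      from pos_limit[OF dilation_positive[OF A s(1,2) Xp Xkl] this]
      show "pos (form (q * p) (mat_flatten q p ?M) v v)" unfolding eq by (simp add: form_M)
    qed (simp add: mat_flatten_def)
    then show ?thesis using Xc F by (auto simp: matalg_positive_def)
  qed
  then show ?thesis
    using F dual_fun_in_dual
    by (auto simp: cuntz_dual_positive_def completely_positive_def dual_mat_def)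
qed

lemma block_sum:
  "(\<Sum>k<Suc n. \<Sum>l<Suc n. g k l) = g 0 0 + (\<Sum>l\<in>{1..n}. g 0 l) + (\<Sum>k\<in>{1..n}. g k 0)
    + (\<Sum>k\<in>{1..n}. \<Sum>l\<in>{1..n}. g k l :: 'b::comm_monoid_add)"
proof -
  have eq: "{..<Suc n} = insert 0 {1..n}" by auto
  show ?thesis unfolding eq by (simp add: sum.distrib add_ac)
qed

text \<open>Apply a completely positive map to the positive block matrix of the row \<open>(1, S\<^sub>1, \<dots>, S\<^sub>n)\<close>.\<close>

lemma dual_positive_block:
  assumes F: "F \<in> cuntz_dual_positive n S p"
  defines "G \<equiv> \<lambda>x. map_mat (\<lambda>f. f x) F"
  shows "pos (form p (G 1) v v + (\<Sum>i\<in>{1..n}. form p (G (S i)) v (w i))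
    + (\<Sum>i\<in>{1..n}. form p (G (star (S i))) (w i) v) + (\<Sum>i\<in>{1..n}. form p (G 1) (w i) (w i)))"
proof -
  have Fc: "F \<in> carrier_mat p p" and Fd: "\<And>k l. k < p \<Longrightarrow> l < p \<Longrightarrow> F $$ (k, l) \<in> cuntz_dual n S"
    using F by (auto simp: cuntz_dual_positive_def)
  define R where "R k = (if k = 0 then 1 else S k)" for k
  \<comment> \<open>A Gram matrix, hence positive. Products of the form
    \<open>star (S i) * S j\<close> are 0 or 1 by orthogonality, so its entries do not leave the
    operator system.\<close>
  define X where "X = mat (Suc n) (Suc n) (\<lambda>(k, l). star (R k) * R l)"
  have Xkl: "X $$ (k, l) = (if k = 0 then if l = 0 then 1 else S l else if l = 0 then star (S k)
      else if k = l then 1 else 0)" if "k < Suc n" "l < Suc n" for k l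
    using that isometries[of k l] by (simp add: X_def R_def)
  have "X \<in> mat_positive (Suc n)"
    unfolding mat_positive_iff
  proof (intro conjI allI)
    fix u
    have "form (Suc n) X u u = (\<Sum>k<Suc n. \<Sum>l<Suc n. star (R k * u k) * (R l * u l))"
      unfolding form_altdef by (intro sum.cong refl) (simp add: X_def mult.assoc)
    also have "\<dots> = star (\<Sum>k<Suc n. R k * u k) * (\<Sum>l<Suc n. R l * u l)"
      unfolding star_sum sum_product ..
    finally show "pos (form (Suc n) X u u)" by (simp only: pos_star_mult)
  qed (simp add: X_def)
  moreover have zero: "(0::'o) = lin 0 (\<lambda>_. 0) (\<lambda>_. 0)" by (simp add: lin_def)
  have "elements_mat X \<subseteq> cuntz_system n S"
  proof
    fix x assume "x \<in> elements_mat X"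
    then obtain k l where kl: "k < Suc n" "l < Suc n" "x = X $$ (k, l)" by (auto simp: X_def)
    have "(0::'o) \<in> cuntz_system n S" using zero lin_in_system by metis
    then show "x \<in> cuntz_system n S"
      unfolding kl(3) Xkl[OF kl(1,2)] using kl(1,2) by (auto intro: generators_in_system)
  qed
  ultimately have "map_mat G X \<in> matalg_positive p (Suc n)"
    using F by (auto simp: cuntz_dual_positive_def completely_positive_def cuntz_system_positive_def G_def)
  then have flat: "mat_flatten (Suc n) p (map_mat G X) \<in> mat_positive (Suc n * p)"
    by (simp add: matalg_positive_def)
  define z where "z k = (if k = 0 then v else w k)" for k
  have "pos (form (Suc n * p) (mat_flatten (Suc n) p (map_mat G X)) (\<lambda>r. z (r div p) (r mod p))
      (\<lambda>r. z (r div p) (r mod p)))"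
    using flat unfolding mat_positive_iff by blast
  then have "pos (\<Sum>k<Suc n. \<Sum>l<Suc n. form p (map_mat G X $$ (k, l)) (z k) (z l))"
    unfolding form_flatten .
  also have "(\<Sum>k<Suc n. \<Sum>l<Suc n. form p (map_mat G X $$ (k, l)) (z k) (z l))
      = (\<Sum>k<Suc n. \<Sum>l<Suc n. form p (G (X $$ (k, l))) (z k) (z l))"
    by (intro sum.cong refl) (simp add: X_def)
  also have "\<dots> = form p (G 1) v v + (\<Sum>i\<in>{1..n}. form p (G (S i)) v (w i))
      + (\<Sum>i\<in>{1..n}. form p (G (star (S i))) (w i) v) + (\<Sum>k\<in>{1..n}. \<Sum>l\<in>{1..n}. if k = l then form p (G 1) (w k) (w k) else 0)"
  proof -
    have "(F $$ (k, l)) 0 = 0" if "k < p" "l < p" for k l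
      using dual_lin[OF Fd[OF that], of 0 "\<lambda>_. 0" "\<lambda>_. 0"] zero by simp
    then have G0: "form p (G 0) y y' = 0" for y y'
      using Fc by (simp add: form_altdef G_def)
    show ?thesis unfolding block_sum
      by (intro arg_cong2[of _ _ _ _ plus] sum.cong refl) (auto simp: Xkl z_def G0)
  qed
  also have "(\<Sum>k\<in>{1..n}. \<Sum>l\<in>{1..n}. if k = l then form p (G 1) (w k) (w k) else 0)
      = (\<Sum>i\<in>{1..n}. form p (G 1) (w i) (w i))"
    by (intro sum.cong refl) (simp add: sum.delta)
  finally show ?thesis .
qed

end

section \<open>Complete positivity of maps on the dual\<close>

lemma rotation_to_minus_cmod:
  obtains c where "cmod c = 1" "c * z = - of_real (cmod z)"
proof (cases "z = 0")
  case True
  then show thesis using that[of 1] by simp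
next
  case False
  show thesis
  proof (rule that[of "- (cnj z / of_real (cmod z))"])
    show "cmod (- (cnj z / of_real (cmod z))) = 1" using False by (simp add: norm_divide)
    have "cnj z * z = of_real (cmod z) * of_real (cmod z)"
      using complex_norm_square[of z] by (simp add: power2_eq_square mult.commute)
    then show "- (cnj z / of_real (cmod z)) * z = - of_real (cmod z)"
      using False by (simp add: field_simps)
  qed
qed

context cuntz
begin

context
  fixes \<phi> :: "('o \<Rightarrow> complex) \<Rightarrow> 'a::unital_cstar_algebra"
  assumes linear: "dual_linear n S \<phi>" and unital: "\<phi> (delta_0 n S) = 1"
begin

definition pencil :: "nat \<Rightarrow> (nat \<Rightarrow> complex mat) \<Rightarrow> 'a mat" where
  "pencil p A = mat_sum p (\<lambda>i. mat_tensor (A i) (\<phi> (delta n S i))) {1..n}"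

lemma pencil_carrier [simp]: "pencil p A \<in> carrier_mat p p"
  by (simp add: pencil_def)

lemma map_dual_mat:
  assumes sa: "\<And>i. i \<in> {1..n} \<Longrightarrow> \<phi> (dual_star (delta n S i)) = star (\<phi> (delta n S i))"
    and A: "\<And>i. i \<in> {1..n} \<Longrightarrow> A i \<in> carrier_mat p p"
  shows "map_mat \<phi> (dual_mat p A) = 1\<^sub>m p + pencil p A + mat_star (pencil p A)"
proof (rule eq_matI)
  fix k l assume "k < dim_row (1\<^sub>m p + pencil p A + mat_star (pencil p A))"
    "l < dim_col (1\<^sub>m p + pencil p A + mat_star (pencil p A))"
  then have kl: "k < p" "l < p" using pencil_carrier[of p A] by auto
  have dims: "dim_row (A i) = p" "dim_col (A i) = p" if "i \<in> {1..n}" for i using A[OF that] by auto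
  have entry: "pencil p A $$ (k, l) = (\<Sum>i\<in>{1..n}. A i $$ (k, l) *\<^sub>C \<phi> (delta n S i))" if "k < p" "l < p" for k l
    unfolding pencil_def mat_sum_def using that dims by (simp add: mat_tensor_def)
  have "map_mat \<phi> (dual_mat p A) $$ (k, l) = (if k = l then 1 else 0) *\<^sub>C 1
      + (\<Sum>i\<in>{1..n}. A i $$ (k, l) *\<^sub>C \<phi> (delta n S i))
      + (\<Sum>i\<in>{1..n}. cnj (A i $$ (l, k)) *\<^sub>C star (\<phi> (delta n S i)))"
    using kl sa by (simp add: dual_mat_def dual_linear_dual_fun[OF linear unital])
  then show "map_mat \<phi> (dual_mat p A) $$ (k, l) = (1\<^sub>m p + pencil p A + mat_star (pencil p A)) $$ (k, l)"
    using kl carrier_matD[OF pencil_carrier[of p A]]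
    by (simp add: mat_star_index[OF pencil_carrier] entry star_sum)
qed (use carrier_matD[OF pencil_carrier[of p A]] in \<open>auto simp: dual_mat_def\<close>)

lemma state_pencil:
  assumes f: "mat_state p f"
  shows "f (1\<^sub>m p + pencil p A + mat_star (pencil p A)) = 1 + f (pencil p A) + cnj (f (pencil p A))"
proof -
  have add: "f (X + Y) = f X + f Y" if "X \<in> carrier_mat p p" "Y \<in> carrier_mat p p" for X Y
    using f that by (simp add: mat_state_def)
  have "f (1\<^sub>m p) = 1" using f by (simp add: mat_state_def)
  then show ?thesis by (simp add: add mat_state_star[OF f])
qed

text \<open>Size 1 suffices. The row with a unimodular \<open>c\<close> in place \<open>i\<close>
  and 0 elsewhere is a row contraction, so \<open>1 + c *\<^sub>C ?b + cnj c *\<^sub>C ?d\<close> is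
  positive and in particular self-adjoint; \<open>c = 1\<close> and \<open>c = \<i>\<close> separate
  the two summands.\<close>

lemma self_adjoint_of_completely_positive:
  assumes cp: "completely_positive (cuntz_dual_positive n S) mat_positive \<phi>"
  shows "i \<in> {1..n} \<Longrightarrow> \<phi> (dual_star (delta n S i)) = star (\<phi> (delta n S i))"
proof -
  assume i: "i \<in> {1..n}"
  let ?b = "\<phi> (delta n S i)" and ?d = "\<phi> (dual_star (delta n S i))"
  have sa: "star (c *\<^sub>C ?b + cnj c *\<^sub>C ?d) = c *\<^sub>C ?b + cnj c *\<^sub>C ?d" if c: "cmod c = 1" for c
  proof -
    define A where "A j = mat 1 1 (\<lambda>_. if j = i then c else 0)" for j
    have "row_contraction n 1 A"
      unfolding row_contraction_iff
    proof (intro conjI allI ballI)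
      fix v
      have "c * cnj c = 1" using c complex_norm_square[of c] by simp
      moreover have "ip 1 (app 1 (mat_star (A j)) v) (app 1 (mat_star (A j)) v)
          = (if j = i then (c * cnj c) * ip 1 v v else 0)" for j
        by (simp add: ip_def app_def A_def mat_star_def star_complex_def algebra_simps)
      ultimately have "ip 1 (app 1 (mat_star (A j)) v) (app 1 (mat_star (A j)) v) = (if j = i then ip 1 v v else 0)" for j
        by simp
      then show "pos (ip 1 v v - (\<Sum>j\<in>{1..n}. ip 1 (app 1 (mat_star (A j)) v) (app 1 (mat_star (A j)) v)))"
        using i by (simp add: sum.delta)
    qed (simp add: A_def)
    from dual_mat_positive[OF this] have "map_mat \<phi> (dual_mat 1 A) \<in> mat_positive 1"
      using cp by (simp add: completely_positive_def)
    from mat_positive_star[OF this] have "star (map_mat \<phi> (dual_mat 1 A) $$ (0, 0)) = map_mat \<phi> (dual_mat 1 A) $$ (0, 0)"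
      using mat_star_index[of "map_mat \<phi> (dual_mat 1 A)" 1 1 0 0] by (simp add: dual_mat_def)
    moreover have "map_mat \<phi> (dual_mat 1 A) $$ (0, 0) = 1 + (c *\<^sub>C ?b + cnj c *\<^sub>C ?d)"
      using i by (simp add: dual_mat_def dual_linear_dual_fun[OF linear unital] A_def
          if_distrib[of "\<lambda>t. t *\<^sub>C _"] if_distrib[of cnj] sum.delta cong: if_cong)
    ultimately show ?thesis by simp
  qed
  have 1: "star ?b + star ?d = ?b + ?d" using sa[of 1] by simp
  have "(- \<i>) *\<^sub>C (star ?b - star ?d) = \<i> *\<^sub>C (?b - ?d)"
    using sa[of \<i>] by (simp add: scaleC_diff_right scaleC_minus_left)
  then have "\<i> *\<^sub>C ((- \<i>) *\<^sub>C (star ?b - star ?d)) = \<i> *\<^sub>C (\<i> *\<^sub>C (?b - ?d))" by simp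
  then have 2: "star ?b - star ?d = ?d - ?b" unfolding scaleC_scaleC by (simp add: scaleC_minus_left)
  have "star ?b + star ?b = (star ?b - star ?d) + (star ?b + star ?d)" by simp
  also have "\<dots> = ?d + ?d" unfolding 1 2 by simp
  finally show "?d = star ?b" by (simp flip: scaleR_2)
qed

lemma dual_self_adjoint_iff:
  "dual_self_adjoint n S \<phi> \<longleftrightarrow> (\<forall>i\<in>{1..n}. \<phi> (dual_star (delta n S i)) = star (\<phi> (delta n S i)))"
proof
  assume "dual_self_adjoint n S \<phi>"
  then show "\<forall>i\<in>{1..n}. \<phi> (dual_star (delta n S i)) = star (\<phi> (delta n S i))"
    using dual_fun_in_dual by (auto simp: dual_self_adjoint_def delta_eq)
next
  assume sa: "\<forall>i\<in>{1..n}. \<phi> (dual_star (delta n S i)) = star (\<phi> (delta n S i))"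
  show "dual_self_adjoint n S \<phi>"
    unfolding dual_self_adjoint_def
  proof
    fix f assume "f \<in> cuntz_dual n S"
    then have f: "f = dual_fun (f 1) (\<lambda>i. f (S i)) (\<lambda>i. f (star (S i)))" by (rule dual_eq_dual_fun) auto
    show "\<phi> (dual_star f) = star (\<phi> f)"
      using sa by (subst (1 2) f) (simp add: dual_star_dual_fun dual_linear_dual_fun[OF linear unital] star_sum algebra_simps)
  qed
qed

lemma numerical_radius_of_completely_positive:
  assumes cp: "completely_positive (cuntz_dual_positive n S) mat_positive \<phi>"
    and p: "1 \<le> p" and A: "row_contraction n p A"
  shows "numerical_radius p (pencil p A) \<le> ereal (1 / 2)"
  unfolding numerical_radius_def
proof (rule SUP_least)
  fix f :: "'a mat \<Rightarrow> complex" assume "f \<in> {f. mat_state p f}"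
  then have f: "mat_state p f" by simp
  \<comment> \<open>The rotation moves the value of the state to the worst position, the negative
    real axis. Positivity then reads \<open>0 \<le> 1 - 2 * cmod (f (pencil p A))\<close>, which is
    the origin of the bound 1/2.\<close>
  obtain c where c: "cmod c = 1" "c * f (pencil p A) = - of_real (cmod (f (pencil p A)))"
    by (rule rotation_to_minus_cmod)
  let ?A = "\<lambda>i. map_mat (scaleC c) (A i)"
  have Ai: "A i \<in> carrier_mat p p" if "i \<in> {1..n}" for i using A that by (simp add: row_contraction_iff)
  then have dims: "dim_row (A i) = p" "dim_col (A i) = p" if "i \<in> {1..n}" for i using that by blast+
  have "map_mat \<phi> (dual_mat p ?A) \<in> mat_positive p"
    using cp p dual_mat_positive[OF row_contraction_rotate[OF A c(1)]] by (simp add: completely_positive_def)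
  then have "0 \<le> Re (f (map_mat \<phi> (dual_mat p ?A)))" using f by (simp add: mat_state_def)
  also have "map_mat \<phi> (dual_mat p ?A) = 1\<^sub>m p + pencil p ?A + mat_star (pencil p ?A)"
    using Ai by (intro map_dual_mat self_adjoint_of_completely_positive[OF cp]) auto
  also have "f \<dots> = 1 + f (pencil p ?A) + cnj (f (pencil p ?A))" by (rule state_pencil[OF f])
  also have "pencil p ?A = map_mat (scaleC c) (pencil p A)"
    using dims by (intro eq_matI) (auto simp: pencil_def mat_sum_def mat_tensor_def scaleC_sum_right scaleC_scaleC scaleC_complex_def)
  also have "f \<dots> = - of_real (cmod (f (pencil p A)))"
    using f c(2) by (simp add: mat_state_def)
  finally show "ereal (cmod (f (pencil p A))) \<le> ereal (1 / 2)" by simp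
qed

text \<open>Every state takes the value \<open>1 + 2 * Re (f (pencil p A))\<close>, which the bound
  keeps nonnegative, and states detect positivity of self-adjoint matrices.\<close>

lemma positive_of_numerical_radius:
  assumes radius: "numerical_radius p (pencil p A) \<le> ereal (1 / 2)"
  shows "1\<^sub>m p + pencil p A + mat_star (pencil p A) \<in> mat_positive p"
proof (rule mat_positive_of_states)
  show "1\<^sub>m p + pencil p A + mat_star (pencil p A) \<in> carrier_mat p p" by simp
  show "mat_star (1\<^sub>m p + pencil p A + mat_star (pencil p A)) = 1\<^sub>m p + pencil p A + mat_star (pencil p A)"
    using carrier_matD[OF pencil_carrier[of p A]] by (intro eq_matI) (auto simp: mat_star_def algebra_simps)
  fix f :: "'a mat \<Rightarrow> complex" assume f: "mat_state p f"
  have "ereal (cmod (f (pencil p A))) \<le> numerical_radius p (pencil p A)"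
    unfolding numerical_radius_def using f by (intro SUP_upper) simp
  then have "cmod (f (pencil p A)) \<le> 1 / 2" using radius by (metis ereal_less_eq(3) order_trans)
  then show "0 \<le> Re (f (1\<^sub>m p + pencil p A + mat_star (pencil p A)))"
    using abs_Re_le_cmod[of "f (pencil p A)"] by (simp add: state_pencil[OF f])
qed

text \<open>With \<open>R\<^sup>* R = F(1) + e\<close> the coefficients of \<open>F\<close> are \<open>R\<^sup>* B\<^sub>i R\<close> for a row contraction \<open>B\<close>.\<close>

lemma dual_positive_factorization:
  assumes F: "F \<in> cuntz_dual_positive n S p" and e: "0 < e"
  defines "G \<equiv> \<lambda>x. map_mat (\<lambda>f. f x) F"
  obtains R B where "R \<in> carrier_mat p p" "row_contraction n p B"
    "mat_star R * R = G 1 + map_mat (scaleC (of_real e)) (1\<^sub>m p)"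
    "\<And>i. i \<in> {1..n} \<Longrightarrow> G (S i) = mat_star R * (B i * R)"
    "\<And>i. i \<in> {1..n} \<Longrightarrow> G (star (S i)) = mat_star (G (S i))"
proof -
  have G: "G x \<in> carrier_mat p p" for x using F by (simp add: G_def cuntz_dual_positive_def)
  have block: "pos (form p (G 1) v v + (\<Sum>i\<in>{1..n}. form p (G (S i)) v (w i))
      + (\<Sum>i\<in>{1..n}. form p (G (star (S i))) (w i) v) + (\<Sum>i\<in>{1..n}. form p (G 1) (w i) (w i)))" for v w
    unfolding G_def by (rule dual_positive_block[OF F])
  let ?z = "\<lambda>_::nat. 0::complex"
  have form0: "form p X ?z v = 0" "form p X v ?z = 0" for X v by (simp_all add: form_altdef)
  have pos1: "pos (form p (G 1) v v)" for v using block[of v "\<lambda>_. ?z"] by (simp add: form0)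
  have adj: "G (star (S i)) = mat_star (G (S i))" if i: "i \<in> {1..n}" for i
  proof -
    have sa: "star (form p (G (S i)) v w + form p (G (star (S i))) w v)
        = form p (G (S i)) v w + form p (G (star (S i))) w v" for v w
    proof -
      \<comment> \<open>Vectors that vanish except at index \<open>i\<close> isolate a single
        generator in the block inequality.\<close>
      let ?w = "\<lambda>j. if j = i then w else ?z"
      have "(\<Sum>j\<in>{1..n}. h j (?w j)) = h i w" if "\<And>j. h j ?z = 0" for h :: "nat \<Rightarrow> (nat \<Rightarrow> complex) \<Rightarrow> complex"
        using i that by (subst sum.remove[of _ i]) (auto intro!: sum.neutral)
      from this[of "\<lambda>j. form p (G (S j)) v"] this[of "\<lambda>j u. form p (G (star (S j))) u v"]
        this[of "\<lambda>j u. form p (G 1) u u"] block[of v ?w]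
      have "pos (form p (G 1) v v + form p (G (S i)) v w + form p (G (star (S i))) w v + form p (G 1) w w)"
        by (simp add: form0)
      from pos_self_adjoint[OF this] pos_self_adjoint[OF pos1[of v]] pos_self_adjoint[OF pos1[of w]]
      show ?thesis by (simp add: algebra_simps)
    qed
    \<comment> \<open>The block only makes the sum of the two off-diagonal terms real. Replacing
      \<open>w\<close> by \<open>\<i> w\<close> makes \<open>\<i>\<close> times their difference
      real too, so they are conjugate.\<close>
    have eq: "form p (G (star (S i))) w v = cnj (form p (G (S i)) v w)" for v w
    proof -
      let ?b = "form p (G (S i)) v w" and ?c = "form p (G (star (S i))) w v"
      have "cnj (?b + ?c) = ?b + ?c" using sa[of v w] by (simp add: star_complex_def)
      moreover have "cnj (\<i> * ?b - \<i> * ?c) = \<i> * ?b - \<i> * ?c"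
        using sa[of v "\<lambda>a. \<i> *\<^sub>C w a"] unfolding form_scaleC_right form_scaleC_left
        by (simp add: star_complex_def scaleC_complex_def)
      ultimately show ?thesis by (auto simp: complex_eq_iff)
    qed
    show ?thesis
    proof (rule eq_matI)
      fix k l assume "k < dim_row (mat_star (G (S i)))" "l < dim_col (mat_star (G (S i)))"
      then have kl: "k < p" "l < p" using carrier_matD[OF G[of "S i"]] by auto
      show "G (star (S i)) $$ (k, l) = mat_star (G (S i)) $$ (k, l)"
        using eq[of "unit_fun k" "unit_fun l"] kl mat_star_index[OF G kl]
        by (simp add: form_unit_fun star_complex_def)
    qed (use carrier_matD[OF G] in auto)
  qed
  \<comment> \<open>\<open>E\<close> dominates \<open>e\<close> times the identity, so any
    \<open>R\<close> with \<open>mat_star R * R = E\<close> is injective and hence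
    invertible.\<close>
  define E where "E = G 1 + map_mat (scaleC (of_real e)) (1\<^sub>m p)"
  have E: "form p E v w = form p (G 1) v w + of_real e * ip p v w" for v w
    unfolding E_def using G by (subst form_add[of _ p]) (auto simp: form_scaleC form_one scaleR_conv_of_real)
  have "E \<in> mat_positive p"
    unfolding mat_positive_iff
  proof (intro conjI allI)
    show "pos (form p E v v)" for v
      unfolding E using pos_add[OF pos1 pos_scaleR[OF less_imp_le[OF e] pos_ip]] by (simp add: scaleR_conv_of_real)
  qed (simp add: E_def)
  then obtain R where RE: "E = mat_star R * R" and R: "R \<in> carrier_mat p p" by (auto simp: mat_positive_def)
  have ipR: "ip p (app p R v) (app p R w) = form p (G 1) v w + of_real e * ip p v w" for v w
    using form_gram[OF R, of v w] by (simp add: RE[symmetric] E)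
  have "v i = 0" if v: "\<And>i. i < p \<Longrightarrow> app p R v i = 0" and i: "i < p" for v i
  proof -
    have "ip p (app p R v) (app p R v) = 0" using v by (simp add: ip_def)
    then have "form p (G 1) v v = - of_real e * ip p v v" by (simp add: ipR add_eq_0_iff)
    then have "e * Re (ip p v v) \<le> 0" using pos_complex[OF pos1[of v]] by simp
    then have "Re (ip p v v) \<le> 0" using e by (simp add: mult_le_0_iff)
    moreover have "Re (ip p v v) = (\<Sum>a<p. (cmod (v a))\<^sup>2)"
      by (simp add: ip_def star_complex_def cmod_power2 flip: power2_eq_square)
    ultimately have "(\<Sum>a<p. (cmod (v a))\<^sup>2) = 0" by (intro antisym sum_nonneg) auto
    then show "v i = 0" using i by (simp add: sum_nonneg_eq_0_iff)
  qed
  then have "\<forall>v. (\<forall>i<p. app p R v i = 0) \<longrightarrow> (\<forall>i<p. v i = 0)" by blast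
  from injective_mat_inverse[OF R this] obtain Q where
    Q: "Q \<in> carrier_mat p p" "R * Q = 1\<^sub>m p" "Q * R = 1\<^sub>m p" by blast
  \<comment> \<open>The only possible choice, since \<open>Q\<close> is the inverse of
    \<open>R\<close>.\<close>
  define B where "B i = mat_star Q * (G (S i) * Q)" for i
  have GQ: "G (S i) * Q \<in> carrier_mat p p" for i by (rule mult_carrier_mat[OF G Q(1)])
  have B: "B i \<in> carrier_mat p p" for i
    unfolding B_def by (rule mult_carrier_mat[OF mat_star_carrier[OF Q(1)] GQ])
  have BR: "G (S i) = mat_star R * (B i * R)" for i
  proof -
    have QR: "mat_star R * mat_star Q = 1\<^sub>m p"
      using mat_star_mult[OF Q(1) R] by (simp add: Q(3))
    have "mat_star R * (B i * R) = mat_star R * (mat_star Q * ((G (S i) * Q) * R))"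
      unfolding B_def by (subst assoc_mult_mat[OF mat_star_carrier[OF Q(1)] GQ R]) simp
    also have "(G (S i) * Q) * R = G (S i)"
      by (simp add: assoc_mult_mat[OF G Q(1) R] Q(3) right_mult_one_mat[OF G])
    also have "mat_star R * (mat_star Q * G (S i)) = G (S i)"
      by (simp add: assoc_mult_mat[OF mat_star_carrier[OF R] mat_star_carrier[OF Q(1)] G, symmetric] QR
          left_mult_one_mat[OF G])
    finally show ?thesis by simp
  qed
  have "row_contraction n p B"
    unfolding row_contraction_iff
  proof (intro conjI ballI allI B)
    fix v
    let ?q = "app p Q"
    \<comment> \<open>In the block inequality put Q v for v and - Q b_i for w_i. Up to the terms
      with \<open>e\<close>, the diagonal contributes |v|^2 + sum |b_i|^2 and the off-diagonal terms
      - 2 sum |b_i|^2, leaving the required |v|^2 - sum |b_i|^2. The terms with \<open>e\<close> are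
      subtracted from it, so they may be added back.\<close>
    define b where "b i = app p (mat_star (B i)) v" for i
    have RQ: "form p (G 1) (?q u) (?q u) = ip p u u - of_real e * ip p (?q u) (?q u)" for u
    proof -
      have "ip p (app p R (?q u)) (app p R (?q u)) = ip p u u"
        using app_mult[OF R Q(1), symmetric] by (intro ip_cong) (auto simp: Q(2) app_one)
      then show ?thesis using ipR[of "?q u" "?q u"] by (simp add: eq_diff_eq)
    qed
    have GB: "form p (G (S i)) (?q v) (?q (b i)) = ip p (b i) (b i)" for i
    proof -
      have "form p (G (S i)) (?q v) (?q (b i)) = form p (B i) v (b i)"
        unfolding B_def form_mat_star_mult[OF Q(1) GQ] form_mult[OF Q(1) G] ..
      then show ?thesis by (simp add: form_eq_ip[OF B] b_def)
    qed
    have GB': "form p (G (star (S i))) (?q (b i)) (?q v) = ip p (b i) (b i)" if "i \<in> {1..n}" for i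
      using GB[of i] by (simp add: adj[OF that] form_mat_star[OF G] star_ip)
    have "pos (form p (G 1) (?q v) (?q v) - (\<Sum>i\<in>{1..n}. form p (G (S i)) (?q v) (?q (b i)))
        - (\<Sum>i\<in>{1..n}. form p (G (star (S i))) (?q (b i)) (?q v))
        + (\<Sum>i\<in>{1..n}. form p (G 1) (?q (b i)) (?q (b i))))"
      using block[of "?q v" "\<lambda>i a. (- 1) *\<^sub>C ?q (b i) a"]
      unfolding form_scaleC_right form_scaleC_left by (simp add: scaleC_minus_left sum_negf)
    also have "\<dots> = ip p v v - (\<Sum>i\<in>{1..n}. ip p (b i) (b i))
        - e *\<^sub>R (ip p (?q v) (?q v) + (\<Sum>i\<in>{1..n}. ip p (?q (b i)) (?q (b i))))"
      by (simp add: RQ GB GB' sum_subtractf sum_distrib_left scaleR_conv_of_real algebra_simps)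
    finally have "pos (ip p v v - (\<Sum>i\<in>{1..n}. ip p (b i) (b i))
        - e *\<^sub>R (ip p (?q v) (?q v) + (\<Sum>i\<in>{1..n}. ip p (?q (b i)) (?q (b i)))))" .
    from pos_add[OF this pos_scaleR[OF less_imp_le[OF e], of "ip p (?q v) (?q v) + (\<Sum>i\<in>{1..n}. ip p (?q (b i)) (?q (b i)))"]]
    show "pos (ip p v v - (\<Sum>i\<in>{1..n}. ip p (app p (mat_star (B i)) v) (app p (mat_star (B i)) v)))"
      by (simp add: b_def pos_add pos_ip pos_sum)
  qed
  with R RE BR adj show thesis by (intro that[of R B]) (auto simp: E_def)
qed

text \<open>With \<open>u = app p (mat_tensor R 1) v\<close>, the form of
  \<open>1 + pencil + adjoint\<close> for the row contraction \<open>B\<close> at \<open>u\<close>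
  equals the form of \<open>map_mat \<phi> F\<close> at \<open>v\<close> plus \<open>e\<close> times
  \<open>ip p v v\<close>. The former is nonnegative by the radius condition, and \<open>e\<close>
  is arbitrary.\<close>

lemma completely_positive_of_numerical_radius:
  assumes sa: "\<And>i. i \<in> {1..n} \<Longrightarrow> \<phi> (dual_star (delta n S i)) = star (\<phi> (delta n S i))"
    and radius: "\<And>p A. 1 \<le> p \<Longrightarrow> row_contraction n p A \<Longrightarrow> numerical_radius p (pencil p A) \<le> ereal (1 / 2)"
  shows "completely_positive (cuntz_dual_positive n S) mat_positive \<phi>"
  unfolding completely_positive_def
proof (intro allI impI ballI)
  fix p F assume p: "1 \<le> (p::nat)" and F: "F \<in> cuntz_dual_positive n S p"
  let ?\<phi> = "\<lambda>i. \<phi> (delta n S i)"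
  define G where "G x = map_mat (\<lambda>f. f x) F" for x
  have Fc: "F \<in> carrier_mat p p" and Fd: "\<And>k l. k < p \<Longrightarrow> l < p \<Longrightarrow> F $$ (k, l) \<in> cuntz_dual n S"
    using F by (auto simp: cuntz_dual_positive_def)
  have G: "G x \<in> carrier_mat p p" for x using Fc by (simp add: G_def)
  have form_F: "form p (map_mat \<phi> F) v v = form p (mat_tensor (G 1) 1) v v
      + (\<Sum>i\<in>{1..n}. form p (mat_tensor (G (S i)) (?\<phi> i)) v v)
      + (\<Sum>i\<in>{1..n}. form p (mat_tensor (G (star (S i))) (star (?\<phi> i))) v v)" for v
  proof (rule form_sum_entries)
    fix k l assume kl: "k < p" "l < p"
    let ?f = "F $$ (k, l)"
    have "?f = dual_fun (?f 1) (\<lambda>i. ?f (S i)) (\<lambda>i. ?f (star (S i)))"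
      by (rule dual_eq_dual_fun[OF Fd[OF kl]]) auto
    then have "\<phi> ?f = ?f 1 *\<^sub>C 1 + (\<Sum>i\<in>{1..n}. ?f (S i) *\<^sub>C ?\<phi> i) + (\<Sum>i\<in>{1..n}. ?f (star (S i)) *\<^sub>C star (?\<phi> i))"
      using dual_linear_dual_fun[OF linear unital, of "?f 1" "\<lambda>i. ?f (S i)" "\<lambda>i. ?f (star (S i))"] sa by simp
    then show "map_mat \<phi> F $$ (k, l) = mat_tensor (G 1) 1 $$ (k, l)
        + (\<Sum>i\<in>{1..n}. mat_tensor (G (S i)) (?\<phi> i) $$ (k, l))
        + (\<Sum>i\<in>{1..n}. mat_tensor (G (star (S i))) (star (?\<phi> i)) $$ (k, l))"
      using Fc kl by (simp add: mat_tensor_def G_def)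
  qed
  show "map_mat \<phi> F \<in> mat_positive p"
    unfolding mat_positive_iff
  proof (intro conjI allI)
    fix v
    show "pos (form p (map_mat \<phi> F) v v)"
    proof (rule pos_perturb)
      fix e :: real assume e: "0 < e"
      obtain R B where R: "R \<in> carrier_mat p p" and B: "row_contraction n p B"
        and RR: "mat_star R * R = G 1 + map_mat (scaleC (of_real e)) (1\<^sub>m p)"
        and GB: "\<And>i. i \<in> {1..n} \<Longrightarrow> G (S i) = mat_star R * (B i * R)"
        and adj: "\<And>i. i \<in> {1..n} \<Longrightarrow> G (star (S i)) = mat_star (G (S i))"
        using dual_positive_factorization[OF F e] unfolding G_def by blast
      have Bi: "B i \<in> carrier_mat p p" if "i \<in> {1..n}" for i using B that by (simp add: row_contraction_iff)
      define u where "u = app p (mat_tensor R 1) v"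
      have "form p (1\<^sub>m p + pencil p B + mat_star (pencil p B)) u u
          = ip p u u + form p (pencil p B) u u + star (form p (pencil p B) u u)"
        by (simp add: form_add[of _ p] form_one form_mat_star)
      then have "pos (ip p u u + form p (pencil p B) u u + star (form p (pencil p B) u u))"
        using positive_of_numerical_radius[OF radius[OF p B]] by (metis mat_positive_iff)
      also have "form p (pencil p B) u u = (\<Sum>i\<in>{1..n}. form p (mat_tensor (G (S i)) (?\<phi> i)) v v)"
        unfolding pencil_def form_mat_sum u_def
        by (intro sum.cong refl) (simp add: form_tensor_conj[OF R Bi] GB)
      also have "star \<dots> = (\<Sum>i\<in>{1..n}. form p (mat_tensor (G (star (S i))) (star (?\<phi> i))) v v)"
        unfolding star_sum
        by (intro sum.cong refl) (simp add: adj mat_star_tensor[symmetric] form_mat_star G)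
      also have "ip p u u = form p (mat_tensor (G 1) 1) v v + e *\<^sub>R ip p v v"
      proof -
        have "mat_tensor (1\<^sub>m p) (1::'a) = 1\<^sub>m p" by (rule eq_matI) (auto simp: mat_tensor_def)
        then have "ip p u u = form p (mat_tensor (mat_star R * (1\<^sub>m p * R)) 1) v v"
          using form_tensor_conj[OF R one_carrier_mat, of "1::'a" v] by (simp add: u_def form_one)
        also have "mat_star R * (1\<^sub>m p * R) = G 1 + map_mat (scaleC (of_real e)) (1\<^sub>m p)"
          using R by (simp add: RR)
        also have "mat_tensor \<dots> (1::'a) = mat_tensor (G 1) 1 + map_mat (scaleC (of_real e)) (1\<^sub>m p)"
          using carrier_matD[OF G[of 1]] by (intro eq_matI) (auto simp: mat_tensor_def scaleC_add_left scaleC_complex_def)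
        finally show ?thesis using G by (simp add: form_add[of _ p] form_scaleC form_one)
      qed
      finally show "pos (form p (map_mat \<phi> F) v v + e *\<^sub>R ip p v v)" by (simp add: form_F algebra_simps)
    qed
  qed (use Fc in simp)
qed

end

end

theorem proposition5p2:
  fixes n :: nat
    and S :: "nat \<Rightarrow> 'o::unital_cstar_algebra"
    and \<phi> :: "('o \<Rightarrow> complex) \<Rightarrow> 'a::unital_cstar_algebra"
  assumes "2 \<le> n"
    and "cuntz_algebra n S"
    and "dual_linear n S \<phi>"
    and "\<phi> (delta_0 n S) = 1"
  shows "completely_positive (cuntz_dual_positive n S) mat_positive \<phi> \<longleftrightarrow>
    dual_self_adjoint n S \<phi> \<and>
    (\<forall>p\<ge>1. \<forall>A. row_contraction n p A \<longrightarrow>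
       numerical_radius p (mat_sum p (\<lambda>i. mat_tensor (A i) (\<phi> (delta n S i))) {1..n}) \<le> ereal (1 / 2))"
proof -
  interpret cuntz n S using assms(1,2) by unfold_locales
  note lu = assms(3,4)
  show ?thesis
    unfolding dual_self_adjoint_iff[OF lu] pencil_def[OF lu, symmetric]
    using self_adjoint_of_completely_positive[OF lu] numerical_radius_of_completely_positive[OF lu]
      completely_positive_of_numerical_radius[OF lu]
    by blast
qed

end
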